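(* $\mathcal{J}_N$ is the only non-trivial closed ideal of the $C^*$-algebra $\mathcal{S}_N$ (i.e. the only closed ideal of $\mathcal{S}_N$ different from $\{0\}$ and $\mathcal{S}_N$).
   Context: Let $N\ge 2$ be an integer and $\mathbb{Z}^+=\{0,1,2,\dots\}$. "Ideal" means two-sided ideal. For $n\ge 1$, $P_n$ is the orthogonal projection of $l^2(\mathbb{Z}^+)$ onto the span of the first $n$ standard basis vectors. For $i\in\{0,\dots,N-1\}$, $S_i\in L(l^2(\mathbb{Z}^+))$ is the isometry $(S_i x)_{rN+i}=x_r$ for $r\ge 0$, with all other components of $S_ix$ equal to $0$. The concrete Cuntz algebra $\mathcal{O}_N$ is the smallest $C^*$-subalgebra of $L(l^2(\mathbb{Z}^+))$ containing $S_0,\dots,S_{N-1}$. Let $\mathcal{F}_\eta$ (with $\eta(n)=N^n$) be the $C^*$-algebra of all bounded sequences $(A_n)_{n\ge 0}$ with $A_n\in\mathbb{C}^{N^n\times N^n}$ (identified with operators on $\mathrm{im}\,P_{N^n}$), with entrywise operations and supremum norm, and $\mathcal{G}_\eta$ its closed ideal of sequences with $\|A_n\|\to 0$. $\mathcal{S}_\eta(\mathcal{O}_N)$ is the smallest $C^*$-subalgebra of $\mathcal{F}_\eta$ containing all sequences $(P_{N^n}AP_{N^n})_{n\ge0}$ with $A\in\mathcal{O}_N$; it contains $\mathcal{G}_\eta$, and $\mathcal{S}_N:=\mathcal{S}_\eta(\mathcal{O}_N)/\mathcal{G}_\eta$. Let $e$ be the identity of $\mathcal{S}_N$, $s_i:=(P_{N^n}S_iP_{N^n})_{n\ge0}+\mathcal{G}_\eta$,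 and $p_1:=s_0^*s_0$. $\mathcal{J}_N$ is the smallest closed ideal of $\mathcal{S}_N$ containing $e-p_1$. *)

theory Defs
  imports "HOL-Analysis.Analysis" "HOL-Algebra.QuotRing" "HOL-Algebra.Module"
begin

section \<open>The Hilbert space of square-summable complex sequences\<close>

typedef ell2 = "{x :: nat \<Rightarrow> complex. summable (\<lambda>n. (cmod (x n))\<^sup>2)}"
  morphisms coord Abs_ell2
  by (rule exI[of _ "\<lambda>_. 0"]) simp

setup_lifting type_definition_ell2

lemma ell2_eqI: "(\<And>n. coord x n = coord y n) \<Longrightarrow> x = y"
  by (simp add: coord_inject[symmetric] ext)

lemma summable_coord: "summable (\<lambda>n. (cmod (coord x n))\<^sup>2)"
  using coord[of x] by simp

lemma summable_sq_add:
  fixes x y :: "nat \<Rightarrow> complex"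
  assumes "summable (\<lambda>n. (cmod (x n))\<^sup>2)" "summable (\<lambda>n. (cmod (y n))\<^sup>2)"
  shows "summable (\<lambda>n. (cmod (x n + y n))\<^sup>2)"
proof (rule summable_comparison_test')
  show "summable (\<lambda>n. 2 * (cmod (x n))\<^sup>2 + 2 * (cmod (y n))\<^sup>2)"
    using assms by (intro summable_add summable_mult)
  fix n
  have "(cmod (x n + y n))\<^sup>2 \<le> (cmod (x n) + cmod (y n))\<^sup>2"
    by (intro power_mono norm_triangle_ineq) auto
  also have "\<dots> \<le> 2 * (cmod (x n))\<^sup>2 + 2 * (cmod (y n))\<^sup>2"
    using sum_squares_bound[of "cmod (x n)" "cmod (y n)"] by (simp add: power2_sum)
  finally show "norm ((cmod (x n + y n))\<^sup>2) \<le> 2 * (cmod (x n))\<^sup>2 + 2 * (cmod (y n))\<^sup>2"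
    by simp
qed

lemma summable_sq_mult:
  fixes x :: "nat \<Rightarrow> complex"
  assumes "summable (\<lambda>n. (cmod (x n))\<^sup>2)"
  shows "summable (\<lambda>n. (cmod (c * x n))\<^sup>2)"
  using summable_mult[OF assms, of "(cmod c)\<^sup>2"] by (simp add: norm_mult power_mult_distrib)

lemma summable_prod:
  fixes x y :: "nat \<Rightarrow> complex"
  assumes "summable (\<lambda>n. (cmod (x n))\<^sup>2)" "summable (\<lambda>n. (cmod (y n))\<^sup>2)"
  shows "summable (\<lambda>n. cmod (x n) * cmod (y n))"
proof (rule summable_comparison_test')
  show "summable (\<lambda>n. (cmod (x n))\<^sup>2 + (cmod (y n))\<^sup>2)"
    using assms by (intro summable_add)
  fix n
  show "norm (cmod (x n) * cmod (y n)) \<le> (cmod (x n))\<^sup>2 + (cmod (y n))\<^sup>2"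
  proof -
    have "2 * (cmod (x n) * cmod (y n)) \<le> (cmod (x n))\<^sup>2 + (cmod (y n))\<^sup>2"
      using sum_squares_bound[of "cmod (x n)" "cmod (y n)"] by simp
    moreover have "0 \<le> cmod (x n) * cmod (y n)" by simp
    ultimately show ?thesis unfolding real_norm_def by linarith
  qed
qed

instantiation ell2 :: real_vector
begin

lift_definition zero_ell2 :: ell2 is "\<lambda>_. 0" by simp
lift_definition plus_ell2 :: "ell2 \<Rightarrow> ell2 \<Rightarrow> ell2" is "\<lambda>x y n. x n + y n"
  by (rule summable_sq_add)
lift_definition uminus_ell2 :: "ell2 \<Rightarrow> ell2" is "\<lambda>x n. - x n" by simp
lift_definition minus_ell2 :: "ell2 \<Rightarrow> ell2 \<Rightarrow> ell2" is "\<lambda>x y n. x n - y n"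
  using summable_sq_add[where y = "\<lambda>n. - y n" for y :: "nat \<Rightarrow> complex"] by simp
lift_definition scaleR_ell2 :: "real \<Rightarrow> ell2 \<Rightarrow> ell2" is "\<lambda>r x n. r *\<^sub>R x n"
  unfolding scaleR_conv_of_real by (rule summable_sq_mult)

instance
proof
  fix x y z :: ell2 and a b :: real
  show "x + y + z = x + (y + z)" by transfer (simp add: add.assoc)
  show "x + y = y + x" by transfer (simp add: add.commute)
  show "0 + x = x" by transfer simp
  show "- x + x = 0" by transfer simp
  show "x - y = x + - y" by transfer simp
  show "a *\<^sub>R (x + y) = a *\<^sub>R x + a *\<^sub>R y" by transfer (simp add: scaleR_add_right)
  show "(a + b) *\<^sub>R x = a *\<^sub>R x + b *\<^sub>R x" by transfer (simp add: scaleR_add_left)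
  show "a *\<^sub>R b *\<^sub>R x = (a * b) *\<^sub>R x" by transfer simp
  show "1 *\<^sub>R x = x" by transfer simp
qed

end

instantiation ell2 :: real_inner
begin

definition inner_ell2 :: "ell2 \<Rightarrow> ell2 \<Rightarrow> real" where
  "inner_ell2 x y = (\<Sum>n. coord x n \<bullet> coord y n)"
definition norm_ell2 :: "ell2 \<Rightarrow> real" where
  "norm_ell2 x = sqrt (\<Sum>n. (cmod (coord x n))\<^sup>2)"
definition sgn_ell2 :: "ell2 \<Rightarrow> ell2" where
  "sgn_ell2 x = x /\<^sub>R norm x"
definition dist_ell2 :: "ell2 \<Rightarrow> ell2 \<Rightarrow> real" where
  "dist_ell2 x y = norm (x - y)"
definition uniformity_ell2 :: "(ell2 \<times> ell2) filter" where
  "uniformity_ell2 = (INF e\<in>{0<..}. principal {(x, y). dist x y < e})"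
definition open_ell2 :: "ell2 set \<Rightarrow> bool" where
  "open_ell2 U = (\<forall>x\<in>U. \<forall>\<^sub>F (x', y) in uniformity. x' = x \<longrightarrow> y \<in> U)"

lemma summable_inner: "summable (\<lambda>n. coord x n \<bullet> coord y n)"
  by (rule summable_comparison_test'[OF summable_prod[OF summable_coord[of x] summable_coord[of y]]])
     (simp add: Cauchy_Schwarz_ineq2)

instance
proof
  fix x y z :: ell2 and a b :: real
  show "sgn x = x /\<^sub>R norm x" by (rule sgn_ell2_def)
  show "dist x y = norm (x - y)" by (rule dist_ell2_def)
  show "(uniformity :: (ell2 \<times> ell2) filter) = (INF e\<in>{0<..}. principal {(x, y). dist x y < e})"
    by (rule uniformity_ell2_def)
  show "open U \<longleftrightarrow> (\<forall>x\<in>U. \<forall>\<^sub>F (x', y) in uniformity. x' = x \<longrightarrow> y \<in> U)" for U :: "ell2 set"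
    by (rule open_ell2_def)
  show "inner x y = inner y x" by (simp add: inner_ell2_def inner_commute)
  show "inner (x + y) z = inner x z + inner y z"
    by (simp add: inner_ell2_def plus_ell2.rep_eq inner_add_left suminf_add summable_inner)
  show "inner (a *\<^sub>R x) y = a * inner x y"
    by (simp add: inner_ell2_def scaleR_ell2.rep_eq suminf_mult summable_inner)
  show "0 \<le> inner x x"
    unfolding inner_ell2_def by (intro suminf_nonneg summable_inner) simp
  have "inner x x = 0 \<longleftrightarrow> (\<forall>n. coord x n \<bullet> coord x n = 0)"
    unfolding inner_ell2_def by (rule suminf_eq_zero_iff) (auto simp: summable_inner)
  also have "\<dots> \<longleftrightarrow> x = 0"
    by (auto intro: ell2_eqI simp: zero_ell2.rep_eq)
  finally show "inner x x = 0 \<longleftrightarrow> x = 0" .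
  show "norm x = sqrt (inner x x)"
    by (simp add: norm_ell2_def inner_ell2_def power2_norm_eq_inner)
qed

end

definition cinner :: "ell2 \<Rightarrow> ell2 \<Rightarrow> complex" where
  "cinner x y = (\<Sum>n. coord x n * cnj (coord y n))"

lemma norm_ell2_sq: "(norm x)\<^sup>2 = (\<Sum>n. (cmod (coord x n))\<^sup>2)"
  by (simp add: norm_ell2_def suminf_nonneg summable_coord)

section \<open>Bounded operators\<close>

lift_definition scaleC :: "complex \<Rightarrow> ell2 \<Rightarrow> ell2" (infixr "*\<^sub>C" 75) is "\<lambda>c x n. c * x n"
  by (rule summable_sq_mult)

lemma bounded_linear_ell2I:
  assumes "\<And>x y. f (x + y) = f x + f y" "\<And>r x. f (r *\<^sub>R x) = r *\<^sub>R f x"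
    and "0 \<le> K"
    and "\<And>x. (\<Sum>n. (cmod (coord (f x) n))\<^sup>2) \<le> K\<^sup>2 * (\<Sum>n. (cmod (coord x n))\<^sup>2)"
  shows "bounded_linear (f :: ell2 \<Rightarrow> ell2)"
proof (rule bounded_linear_intro)
  fix x
  have "(norm (f x))\<^sup>2 \<le> (norm x * K)\<^sup>2"
    using assms(4)[of x] by (simp add: norm_ell2_sq power_mult_distrib mult.commute)
  then show "norm (f x) \<le> norm x * K"
    using assms(3) by (simp add: power2_le_iff_abs_le)
qed (use assms in auto)

lift_definition scaleC_op :: "complex \<Rightarrow> ell2 \<Rightarrow>\<^sub>L ell2" is "\<lambda>c x. c *\<^sub>C x"
proof (rule bounded_linear_ell2I)
  fix c :: complex and x :: ell2
  show "(\<Sum>n. (cmod (coord (c *\<^sub>C x) n))\<^sup>2) \<le> (cmod c)\<^sup>2 * (\<Sum>n. (cmod (coord x n))\<^sup>2)"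
    by (simp add: scaleC.rep_eq norm_mult power_mult_distrib suminf_mult summable_coord)
qed (auto intro!: ell2_eqI simp: scaleC.rep_eq plus_ell2.rep_eq scaleR_ell2.rep_eq algebra_simps)

text \<open>The orthogonal projection onto the span of the first \<open>n\<close> standard basis vectors.\<close>

lift_definition trunc :: "nat \<Rightarrow> ell2 \<Rightarrow> ell2" is "\<lambda>n x k. if k < n then x k else 0"
  by (rule summable_comparison_test') auto

lift_definition proj :: "nat \<Rightarrow> ell2 \<Rightarrow>\<^sub>L ell2" is trunc
proof (rule bounded_linear_ell2I)
  fix n :: nat and x :: ell2
  show "(\<Sum>k. (cmod (coord (trunc n x) k))\<^sup>2) \<le> 1\<^sup>2 * (\<Sum>k. (cmod (coord x k))\<^sup>2)"
    using suminf_le[OF _ summable_coord summable_coord, of "trunc n x" x]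
    by (simp add: trunc.rep_eq)
qed (auto intro!: ell2_eqI simp: trunc.rep_eq plus_ell2.rep_eq scaleR_ell2.rep_eq)

lemma spread_bound:
  fixes x :: "nat \<Rightarrow> complex"
  assumes "summable (\<lambda>n. (cmod (x n))\<^sup>2)"
  shows "(\<lambda>m. (cmod (if m mod N = i then x (m div N) else 0))\<^sup>2) summable_on UNIV" (is ?A)
    and "(\<Sum>m. (cmod (if m mod N = i then x (m div N) else 0))\<^sup>2) \<le> (\<Sum>n. (cmod (x n))\<^sup>2)" (is ?B)
proof -
  let ?f = "\<lambda>m. (cmod (if m mod N = i then x (m div N) else 0))\<^sup>2"
  let ?S = "{m. m mod N = i}"
  have inj: "inj_on (\<lambda>m. m div N) ?S"
    by (rule inj_onI) (metis (mono_tags, lifting) mem_Collect_eq mult_div_mod_eq)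
  have sx: "(\<lambda>n. (cmod (x n))\<^sup>2) summable_on UNIV"
    using assms by (intro norm_summable_imp_summable_on) simp
  have sS: "(\<lambda>n. (cmod (x n))\<^sup>2) summable_on ((\<lambda>m. m div N) ` ?S)"
    using sx by (rule summable_on_subset_banach) simp
  have "((\<lambda>n. (cmod (x n))\<^sup>2) \<circ> (\<lambda>m. m div N)) summable_on ?S"
    using summable_on_reindex[OF inj] sS by blast
  then have fS: "?f summable_on ?S"
    by (rule summable_on_cong[THEN iffD1, rotated]) simp
  show A: ?A
    using fS by (subst summable_on_cong_neutral[where T = ?S and g = ?f]) auto
  have "(\<Sum>m. ?f m) = infsum ?f UNIV"
    using has_sum_imp_sums[OF has_sum_infsum[OF A]] by (simp add: sums_iff)
  also have "\<dots> = infsum ?f ?S" by (rule infsum_cong_neutral) auto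
  also have "\<dots> = infsum ((\<lambda>n. (cmod (x n))\<^sup>2) \<circ> (\<lambda>m. m div N)) ?S"
    by (rule infsum_cong) simp
  also have "\<dots> = infsum (\<lambda>n. (cmod (x n))\<^sup>2) ((\<lambda>m. m div N) ` ?S)"
    by (rule infsum_reindex[OF inj, symmetric])
  also have "\<dots> \<le> infsum (\<lambda>n. (cmod (x n))\<^sup>2) UNIV"
    using sS sx by (rule infsum_mono_neutral) auto
  also have "\<dots> = (\<Sum>n. (cmod (x n))\<^sup>2)"
    using has_sum_imp_sums[OF has_sum_infsum[OF sx]] by (simp add: sums_iff)
  finally show ?B .
qed

lift_definition spread :: "nat \<Rightarrow> nat \<Rightarrow> ell2 \<Rightarrow> ell2" is
  "\<lambda>N i x m. if m mod N = i then x (m div N) else 0"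
  using has_sum_imp_sums[OF has_sum_infsum[OF spread_bound(1)]] by (auto simp: sums_iff)

text \<open>\<open>cuntz_iso N i\<close> maps \<open>x\<close> to the sequence with entry \<open>x\<^sub>r\<close> at \<open>r * N + i\<close> and \<open>0\<close> elsewhere;
  it is the intended isometry for \<open>i < N\<close> only.\<close>

lift_definition cuntz_iso :: "nat \<Rightarrow> nat \<Rightarrow> ell2 \<Rightarrow>\<^sub>L ell2" is spread
proof (rule bounded_linear_ell2I)
  fix N i :: nat and x :: ell2
  show "(\<Sum>k. (cmod (coord (spread N i x) k))\<^sup>2) \<le> 1\<^sup>2 * (\<Sum>k. (cmod (coord x k))\<^sup>2)"
    using spread_bound(2)[OF summable_coord] by (simp add: spread.rep_eq)
qed (auto intro!: ell2_eqI simp: spread.rep_eq plus_ell2.rep_eq scaleR_ell2.rep_eq)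

lemma coord_cuntz_iso:
  assumes "i < N"
  shows "coord (blinfun_apply (cuntz_iso N i) x) (r * N + i) = coord x r"
    and "(\<And>r. m \<noteq> r * N + i) \<Longrightarrow> coord (blinfun_apply (cuntz_iso N i) x) m = 0"
  using assms
   apply (simp add: cuntz_iso.rep_eq spread.rep_eq)
  apply (simp add: cuntz_iso.rep_eq spread.rep_eq) 
  by (metis div_mult_mod_eq)

text \<open>For complex-linear \<open>A\<close> the adjoint exists and is unique by the Riesz representation theorem;
  for other real-linear \<open>A\<close> the value is unspecified.\<close>

definition adj :: "(ell2 \<Rightarrow>\<^sub>L ell2) \<Rightarrow> (ell2 \<Rightarrow>\<^sub>L ell2)" where
  "adj A = (THE B. \<forall>x y. cinner (blinfun_apply A x) y = cinner x (blinfun_apply B y))"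

section \<open>Complex normed algebras with involution\<close>

record 'a star_algebra = "(complex, 'a) module" +
  star :: "'a \<Rightarrow> 'a"
  nrm :: "'a \<Rightarrow> real"

definition norm_closed_in :: "'a set \<Rightarrow> ('a, 'm) star_algebra_scheme \<Rightarrow> bool" where
  "norm_closed_in B A \<longleftrightarrow> B \<subseteq> carrier A \<and>
     (\<forall>f. \<forall>a \<in> carrier A. (\<forall>n::nat. f n \<in> B) \<and> (\<lambda>n. nrm A (f n \<ominus>\<^bsub>A\<^esub> a)) \<longlonglongrightarrow> 0 \<longrightarrow> a \<in> B)"

definition cstar_subalgebra :: "'a set \<Rightarrow> ('a, 'm) star_algebra_scheme \<Rightarrow> bool" where
  "cstar_subalgebra B A \<longleftrightarrow> norm_closed_in B A \<and> \<zero>\<^bsub>A\<^esub> \<in> B \<and>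
     (\<forall>a\<in>B. \<forall>b\<in>B. a \<oplus>\<^bsub>A\<^esub> b \<in> B \<and> a \<otimes>\<^bsub>A\<^esub> b \<in> B) \<and>
     (\<forall>a\<in>B. star A a \<in> B \<and> (\<forall>c. c \<odot>\<^bsub>A\<^esub> a \<in> B))"

definition cstar_generated :: "('a, 'm) star_algebra_scheme \<Rightarrow> 'a set \<Rightarrow> 'a set" where
  "cstar_generated A X = \<Inter>{B. cstar_subalgebra B A \<and> X \<subseteq> B}"

text \<open>The algebra to which this is applied is unital, so a two-sided ring ideal is automatically closed
  under multiplication by complex scalars.\<close>

definition closed_ideal :: "'a set \<Rightarrow> ('a, 'm) star_algebra_scheme \<Rightarrow> bool" where
  "closed_ideal I A \<longleftrightarrow> ideal I A \<and> norm_closed_in I A"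

definition closed_ideal_generated :: "('a, 'm) star_algebra_scheme \<Rightarrow> 'a set \<Rightarrow> 'a set" where
  "closed_ideal_generated A X = \<Inter>{I. closed_ideal I A \<and> X \<subseteq> I}"

text \<open>The quotient ring with the induced scalar multiplication and involution and the quotient
  norm.\<close>

definition quotient_algebra ::
    "('a, 'm) star_algebra_scheme \<Rightarrow> 'a set \<Rightarrow> 'a set star_algebra" where
  "quotient_algebra A I =
     \<lparr>carrier = carrier (A Quot I), mult = mult (A Quot I), one = one (A Quot I),
      zero = zero (A Quot I), add = add (A Quot I),
      smult = (\<lambda>c X. \<Union>x\<in>X. I +>\<^bsub>A\<^esub> (c \<odot>\<^bsub>A\<^esub> x)),
      star = (\<lambda>X. \<Union>x\<in>X. I +>\<^bsub>A\<^esub> star A x),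
      nrm = (\<lambda>X. INF x\<in>X. nrm A x)\<rparr>"

section \<open>The algebras of the statement\<close>

text \<open>The type of bounded linear maps is real-linear; the carrier selects the complex-linear ones.\<close>

definition L_ell2 :: "(ell2 \<Rightarrow>\<^sub>L ell2) star_algebra" where
  "L_ell2 =
     \<lparr>carrier = {A. \<forall>c x. blinfun_apply A (c *\<^sub>C x) = c *\<^sub>C blinfun_apply A x},
      mult = (o\<^sub>L), one = id_blinfun, zero = 0, add = (+),
      smult = (\<lambda>c A. scaleC_op c o\<^sub>L A), star = adj, nrm = norm\<rparr>"

definition cuntz :: "nat \<Rightarrow> (ell2 \<Rightarrow>\<^sub>L ell2) set" where
  "cuntz N = cstar_generated L_ell2 (cuntz_iso N ` {..<N})"

text \<open>A matrix of order \<open>m\<close> is identified with an operator on the range of \<open>proj m\<close>, and the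
  latter with the operator \<open>A\<close> on the whole space that satisfies \<open>proj m A proj m = A\<close>. This
  respects the operations and the norm, and the identity matrix becomes \<open>proj m\<close>.\<close>

definition F_alg :: "(nat \<Rightarrow> nat) \<Rightarrow> (nat \<Rightarrow> ell2 \<Rightarrow>\<^sub>L ell2) star_algebra" where
  "F_alg \<eta> =
     \<lparr>carrier = {A. (\<forall>n. A n \<in> carrier L_ell2 \<and> proj (\<eta> n) o\<^sub>L A n o\<^sub>L proj (\<eta> n) = A n) \<and>
                    bounded (range A)},
      mult = (\<lambda>A B n. A n \<otimes>\<^bsub>L_ell2\<^esub> B n), one = (\<lambda>n. proj (\<eta> n)),
      zero = (\<lambda>n. \<zero>\<^bsub>L_ell2\<^esub>), add = (\<lambda>A B n. A n \<oplus>\<^bsub>L_ell2\<^esub> B n),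
      smult = (\<lambda>c A n. c \<odot>\<^bsub>L_ell2\<^esub> A n), star = (\<lambda>A n. star L_ell2 (A n)),
      nrm = (\<lambda>A. SUP n. nrm L_ell2 (A n))\<rparr>"

definition G_ideal :: "(nat \<Rightarrow> nat) \<Rightarrow> (nat \<Rightarrow> ell2 \<Rightarrow>\<^sub>L ell2) set" where
  "G_ideal \<eta> = {A \<in> carrier (F_alg \<eta>). (\<lambda>n. nrm L_ell2 (A n)) \<longlonglongrightarrow> 0}"

definition sections :: "(nat \<Rightarrow> nat) \<Rightarrow> (ell2 \<Rightarrow>\<^sub>L ell2) \<Rightarrow> nat \<Rightarrow> ell2 \<Rightarrow>\<^sub>L ell2" where
  "sections \<eta> A n = proj (\<eta> n) o\<^sub>L A o\<^sub>L proj (\<eta> n)"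

definition section_algebra ::
    "(nat \<Rightarrow> nat) \<Rightarrow> (ell2 \<Rightarrow>\<^sub>L ell2) set \<Rightarrow> (nat \<Rightarrow> ell2 \<Rightarrow>\<^sub>L ell2) star_algebra" where
  "section_algebra \<eta> X = (F_alg \<eta>)\<lparr>carrier := cstar_generated (F_alg \<eta>) (sections \<eta> ` X)\<rparr>"

definition S_eta :: "nat \<Rightarrow> (nat \<Rightarrow> ell2 \<Rightarrow>\<^sub>L ell2) star_algebra" where
  "S_eta N = section_algebra (\<lambda>n. N ^ n) (cuntz N)"

definition S_quot :: "nat \<Rightarrow> (nat \<Rightarrow> ell2 \<Rightarrow>\<^sub>L ell2) set star_algebra" where
  "S_quot N = quotient_algebra (S_eta N) (G_ideal (\<lambda>n. N ^ n))"

definition s_gen :: "nat \<Rightarrow> nat \<Rightarrow> (nat \<Rightarrow> ell2 \<Rightarrow>\<^sub>L ell2) set" where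
  "s_gen N i = G_ideal (\<lambda>n. N ^ n) +>\<^bsub>S_eta N\<^esub> sections (\<lambda>n. N ^ n) (cuntz_iso N i)"

definition p1 :: "nat \<Rightarrow> (nat \<Rightarrow> ell2 \<Rightarrow>\<^sub>L ell2) set" where
  "p1 N = star (S_quot N) (s_gen N 0) \<otimes>\<^bsub>S_quot N\<^esub> s_gen N 0"

definition J_ideal :: "nat \<Rightarrow> (nat \<Rightarrow> ell2 \<Rightarrow>\<^sub>L ell2) set set" where
  "J_ideal N = closed_ideal_generated (S_quot N) {\<one>\<^bsub>S_quot N\<^esub> \<ominus>\<^bsub>S_quot N\<^esub> p1 N}"

end

theory Submission
  imports Defs
begin

text \<open>
  Up to null sequences, the section algebra is the closed span of the sequences
  \<open>T\<^sub>v P T\<^sub>w\<^sup>*\<close>, where \<open>T\<^sub>v\<close> and \<open>T\<^sub>w\<close> are products of the isometries and \<open>P\<close> is the projection onto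
  the first \<open>N ^ (n - k)\<close> basis vectors.

  Let \<open>A\<close> belong to a closed ideal without being a null sequence. Inserting a block of digits into the indices
  of a test vector, and averaging over the position of the block, almost commutes with the
  digit shifts. This shows that the columns of \<open>A\<close> with arbitrarily large index are bounded from below.
  Approximate \<open>A\<^sup>* A\<close> by an element of the span and compress to the indices with a fixed number of leading zeros
  and fixed last digits. All terms of nonzero degree vanish, and what is left is a scalar, which is bounded from below
  by the column norms, times a projection. Hence this projection, and with it \<open>e - p\<^sub>1\<close>, belongs to the ideal.

  If the ideal is strictly larger than one that contains \<open>e - p\<^sub>1\<close>, the same argument gives large columns
  whose indices also have many leading zeros. Compressing to last digits that are preceded by \<open>0 \<dots> 0 1\<close> now kills the
  terms of nonzero degree without fixing the leading zeros. This gives the projection \<open>s\<^sub>0\<^sup>*\<^sup>c s\<^sub>0\<^sup>c\<close> for some \<open>c\<close>,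
  which is the identity modulo the ideal generated by \<open>e - p\<^sub>1\<close>. That ideal is proper because its elements converge
  strongly to zero.
\<close>

subsection \<open>Coordinates and the standard basis\<close>

text \<open>A large norm of \<open>A n\<close> does not by itself give an entry that survives
  compression: the compression of a polynomial is scalar only on words that are long compared with
  its monomials, and this polynomial can be chosen only after the size of the columns is known. The
  test vector is therefore moved to long words, at a loss that depends on its level \<open>h\<close>
  but not on how far it is moved. One insertion is not enough, because a monomial of nonzero degree
  changes the position of the block; the sum over \<open>L\<close> positions has norm proportional
  to \<open>sqrt L\<close>, while the boundary error stays bounded. The two cases differ because of
  the truncations inside the monomials, which see only the number of leading zeros. Elements such as
  \<open>e - p_1\<close> have no large columns with many leading zeros, so in the first case this
  number is recorded and the projection obtained is a band. Modulo the top band the truncations can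
  be removed, so that one test vector serves all levels and leading zeros become available.\<close>

lemma coord_simps [simp]:
  "coord 0 n = 0" "coord (x + y) n = coord x n + coord y n" "coord (x - y) n = coord x n - coord y n"
  "coord (- x) n = - coord x n" "coord (c *\<^sub>C x) n = c * coord x n"
  "coord (r *\<^sub>R x) n = r *\<^sub>R coord x n"
  by (simp_all add: zero_ell2.rep_eq plus_ell2.rep_eq minus_ell2.rep_eq uminus_ell2.rep_eq
      scaleC.rep_eq scaleR_ell2.rep_eq)

lemma coord_sum [simp]: "coord (sum f A) n = (\<Sum>i\<in>A. coord (f i) n)"
  by (induction A rule: infinite_finite_induct) auto

lemma scaleC_simps [simp]:
  "1 *\<^sub>C x = x" "0 *\<^sub>C x = 0" "c *\<^sub>C (0 :: ell2) = 0" "c *\<^sub>C d *\<^sub>C x = (c * d) *\<^sub>C x"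
  by (auto intro!: ell2_eqI)

lemma scaleC_add: "c *\<^sub>C (x + y) = c *\<^sub>C x + c *\<^sub>C y"
  by (auto intro!: ell2_eqI simp: algebra_simps)

lemma scaleC_diff: "c *\<^sub>C (x - y) = c *\<^sub>C x - c *\<^sub>C y"
  by (auto intro!: ell2_eqI simp: algebra_simps)

lemma scaleC_sum: "c *\<^sub>C (sum f A) = (\<Sum>i\<in>A. c *\<^sub>C f i)"
  by (auto intro!: ell2_eqI simp: sum_distrib_left)

lemma scaleR_scaleC: "r *\<^sub>R x = complex_of_real r *\<^sub>C x"
  by (auto intro!: ell2_eqI simp: scaleR_conv_of_real)

lemma norm_scaleC [simp]: "norm (c *\<^sub>C x) = cmod c * norm x"
proof -
  have "(norm (c *\<^sub>C x))\<^sup>2 = (cmod c * norm x)\<^sup>2"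
    by (simp add: norm_ell2_sq norm_mult power_mult_distrib suminf_mult summable_coord)
  then show ?thesis by (simp add: power2_eq_iff_nonneg)
qed

lift_definition basis :: "nat \<Rightarrow> ell2" is "\<lambda>j n. if n = j then 1 else 0"
  by (rule summable_finite[of "{j}" for j]) auto

lemma coord_basis [simp]: "coord (basis j) n = (if n = j then 1 else 0)"
  by (simp add: basis.rep_eq)

lemma norm_finite_support:
  assumes "finite A" "\<And>n. n \<notin> A \<Longrightarrow> coord x n = 0"
  shows "(norm x)\<^sup>2 = (\<Sum>n\<in>A. (cmod (coord x n))\<^sup>2)"
  unfolding norm_ell2_sq by (rule suminf_finite) (use assms in auto)

lemma norm_basis [simp]: "norm (basis j) = 1"
proof -
  have "(norm (basis j))\<^sup>2 = (\<Sum>n\<in>{j}. (cmod (coord (basis j) n))\<^sup>2)"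
    by (rule norm_finite_support) auto
  then have "(norm (basis j))\<^sup>2 = 1\<^sup>2" by simp
  then show ?thesis by (rule power2_eq_imp_eq) auto
qed

lemma norm_trunc_le: "(\<Sum>n<m. (cmod (coord x n))\<^sup>2) \<le> (norm x)\<^sup>2"
  unfolding norm_ell2_sq by (rule sum_le_suminf[OF summable_coord]) auto

lemma coord_le_norm: "cmod (coord x n) \<le> norm x"
proof -
  have "(cmod (coord x n))\<^sup>2 \<le> (\<Sum>n<Suc n. (cmod (coord x n))\<^sup>2)"
    by (rule member_le_sum) auto
  also have "\<dots> \<le> (norm x)\<^sup>2" by (rule norm_trunc_le)
  finally show ?thesis by (simp add: power2_le_iff_abs_le)
qed

lemma trunc_eq_sum: "trunc m x = (\<Sum>j<m. coord x j *\<^sub>C basis j)"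
  by (rule ell2_eqI) (simp add: trunc.rep_eq if_distrib[of "\<lambda>c. _ * c"] cong: if_cong)

lemma trunc_tendsto: "(\<lambda>m. trunc m x) \<longlonglongrightarrow> x"
proof -
  let ?f = "\<lambda>n. (cmod (coord x n))\<^sup>2"
  have eq: "(norm (x - trunc m x))\<^sup>2 = (\<Sum>n. ?f n) - (\<Sum>n<m. ?f n)" for m
  proof -
    have "(norm (x - trunc m x))\<^sup>2 = (\<Sum>n. ?f n - (if n < m then ?f n else 0))"
      unfolding norm_ell2_sq by (rule arg_cong[of _ _ suminf]) (auto simp: trunc.rep_eq)
    also have "\<dots> = (\<Sum>n. ?f n) - (\<Sum>n. if n < m then ?f n else 0)"
      by (rule suminf_diff[symmetric, OF summable_coord]) (rule summable_finite[of "{..<m}"], auto)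
    also have "(\<Sum>n. if n < m then ?f n else 0) = (\<Sum>n<m. ?f n)"
      by (subst suminf_finite[of "{..<m}"]) auto
    finally show ?thesis .
  qed
  have "(\<lambda>m. (\<Sum>n. ?f n) - (\<Sum>n<m. ?f n)) \<longlonglongrightarrow> (\<Sum>n. ?f n) - (\<Sum>n. ?f n)"
    by (intro tendsto_intros summable_LIMSEQ summable_coord)
  then have "(\<lambda>m. (norm (x - trunc m x))\<^sup>2) \<longlonglongrightarrow> 0" by (simp add: eq)
  then have "(\<lambda>m. sqrt ((norm (x - trunc m x))\<^sup>2)) \<longlonglongrightarrow> sqrt 0" by (rule tendsto_real_sqrt)
  then have "(\<lambda>m. norm (trunc m x - x)) \<longlonglongrightarrow> 0" by (simp add: norm_minus_commute)
  then show ?thesis using LIM_zero_iff tendsto_norm_zero_iff by blast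
qed

subsection \<open>The sesquilinear inner product\<close>

lemma summable_cinner: "summable (\<lambda>n. coord x n * cnj (coord y n))"
  by (rule summable_norm_cancel)
     (simp add: norm_mult summable_prod[OF summable_coord summable_coord])

lemma cinner_simps [simp]:
  "cinner (x + y) z = cinner x z + cinner y z" "cinner (x - y) z = cinner x z - cinner y z"
  "cinner (c *\<^sub>C x) z = c * cinner x z" "cinner 0 z = 0"
  unfolding cinner_def
  by (simp_all add: suminf_add summable_cinner suminf_diff algebra_simps suminf_mult)

lemma cinner_sum [simp]: "cinner (sum f A) z = (\<Sum>i\<in>A. cinner (f i) z)"
  by (induction A rule: infinite_finite_induct) auto

lemma cinner_commute: "cinner y x = cnj (cinner x y)"
proof -
  have "(\<lambda>n. cnj (coord x n * cnj (coord y n))) sums cnj (cinner x y)"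
    unfolding sums_cnj cinner_def by (rule summable_sums[OF summable_cinner])
  then show ?thesis by (simp add: sums_iff cinner_def mult.commute)
qed

lemma Re_cinner: "Re (cinner x y) = x \<bullet> y"
  unfolding cinner_def inner_ell2_def Re_suminf[OF summable_cinner]
  by (simp add: inner_complex_def)

lemma cinner_self: "cinner x x = complex_of_real ((norm x)\<^sup>2)"
proof (rule complex_eqI)
  show "Im (cinner x x) = Im (complex_of_real ((norm x)\<^sup>2))"
    using cinner_commute[of x x] by (metis Im_complex_of_real complex_cnj complex_eq_iff cnj.simps(2) equal_neg_zero)
qed (simp add: Re_cinner power2_norm_eq_inner)

lemma cinner_le: "cmod (cinner x y) \<le> norm x * norm y"
proof (cases "cinner x y = 0")
  case False
  define c where "c = cnj (sgn (cinner x y))"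
  have c: "cmod c = 1" using False by (simp add: c_def norm_sgn)
  have "cinner (c *\<^sub>C x) y = complex_of_real (cmod (cinner x y))"
    using False by (simp add: c_def sgn_eq complex_norm_square[symmetric] power2_eq_square mult.commute)
  then have "cmod (cinner x y) = (c *\<^sub>C x) \<bullet> y"
    by (metis Re_cinner Re_complex_of_real)
  also have "\<dots> \<le> norm (c *\<^sub>C x) * norm y" by (rule norm_cauchy_schwarz)
  finally show ?thesis using c by simp
qed simp

lemma cinner_basis [simp]: "cinner (basis j) y = cnj (coord y j)" "cinner y (basis j) = coord y j"
proof -
  show *: "cinner y (basis j) = coord y j" for y
    unfolding cinner_def by (subst suminf_finite[of "{j}"]) auto
  show "cinner (basis j) y = cnj (coord y j)" by (metis * cinner_commute)
qed

lemma tendsto_cinner_left: "(f \<longlongrightarrow> l) F \<Longrightarrow> ((\<lambda>n. cinner (f n) y) \<longlongrightarrow> cinner l y) F"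
proof -
  assume "(f \<longlongrightarrow> l) F"
  then have "((\<lambda>n. norm (f n - l) * norm y) \<longlongrightarrow> 0) F"
    by (intro tendsto_mult_left_zero) (simp add: LIM_zero_iff tendsto_norm_zero_iff)
  then have "((\<lambda>n. cinner (f n) y - cinner l y) \<longlongrightarrow> 0) F"
    by (rule Lim_null_comparison[rotated])
       (auto intro!: always_eventually simp: cinner_simps(2)[symmetric] cinner_le simp del: cinner_simps)
  then show ?thesis by (simp add: LIM_zero_iff)
qed

subsection \<open>Complex-linear operators and adjoints\<close>

definition clin :: "(ell2 \<Rightarrow>\<^sub>L ell2) \<Rightarrow> bool" where
  "clin A \<longleftrightarrow> (\<forall>c x. A (c *\<^sub>C x) = c *\<^sub>C A x)"

lemma carrier_L: "carrier L_ell2 = Collect clin"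
  by (auto simp: L_ell2_def clin_def)

lemma clin_scaleC: "clin A \<Longrightarrow> A (c *\<^sub>C x) = c *\<^sub>C A x"
  by (simp add: clin_def)

lemma scaleC_op_apply [simp]: "scaleC_op c x = c *\<^sub>C x"
  by (simp add: scaleC_op.rep_eq)

lemma proj_apply [simp]: "coord (proj m x) n = (if n < m then coord x n else 0)"
  by (simp add: proj.rep_eq trunc.rep_eq)

lemma proj_basis [simp]: "proj m (basis j) = (if j < m then basis j else 0)"
  by (rule ell2_eqI) auto

lemma cuntz_iso_basis: "i < M \<Longrightarrow> cuntz_iso M i (basis j) = basis (j * M + i)"
proof (rule ell2_eqI)
  fix n assume "i < M"
  then have "n = j * M + i \<longleftrightarrow> n mod M = i \<and> n div M = j" by auto
  then show "coord (cuntz_iso M i (basis j)) n = coord (basis (j * M + i)) n"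
    by (auto simp: cuntz_iso.rep_eq spread.rep_eq)
qed

lemma clin_intros [simp, intro]:
  "clin 0" "clin id_blinfun" "clin (proj m)" "clin (cuntz_iso M i)" "clin (scaleC_op c)"
  "clin A \<Longrightarrow> clin B \<Longrightarrow> clin (A + B)" "clin A \<Longrightarrow> clin B \<Longrightarrow> clin (A - B)"
  "clin A \<Longrightarrow> clin (- A)" "clin A \<Longrightarrow> clin B \<Longrightarrow> clin (A o\<^sub>L B)" "clin A \<Longrightarrow> clin (r *\<^sub>R A)"
  by (auto simp: clin_def blinfun.bilinear_simps scaleC_add scaleC_diff scaleR_scaleC mult.commute
      intro!: ell2_eqI simp: cuntz_iso.rep_eq spread.rep_eq)

lemma clin_sum [intro]: "(\<And>i. i \<in> I \<Longrightarrow> clin (f i)) \<Longrightarrow> clin (sum f I)"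
  by (induction I rule: infinite_finite_induct) auto

lemma clin_trunc: "clin A \<Longrightarrow> A (trunc m x) = (\<Sum>j<m. coord x j *\<^sub>C A (basis j))"
  by (simp add: trunc_eq_sum blinfun.sum_right clin_scaleC)

lemma clin_tendsto: "clin A \<Longrightarrow> (\<lambda>m. \<Sum>j<m. coord x j *\<^sub>C A (basis j)) \<longlonglongrightarrow> A x"
  by (simp add: clin_trunc[symmetric]) (intro tendsto_intros trunc_tendsto)

text \<open>Finite combinations of basis vectors are dense, so complex linearity and continuity
  suffice. Through this rule nearly all operator identities below become statements about indices in
  base \<open>N\<close>.\<close>

lemma clin_eqI:
  assumes "clin A" "clin B" "\<And>j. A (basis j) = B (basis j)"
  shows "A = B"
proof (rule blinfun_eqI)
  fix x
  show "A x = B x"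
    using LIMSEQ_unique[OF clin_tendsto[OF assms(1)]] clin_tendsto[OF assms(2), of x] assms(3) by simp
qed

text \<open>The relation forces the coordinates of \<open>B y\<close>, namely \<open>b y n\<close>.
  Their square summability comes from testing with the finite vector \<open>\<xi>\<close> that has
  these coordinates below \<open>m\<close>: \<open>cinner (A \<xi>) y\<close> is the square of its
  norm, and Cauchy-Schwarz then bounds that norm by \<open>norm A * norm y\<close>.\<close>

lemma adj_exists:
  assumes A: "clin A"
  shows "\<exists>B. \<forall>x y. cinner (blinfun_apply A x) y = cinner x (blinfun_apply B y)"
proof -
  define b where "b y n = cinner y (A (basis n))" for y n
  have bound: "(\<Sum>n<m. (cmod (b y n))\<^sup>2) \<le> (norm A * norm y)\<^sup>2" for y m
  proof -
    define \<xi> where "\<xi> = (\<Sum>n<m. b y n *\<^sub>C basis n)"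
    have co: "coord \<xi> n = (if n < m then b y n else 0)" for n
      unfolding \<xi>_def by (simp add: if_distrib[of "\<lambda>c. _ * c"] cong: if_cong)
    have nx: "(norm \<xi>)\<^sup>2 = (\<Sum>n<m. (cmod (b y n))\<^sup>2)"
      by (subst norm_finite_support[of "{..<m}"]) (auto simp: co)
    have "A \<xi> = (\<Sum>n<m. b y n *\<^sub>C A (basis n))"
      by (simp add: \<xi>_def blinfun.sum_right clin_scaleC[OF A])
    then have "cinner (A \<xi>) y = (\<Sum>n<m. b y n * cnj (b y n))"
      by (simp add: b_def cinner_commute[of y])
    also have "\<dots> = complex_of_real ((norm \<xi>)\<^sup>2)"
      by (simp add: nx complex_norm_square[symmetric])
    finally have "(norm \<xi>)\<^sup>2 = cmod (cinner (A \<xi>) y)" by (metis abs_of_nonneg norm_of_real zero_le_power2)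
    also have "\<dots> \<le> norm A * norm \<xi> * norm y"
      using cinner_le[of "A \<xi>" y] mult_right_mono[OF norm_blinfun[of A \<xi>] norm_ge_zero[of y]] by linarith
    finally have "norm \<xi> * norm \<xi> \<le> norm \<xi> * (norm A * norm y)" by (simp add: power2_eq_square ac_simps)
    then have "norm \<xi> \<le> norm A * norm y"
      by (cases "norm \<xi> = 0") (auto simp: mult_le_cancel_left)
    then show ?thesis unfolding nx[symmetric] by (intro power_mono) auto
  qed
  have summ: "summable (\<lambda>n. (cmod (b y n))\<^sup>2)" for y
    by (rule bounded_imp_summable[of _ "(norm A * norm y)\<^sup>2"])
       (use bound[of y "Suc _"] in \<open>auto simp: lessThan_Suc_atMost\<close>)
  define B where "B y = Abs_ell2 (b y)" for y
  have cB: "coord (B y) n = b y n" for y n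
    unfolding B_def using Abs_ell2_inverse[of "b y"] summ by simp
  have bl: "bounded_linear B"
  proof (rule bounded_linear_ell2I)
    show "B (x + y) = B x + B y" for x y by (rule ell2_eqI) (simp add: cB b_def)
    show "B (r *\<^sub>R x) = r *\<^sub>R B x" for r x
      by (rule ell2_eqI) (simp add: cB b_def scaleR_scaleC)
    show "0 \<le> norm A" by simp
    show "(\<Sum>n. (cmod (coord (B x) n))\<^sup>2) \<le> (norm A)\<^sup>2 * (\<Sum>n. (cmod (coord x n))\<^sup>2)" for x
      unfolding norm_ell2_sq[symmetric, of x] power_mult_distrib[symmetric] cB
      by (rule suminf_le_const[OF summ bound])
  qed
  have "cinner (A x) y = cinner x (B y)" for x y
  proof -
    have "cinner (\<Sum>j<m. coord x j *\<^sub>C A (basis j)) y = cinner (trunc m x) (B y)" for m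
      by (simp add: trunc_eq_sum cB b_def cinner_commute[of y])
    then have "(\<lambda>m. cinner (trunc m x) (B y)) \<longlonglongrightarrow> cinner (A x) y"
      using tendsto_cinner_left[OF clin_tendsto[OF A, of x], of y] by simp
    then show ?thesis
      using tendsto_cinner_left[OF trunc_tendsto] LIMSEQ_unique by blast
  qed
  then show ?thesis using bounded_linear_Blinfun_apply[OF bl] by metis
qed

lemma cinner_adj:
  assumes A: "clin A"
  shows "cinner (A x) y = cinner x (adj A y)"
proof -
  obtain B where B: "\<forall>x y. cinner (blinfun_apply A x) y = cinner x (blinfun_apply B y)"
    using adj_exists[OF A] by blast
  have "adj A = B"
    unfolding adj_def
  proof (rule the_equality[where a = B])
    fix C assume C: "\<forall>x y. cinner (blinfun_apply A x) y = cinner x (blinfun_apply C y)"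
    have "coord (C y) j = coord (B y) j" for y j
      using B C cinner_basis(1) by (metis complex_cnj_cancel_iff)
    then show "C = B" by (intro blinfun_eqI ell2_eqI)
  qed (use B in auto)
  then show ?thesis using B by simp
qed

lemma adj_eqI:
  assumes "clin A" "\<And>x y. cinner (A x) y = cinner x (blinfun_apply B y)"
  shows "adj A = B"
  by (intro blinfun_eqI ell2_eqI)
     (metis assms cinner_adj cinner_basis(1) complex_cnj_cancel_iff)

lemma coord_adj: "clin A \<Longrightarrow> coord (adj A y) j = cinner y (A (basis j))"
  by (metis cinner_adj cinner_basis(1) cinner_commute complex_cnj_cancel_iff)

lemma clin_adj [simp, intro]: "clin A \<Longrightarrow> clin (adj A)"
  unfolding clin_def[of "adj A"] by (auto intro!: ell2_eqI simp: coord_adj)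

lemma cinner_adj': "clin A \<Longrightarrow> cinner x (A y) = cinner (adj A x) y"
  by (metis cinner_adj cinner_commute)

lemma adj_adj [simp]: "clin A \<Longrightarrow> adj (adj A) = A"
  by (rule adj_eqI) (auto simp: cinner_adj')

lemma cinner_simps_right [simp]:
  "cinner z (x + y) = cinner z x + cinner z y" "cinner z (x - y) = cinner z x - cinner z y"
  "cinner z (c *\<^sub>C x) = cnj c * cinner z x" "cinner z 0 = 0"
  by (simp_all add: cinner_commute[of z])

lemma adj_compose: "clin A \<Longrightarrow> clin B \<Longrightarrow> adj (A o\<^sub>L B) = adj B o\<^sub>L adj A"
  by (rule adj_eqI) (auto simp: cinner_adj)

lemma adj_add: "clin A \<Longrightarrow> clin B \<Longrightarrow> adj (A + B) = adj A + adj B"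
  by (rule adj_eqI) (auto simp: cinner_adj blinfun.bilinear_simps)

lemma adj_diff: "clin A \<Longrightarrow> clin B \<Longrightarrow> adj (A - B) = adj A - adj B"
  by (rule adj_eqI) (auto simp: cinner_adj blinfun.bilinear_simps)

lemma adj_scaleC_op: "adj (scaleC_op c) = scaleC_op (cnj c)"
  by (rule adj_eqI) auto

lemma adj_proj [simp]: "adj (proj m) = proj m"
  by (rule clin_eqI) (auto intro!: ell2_eqI simp: coord_adj)

lemma adj_zero [simp]: "adj 0 = 0"
  by (rule adj_eqI) auto

lemma norm_adj_le: "clin A \<Longrightarrow> norm (adj A) \<le> norm A"
proof (rule norm_blinfun_bound)
  assume A: "clin A"
  fix y
  have "(norm (adj A y))\<^sup>2 = cmod (cinner (adj A y) (adj A y))"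
    by (simp add: cinner_self norm_power)
  also have "\<dots> = cmod (cinner (A (adj A y)) y)" by (simp add: cinner_adj[OF A])
  also have "\<dots> \<le> norm A * norm (adj A y) * norm y"
    using cinner_le[of "A (adj A y)" y] mult_right_mono[OF norm_blinfun[of A "adj A y"] norm_ge_zero[of y]] by linarith
  finally have "norm (adj A y) * norm (adj A y) \<le> norm (adj A y) * (norm A * norm y)"
    by (simp add: power2_eq_square ac_simps)
  then show "norm (adj A y) \<le> norm A * norm y"
    by (cases "norm (adj A y) = 0") (auto simp: mult_le_cancel_left)
qed simp

lemma norm_proj_le: "norm (proj m) \<le> 1"
proof (rule norm_blinfun_bound)
  fix x
  have "(norm (proj m x))\<^sup>2 \<le> (norm x)\<^sup>2"
    using norm_trunc_le[of x m] by (subst norm_finite_support[of "{..<m}"]) auto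
  then show "norm (proj m x) \<le> 1 * norm x" by (simp add: power2_le_iff_abs_le)
qed simp

lemma norm_contraction: "norm (A :: ell2 \<Rightarrow>\<^sub>L ell2) \<le> 1 \<Longrightarrow> norm (A x) \<le> norm x"
  using norm_blinfun[of A x] mult_right_mono[of "norm A" 1 "norm x"] by simp

lemma norm_scaleC_op_le: "norm (scaleC_op c) \<le> cmod c"
  by (rule norm_blinfun_bound) auto

lemma norm_compose_le: "norm A \<le> a \<Longrightarrow> norm B \<le> b \<Longrightarrow> norm (A o\<^sub>L B) \<le> a * b"
  by (rule order_trans[OF norm_blinfun_compose]) (auto intro!: mult_mono order_trans[OF norm_ge_zero])

lemma norm_cuntz_iso_le: "norm (cuntz_iso M i) \<le> 1"
proof (rule norm_blinfun_bound)
  fix x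
  have "(norm (cuntz_iso M i x))\<^sup>2 \<le> (norm x)\<^sup>2"
    using spread_bound(2)[OF summable_coord] by (simp add: norm_ell2_sq cuntz_iso.rep_eq spread.rep_eq)
  then show "norm (cuntz_iso M i x) \<le> 1 * norm x" by (simp add: power2_le_iff_abs_le)
qed simp

lemma adj_cuntz_iso_basis:
  assumes "i < M"
  shows "adj (cuntz_iso M i) (basis j) = (if j mod M = i then basis (j div M) else 0)"
proof (rule ell2_eqI)
  fix n
  have "j = n * M + i \<longleftrightarrow> j mod M = i \<and> n = j div M" using assms by auto
  then show "coord (adj (cuntz_iso M i) (basis j)) n = coord (if j mod M = i then basis (j div M) else 0) n"
    using assms by (auto simp: coord_adj cuntz_iso_basis)
qed

type_synonym op_seq = "nat \<Rightarrow> ell2 \<Rightarrow>\<^sub>L ell2"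

subsection \<open>Operators and bounded sequences as algebras with involution\<close>

lemma L_simps [simp]:
  "mult L_ell2 = (o\<^sub>L)" "one L_ell2 = id_blinfun" "zero L_ell2 = 0" "add L_ell2 = (+)"
  "smult L_ell2 = (\<lambda>c A. scaleC_op c o\<^sub>L A)" "star L_ell2 = adj" "nrm L_ell2 = norm"
  by (simp_all add: L_ell2_def)

lemma F_simps [simp]:
  "mult (F_alg \<eta>) = (\<lambda>A B n. A n o\<^sub>L B n)" "one (F_alg \<eta>) = (\<lambda>n. proj (\<eta> n))"
  "zero (F_alg \<eta>) = (\<lambda>n. 0)" "add (F_alg \<eta>) = (\<lambda>A B n. A n + B n)"
  "smult (F_alg \<eta>) = (\<lambda>c A n. scaleC_op c o\<^sub>L A n)" "star (F_alg \<eta>) = (\<lambda>A n. adj (A n))"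
  "nrm (F_alg \<eta>) = (\<lambda>A. SUP n. norm (A n))"
  by (simp_all add: F_alg_def)

lemma carrier_F:
  "A \<in> carrier (F_alg \<eta>) \<longleftrightarrow>
    (\<forall>n. clin (A n) \<and> proj (\<eta> n) o\<^sub>L A n o\<^sub>L proj (\<eta> n) = A n) \<and> (\<exists>C. \<forall>n. norm (A n) \<le> C)"
  by (auto simp: F_alg_def carrier_L bounded_iff)

text \<open>In HOL-Algebra the negative is a definite description over the carrier. Evaluating it
  directly gives the subtraction of \<open>F_alg\<close> without establishing a ring structure
  there.\<close>

lemma minus_seq:
  fixes R :: "(op_seq, 'm) ring_scheme"
  assumes "add R = (\<lambda>A B n. A n + B n)" "zero R = (\<lambda>n. 0)" "(\<lambda>n. - B n) \<in> carrier R"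
  shows "A \<ominus>\<^bsub>R\<^esub> B = (\<lambda>n. A n - B n)"
proof -
  have "\<ominus>\<^bsub>R\<^esub> B = (\<lambda>n. - B n)"
    unfolding a_inv_def m_inv_def
  proof (rule the_equality)
    fix C assume "C \<in> carrier (add_monoid R) \<and> B \<otimes>\<^bsub>add_monoid R\<^esub> C = \<one>\<^bsub>add_monoid R\<^esub> \<and>
        C \<otimes>\<^bsub>add_monoid R\<^esub> B = \<one>\<^bsub>add_monoid R\<^esub>"
    then have "(\<lambda>n. B n + C n) = (\<lambda>n. 0)" using assms(1,2) by simp
    then show "C = (\<lambda>n. - B n)" by (metis minus_unique)
  qed (use assms in simp)
  then show ?thesis using assms by (simp add: a_minus_def)
qed

lemma minus_L:
  assumes "clin B"
  shows "A \<ominus>\<^bsub>L_ell2\<^esub> B = A - B"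
proof -
  have "\<ominus>\<^bsub>L_ell2\<^esub> B = - B"
    unfolding a_inv_def m_inv_def
    by (rule the_equality) (use assms in \<open>auto simp: carrier_L dest: minus_unique\<close>)
  then show ?thesis by (simp add: a_minus_def)
qed

lemma proj_proj [simp]: "proj m o\<^sub>L proj n = proj (min m n)"
  by (rule clin_eqI) auto

lemma compose_assoc: "A o\<^sub>L B o\<^sub>L C = A o\<^sub>L (B o\<^sub>L C)"
  by (rule blinfun_eqI) simp

lemma compose_proj_left: "proj m o\<^sub>L A o\<^sub>L proj m = A \<Longrightarrow> proj m o\<^sub>L A = A"
  by (metis compose_assoc min.idem proj_proj)

lemma compose_proj_right: "proj m o\<^sub>L A o\<^sub>L proj m = A \<Longrightarrow> A o\<^sub>L proj m = A"
  by (metis compose_assoc min.idem proj_proj)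

lemma compose_simps:
  "(A + B) o\<^sub>L C = (A o\<^sub>L C) + (B o\<^sub>L C)" "C o\<^sub>L (A + B) = (C o\<^sub>L A) + (C o\<^sub>L B)"
  "(A - B) o\<^sub>L C = (A o\<^sub>L C) - (B o\<^sub>L C)" "C o\<^sub>L (A - B) = (C o\<^sub>L A) - (C o\<^sub>L B)"
  "(- A) o\<^sub>L C = - (A o\<^sub>L C)" "C o\<^sub>L (- A) = - (C o\<^sub>L A)"
  "A o\<^sub>L 0 = 0" "0 o\<^sub>L A = 0"
  "A o\<^sub>L id_blinfun = A" "id_blinfun o\<^sub>L A = A"
  by (auto intro!: blinfun_eqI simp: blinfun.bilinear_simps)

lemma scaleC_op_commute: "clin A \<Longrightarrow> A o\<^sub>L scaleC_op c = scaleC_op c o\<^sub>L A"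
  by (auto intro!: blinfun_eqI simp: clin_scaleC)

lemma F_memD:
  assumes "A \<in> carrier (F_alg \<eta>)"
  shows "clin (A n)" "proj (\<eta> n) o\<^sub>L A n = A n" "A n o\<^sub>L proj (\<eta> n) = A n"
  using assms compose_proj_left compose_proj_right by (auto simp: carrier_F)

lemma F_memI:
  assumes "\<And>n. clin (A n)" "\<And>n. proj (\<eta> n) o\<^sub>L A n = A n" "\<And>n. A n o\<^sub>L proj (\<eta> n) = A n"
    "\<And>n. norm (A n) \<le> C"
  shows "A \<in> carrier (F_alg \<eta>)"
  using assms by (auto simp: carrier_F)

lemma F_bound:
  assumes "A \<in> carrier (F_alg \<eta>)"
  obtains C where "C > 0" "\<And>n. norm (A n) \<le> C"
proof -
  obtain C where "\<And>n. norm (A n) \<le> C" using assms by (auto simp: carrier_F)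
  then have "norm (A n) \<le> max C 1" for n by (meson max.coboundedI1)
  then show ?thesis by (rule that[rotated]) simp
qed

lemma F_closed:
  assumes "A \<in> carrier (F_alg \<eta>)"
  shows "(\<lambda>n. - A n) \<in> carrier (F_alg \<eta>)" "(\<lambda>n. scaleC_op c o\<^sub>L A n) \<in> carrier (F_alg \<eta>)"
    "(\<lambda>n. adj (A n)) \<in> carrier (F_alg \<eta>)"
proof -
  note A = F_memD[OF assms]
  obtain C where C: "C > 0" "\<And>n. norm (A n) \<le> C" using F_bound[OF assms] by blast
  show "(\<lambda>n. - A n) \<in> carrier (F_alg \<eta>)"
    by (rule F_memI[where C = C]) (use A C in \<open>auto simp: compose_simps\<close>)
  have comm: "proj m o\<^sub>L (scaleC_op c o\<^sub>L B) = scaleC_op c o\<^sub>L (proj m o\<^sub>L B)" for m B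
    by (metis compose_assoc clin_intros(3) scaleC_op_commute)
  show "(\<lambda>n. scaleC_op c o\<^sub>L A n) \<in> carrier (F_alg \<eta>)"
    by (rule F_memI[where C = "cmod c * C"])
       (use A C in \<open>auto simp: compose_assoc comm intro!: norm_compose_le norm_scaleC_op_le\<close>)
  show "(\<lambda>n. adj (A n)) \<in> carrier (F_alg \<eta>)"
  proof (rule F_memI[where C = C])
    fix n
    show "proj (\<eta> n) o\<^sub>L adj (A n) = adj (A n)"
      by (metis A(1,3) adj_compose adj_proj clin_intros(3))
    show "adj (A n) o\<^sub>L proj (\<eta> n) = adj (A n)"
      by (metis A(1,2) adj_compose adj_proj clin_intros(3))
  qed (use A C in \<open>auto intro: order_trans[OF norm_adj_le]\<close>)
qed

lemma F_closed2:
  assumes "A \<in> carrier (F_alg \<eta>)" "B \<in> carrier (F_alg \<eta>)"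
  shows "(\<lambda>n. A n + B n) \<in> carrier (F_alg \<eta>)" "(\<lambda>n. A n - B n) \<in> carrier (F_alg \<eta>)"
    "(\<lambda>n. A n o\<^sub>L B n) \<in> carrier (F_alg \<eta>)"
proof -
  note A = F_memD[OF assms(1)] and B = F_memD[OF assms(2)]
  obtain C where C: "C > 0" "\<And>n. norm (A n) \<le> C" using F_bound[OF assms(1)] by blast
  obtain D where D: "D > 0" "\<And>n. norm (B n) \<le> D" using F_bound[OF assms(2)] by blast
  show "(\<lambda>n. A n + B n) \<in> carrier (F_alg \<eta>)"
    by (rule F_memI[where C = "C + D"])
       (use A B C D in \<open>auto simp: compose_simps intro!: norm_triangle_mono\<close>)
  then show "(\<lambda>n. A n - B n) \<in> carrier (F_alg \<eta>)"
    by (intro F_memI[where C = "C + D"])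
       (use A B C D in \<open>auto simp: compose_simps intro!: order_trans[OF norm_triangle_ineq4] add_mono\<close>)
  show "(\<lambda>n. A n o\<^sub>L B n) \<in> carrier (F_alg \<eta>)"
    by (rule F_memI[where C = "C * D"])
       (use A B C D in \<open>auto simp: compose_assoc[symmetric] intro!: norm_compose_le\<close>,
        simp add: compose_assoc)
qed

lemma F_zero_one: "(\<lambda>n. 0) \<in> carrier (F_alg \<eta>)" "(\<lambda>n. proj (\<eta> n)) \<in> carrier (F_alg \<eta>)"
  by (auto intro!: F_memI[where C = 1] norm_proj_le simp: compose_simps)

lemma minus_F: "B \<in> carrier (F_alg \<eta>) \<Longrightarrow> A \<ominus>\<^bsub>F_alg \<eta>\<^esub> B = (\<lambda>n. A n - B n)"
  by (rule minus_seq) (auto simp: F_closed)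

lemma norm_le_nrm_F:
  assumes "A \<in> carrier (F_alg \<eta>)"
  shows "norm (A n) \<le> nrm (F_alg \<eta>) A"
proof -
  obtain C where "\<And>n. norm (A n) \<le> C" using F_bound[OF assms] by blast
  then show ?thesis by (auto intro!: cSUP_upper bdd_aboveI[where M = C])
qed

lemma nrm_F_le: "(\<And>n. norm (A n) \<le> C) \<Longrightarrow> nrm (F_alg \<eta>) A \<le> C"
  by (auto intro!: cSUP_least)

lemma sections_F: "clin A \<Longrightarrow> sections \<eta> A \<in> carrier (F_alg \<eta>)"
  unfolding sections_def
  by (intro F_memI[where C = "1 * norm A * 1"] norm_compose_le norm_proj_le)
     (auto simp: compose_assoc[symmetric], simp add: compose_assoc)

lemma quotient_algebra_simps [simp]:
  "carrier (quotient_algebra A I) = carrier (A Quot I)" "mult (quotient_algebra A I) = mult (A Quot I)"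
  "one (quotient_algebra A I) = one (A Quot I)" "zero (quotient_algebra A I) = zero (A Quot I)"
  "add (quotient_algebra A I) = add (A Quot I)"
  "star (quotient_algebra A I) = (\<lambda>X. \<Union>x\<in>X. I +>\<^bsub>A\<^esub> star A x)"
  "nrm (quotient_algebra A I) = (\<lambda>X. INF x\<in>X. nrm A x)"
  by (simp_all add: quotient_algebra_def)

lemma ring_quotient_algebra:
  assumes "ideal I A"
  shows "ring (quotient_algebra A I)"
proof -
  interpret Q: ring "A Quot I" by (rule ideal.quotient_is_ring[OF assms])
  show ?thesis
  proof (rule ringI)
    show "abelian_group (quotient_algebra A I)"
    proof (rule abelian_groupI)
      fix x assume "x \<in> carrier (quotient_algebra A I)"
      then show "\<exists>y\<in>carrier (quotient_algebra A I). y \<oplus>\<^bsub>quotient_algebra A I\<^esub> x = \<zero>\<^bsub>quotient_algebra A I\<^esub>"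
        by (intro bexI[of _ "\<ominus>\<^bsub>A Quot I\<^esub> x"]) (simp_all add: Q.l_neg)
    qed (simp_all add: Q.a_ac)
    show "monoid (quotient_algebra A I)"
      by (rule monoidI) (simp_all add: Q.m_assoc)
  qed (simp_all add: Q.l_distr Q.r_distr)
qed

subsection \<open>Generated subalgebras\<close>

text \<open>Each closure condition passes to intersections. That the carrier is itself a subalgebra
  containing \<open>X\<close> makes it a member of the intersected family, so the result lies in the
  carrier.\<close>

lemma cstar_subalgebra_generated:
  assumes "cstar_subalgebra (carrier A) A" "X \<subseteq> carrier A"
  shows "cstar_subalgebra (cstar_generated A X) A" "X \<subseteq> cstar_generated A X"
proof -
  show "X \<subseteq> cstar_generated A X" by (auto simp: cstar_generated_def)
  have mem: "a \<in> cstar_generated A X \<longleftrightarrow> (\<forall>B. cstar_subalgebra B A \<and> X \<subseteq> B \<longrightarrow> a \<in> B)" for a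
    by (auto simp: cstar_generated_def)
  have sub: "cstar_generated A X \<subseteq> carrier A" using assms by (auto simp: cstar_generated_def)
  have closed: "a \<in> B" if "cstar_subalgebra B A" "a \<in> carrier A" "\<forall>n. f n \<in> B"
    "(\<lambda>n. nrm A (f n \<ominus>\<^bsub>A\<^esub> a)) \<longlonglongrightarrow> 0" for a B and f :: "nat \<Rightarrow> 'a"
    using that unfolding cstar_subalgebra_def norm_closed_in_def by blast
  have "norm_closed_in (cstar_generated A X) A"
    unfolding norm_closed_in_def
  proof (intro conjI sub allI ballI impI)
    fix f :: "nat \<Rightarrow> 'a" and a assume a: "a \<in> carrier A"
      and f: "(\<forall>n. f n \<in> cstar_generated A X) \<and> (\<lambda>n. nrm A (f n \<ominus>\<^bsub>A\<^esub> a)) \<longlonglongrightarrow> 0"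
    show "a \<in> cstar_generated A X"
      unfolding mem
    proof (intro allI impI)
      fix B assume B: "cstar_subalgebra B A \<and> X \<subseteq> B"
      then have "\<forall>n. f n \<in> B" using f mem by blast
      then show "a \<in> B" using closed a f B by blast
    qed
  qed
  moreover have ops: "\<zero>\<^bsub>A\<^esub> \<in> B" "a \<in> B \<Longrightarrow> b \<in> B \<Longrightarrow> a \<oplus>\<^bsub>A\<^esub> b \<in> B" "a \<in> B \<Longrightarrow> b \<in> B \<Longrightarrow> a \<otimes>\<^bsub>A\<^esub> b \<in> B"
    "a \<in> B \<Longrightarrow> star A a \<in> B" "a \<in> B \<Longrightarrow> c \<odot>\<^bsub>A\<^esub> a \<in> B" if "cstar_subalgebra B A" for B a b c
    using that unfolding cstar_subalgebra_def by simp_all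
  ultimately show "cstar_subalgebra (cstar_generated A X) A"
    unfolding cstar_subalgebra_def[of "cstar_generated A X"]
    by (intro conjI ballI allI impI) (assumption | simp only: mem, metis ops)+
qed

lemma cstar_generated_least:
  "cstar_subalgebra B A \<Longrightarrow> X \<subseteq> B \<Longrightarrow> cstar_generated A X \<subseteq> B"
  by (auto simp: cstar_generated_def)

text \<open>Membership in the closure of \<open>D\<close> for the seminorm
  \<open>limsup norm (A n)\<close>, which ignores finitely many levels and all null sequences. This
  is the closeness that remains visible in the quotient.\<close>

definition approx :: "op_seq set \<Rightarrow> op_seq \<Rightarrow> bool" where
  "approx D A \<longleftrightarrow> (\<forall>\<epsilon>>0. \<exists>\<phi>\<in>D. \<forall>\<^sub>F n in sequentially. norm (A n - \<phi> n) \<le> \<epsilon>)"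

lemma approxE:
  assumes "approx D A" "\<epsilon> > 0"
  obtains \<phi> where "\<phi> \<in> D" "\<forall>\<^sub>F n in sequentially. norm (A n - \<phi> n) \<le> \<epsilon>"
  using assms by (auto simp: approx_def)

lemma approx_closed:
  assumes "\<And>\<epsilon>. \<epsilon> > 0 \<Longrightarrow> \<exists>B. approx D B \<and> (\<forall>\<^sub>F n in sequentially. norm (A n - B n) \<le> \<epsilon>)"
  shows "approx D A"
  unfolding approx_def
proof (intro allI impI)
  fix \<epsilon> :: real assume "\<epsilon> > 0"
  then obtain B where B: "approx D B" "\<forall>\<^sub>F n in sequentially. norm (A n - B n) \<le> \<epsilon>/2"
    using assms[of "\<epsilon>/2"] by auto
  obtain \<phi> where \<phi>: "\<phi> \<in> D" "\<forall>\<^sub>F n in sequentially. norm (B n - \<phi> n) \<le> \<epsilon>/2"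
    using approxE[OF B(1)] \<open>\<epsilon> > 0\<close> by (metis half_gt_zero)
  have "\<forall>\<^sub>F n in sequentially. norm (A n - \<phi> n) \<le> \<epsilon>"
    using B(2) \<phi>(2)
  proof eventually_elim
    case (elim n)
    then show ?case using norm_triangle_ineq[of "A n - B n" "B n - \<phi> n"] by simp
  qed
  then show "\<exists>\<phi>\<in>D. \<forall>\<^sub>F n in sequentially. norm (A n - \<phi> n) \<le> \<epsilon>" using \<phi>(1) by blast
qed

text \<open>Closure is demanded only from some level on, because the product formula for monomials
  with truncations holds only at large levels.\<close>

locale star_algebra_germs =
  fixes D :: "op_seq set"
  assumes zero: "(\<lambda>_. 0) \<in> D"
    and lin: "\<phi> \<in> D \<Longrightarrow> clin (\<phi> n)"
    and add: "\<phi> \<in> D \<Longrightarrow> \<psi> \<in> D \<Longrightarrow> \<exists>\<theta>\<in>D. \<forall>\<^sub>F n in sequentially. \<phi> n + \<psi> n = \<theta> n"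
    and mult: "\<phi> \<in> D \<Longrightarrow> \<psi> \<in> D \<Longrightarrow> \<exists>\<theta>\<in>D. \<forall>\<^sub>F n in sequentially. \<phi> n o\<^sub>L \<psi> n = \<theta> n"
    and scale: "\<phi> \<in> D \<Longrightarrow> \<exists>\<theta>\<in>D. \<forall>\<^sub>F n in sequentially. scaleC_op c o\<^sub>L \<phi> n = \<theta> n"
    and adj: "\<phi> \<in> D \<Longrightarrow> \<exists>\<theta>\<in>D. \<forall>\<^sub>F n in sequentially. adj (\<phi> n) = \<theta> n"
begin

lemma approx_zero: "approx D (\<lambda>_. 0)"
  unfolding approx_def using zero by (auto intro!: bexI[of _ "\<lambda>_. 0"])

lemma approx_add:
  assumes "approx D A" "approx D B"
  shows "approx D (\<lambda>n. A n + B n)"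
  unfolding approx_def
proof (intro allI impI)
  fix \<epsilon> :: real assume "\<epsilon> > 0"
  then have e: "\<epsilon>/2 > 0" by simp
  obtain \<phi> where \<phi>: "\<phi> \<in> D" "\<forall>\<^sub>F n in sequentially. norm (A n - \<phi> n) \<le> \<epsilon>/2"
    using approxE[OF assms(1) e] .
  obtain \<psi> where \<psi>: "\<psi> \<in> D" "\<forall>\<^sub>F n in sequentially. norm (B n - \<psi> n) \<le> \<epsilon>/2"
    using approxE[OF assms(2) e] .
  obtain \<theta> where \<theta>: "\<theta> \<in> D" "\<forall>\<^sub>F n in sequentially. \<phi> n + \<psi> n = \<theta> n"
    using add[OF \<phi>(1) \<psi>(1)] by blast
  have "\<forall>\<^sub>F n in sequentially. norm (A n + B n - \<theta> n) \<le> \<epsilon>"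
    using \<phi>(2) \<psi>(2) \<theta>(2)
  proof eventually_elim
    case (elim n)
    have "A n + B n - \<theta> n = (A n - \<phi> n) + (B n - \<psi> n)" by (simp add: elim(3)[symmetric])
    then show ?case using norm_triangle_mono[OF elim(1,2)] by (simp only: field_sum_of_halves)
  qed
  then show "\<exists>\<phi>\<in>D. \<forall>\<^sub>F n in sequentially. norm (A n + B n - \<phi> n) \<le> \<epsilon>" using \<theta>(1) by blast
qed

lemma approx_mult:
  assumes "approx D A" "approx D B" "\<And>n. norm (A n) \<le> a" "\<And>n. norm (B n) \<le> b" "0 < a" "0 < b"
  shows "approx D (\<lambda>n. A n o\<^sub>L B n)"
  unfolding approx_def
proof (intro allI impI)
  fix \<epsilon> :: real assume \<epsilon>: "\<epsilon> > 0"
  \<comment> \<open>The cap 1 keeps \<open>norm (\<psi> n) \<le> b + 1\<close> eventually, and the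
    other value makes \<open>a * \<delta>\<close> at most half of \<open>\<epsilon>\<close>.\<close>
  define \<delta> where "\<delta> = min 1 (\<epsilon> / (2 * a))"
  have d: "\<delta> > 0" "\<delta> \<le> 1" "a * \<delta> \<le> \<epsilon>/2"
    using \<epsilon> assms(5) by (auto simp: \<delta>_def min_def field_simps)
  obtain \<psi> where \<psi>: "\<psi> \<in> D" "\<forall>\<^sub>F n in sequentially. norm (B n - \<psi> n) \<le> \<delta>"
    using approxE[OF assms(2) d(1)] .
  have e: "\<epsilon> / (2 * (b + 1)) > 0" using \<epsilon> assms(6) by auto
  obtain \<phi> where \<phi>: "\<phi> \<in> D" "\<forall>\<^sub>F n in sequentially. norm (A n - \<phi> n) \<le> \<epsilon> / (2 * (b + 1))"
    using approxE[OF assms(1) e] .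
  obtain \<theta> where \<theta>: "\<theta> \<in> D" "\<forall>\<^sub>F n in sequentially. \<phi> n o\<^sub>L \<psi> n = \<theta> n"
    using mult[OF \<phi>(1) \<psi>(1)] by blast
  have "\<forall>\<^sub>F n in sequentially. norm ((A n o\<^sub>L B n) - \<theta> n) \<le> \<epsilon>"
    using \<phi>(2) \<psi>(2) \<theta>(2)
  proof eventually_elim
    case (elim n)
    have "norm (\<psi> n) \<le> norm (B n) + norm (B n - \<psi> n)" by (metis norm_triangle_sub norm_minus_commute)
    then have p: "norm (\<psi> n) \<le> b + 1" using elim(2) d(2) assms(4)[of n] by linarith
    have "(A n o\<^sub>L B n) - \<theta> n = (A n o\<^sub>L (B n - \<psi> n)) + ((A n - \<phi> n) o\<^sub>L \<psi> n)"
      using elim(3) by (simp add: compose_simps)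
    also have "norm \<dots> \<le> a * \<delta> + \<epsilon> / (2 * (b + 1)) * (b + 1)"
      by (intro norm_triangle_mono norm_compose_le assms elim p)
    also have "\<epsilon> / (2 * (b + 1)) * (b + 1) = \<epsilon>/2" using assms(6) by (simp add: field_simps)
    also have "a * \<delta> + \<epsilon>/2 \<le> \<epsilon>" using d(3) by simp
    finally show ?case .
  qed
  then show "\<exists>\<phi>\<in>D. \<forall>\<^sub>F n in sequentially. norm ((A n o\<^sub>L B n) - \<phi> n) \<le> \<epsilon>" using \<theta>(1) by blast
qed

lemma approx_map:
  assumes "approx D A" and f: "\<And>\<phi>. \<phi> \<in> D \<Longrightarrow> \<exists>\<theta>\<in>D. \<forall>\<^sub>F n in sequentially. f (\<phi> n) = \<theta> n"
    and C: "\<And>\<phi> n. \<phi> \<in> D \<Longrightarrow> norm (f (A n) - f (\<phi> n)) \<le> C * norm (A n - \<phi> n)" "0 < C"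
  shows "approx D (\<lambda>n. f (A n))"
  unfolding approx_def
proof (intro allI impI)
  fix \<epsilon> :: real assume "\<epsilon> > 0"
  then have e: "\<epsilon> / C > 0" using C(2) by simp
  obtain \<phi> where \<phi>: "\<phi> \<in> D" "\<forall>\<^sub>F n in sequentially. norm (A n - \<phi> n) \<le> \<epsilon> / C"
    using approxE[OF assms(1) e] .
  obtain \<theta> where \<theta>: "\<theta> \<in> D" "\<forall>\<^sub>F n in sequentially. f (\<phi> n) = \<theta> n"
    using f[OF \<phi>(1)] by blast
  have "\<forall>\<^sub>F n in sequentially. norm (f (A n) - \<theta> n) \<le> \<epsilon>"
    using \<phi>(2) \<theta>(2)
  proof eventually_elim
    case (elim n)
    have "C * norm (A n - \<phi> n) \<le> \<epsilon>" using elim(1) C(2) by (simp add: field_simps)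
    then show ?case using C(1)[OF \<phi>(1), of n] elim(2) by simp
  qed
  then show "\<exists>\<phi>\<in>D. \<forall>\<^sub>F n in sequentially. norm (f (A n) - \<phi> n) \<le> \<epsilon>" using \<theta>(1) by blast
qed

lemma approx_scale: "approx D A \<Longrightarrow> approx D (\<lambda>n. scaleC_op c o\<^sub>L A n)"
proof (rule approx_map[where f = "\<lambda>X. scaleC_op c o\<^sub>L X" and C = "cmod c + 1"])
  show "norm ((scaleC_op c o\<^sub>L A n) - (scaleC_op c o\<^sub>L \<phi> n)) \<le> (cmod c + 1) * norm (A n - \<phi> n)" for \<phi> n
    unfolding compose_simps[symmetric]
    by (intro norm_compose_le order_refl order_trans[OF norm_scaleC_op_le]) simp
qed (auto intro: scale simp: add_nonneg_pos)

lemma approx_adj: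
  assumes "approx D A" "\<And>n. clin (A n)"
  shows "approx D (\<lambda>n. adj (A n))"
  using assms(1)
proof (rule approx_map[where f = adj and C = 1])
  show "norm (adj (A n) - adj (\<phi> n)) \<le> 1 * norm (A n - \<phi> n)" if "\<phi> \<in> D" for \<phi> n
    using norm_adj_le[of "A n - \<phi> n"] assms(2) lin[OF that] by (simp add: adj_diff)
qed (auto intro: adj)

text \<open>A single operator enters as a constant sequence, so one notion of germ serves both the
  Cuntz algebra and the algebra of sequences.\<close>

lemma cstar_subalgebra_L: "cstar_subalgebra {X. clin X \<and> approx D (\<lambda>_. X)} L_ell2"
  unfolding cstar_subalgebra_def norm_closed_in_def
proof (intro conjI ballI allI impI)
  fix f :: "op_seq" and a
  assume a: "a \<in> carrier L_ell2"
    and f: "(\<forall>n. f n \<in> {X. clin X \<and> approx D (\<lambda>_. X)}) \<and> (\<lambda>n. nrm L_ell2 (f n \<ominus>\<^bsub>L_ell2\<^esub> a)) \<longlonglongrightarrow> 0"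
  have "(\<lambda>n. norm (f n - a)) \<longlonglongrightarrow> 0" using a f by (simp add: minus_L carrier_L)
  then have "approx D (\<lambda>_. a)"
  proof (intro approx_closed)
    fix \<epsilon> :: real assume "\<epsilon> > 0" "(\<lambda>n. norm (f n - a)) \<longlonglongrightarrow> 0"
    then have "\<forall>\<^sub>F n in sequentially. norm (f n - a) < \<epsilon>" by (intro order_tendstoD)
    then obtain n where "norm (f n - a) < \<epsilon>" by (auto simp: eventually_sequentially)
    then show "\<exists>B. approx D B \<and> (\<forall>\<^sub>F n in sequentially. norm (a - B n) \<le> \<epsilon>)"
      using f by (intro exI[of _ "\<lambda>_. f n"]) (auto simp: norm_minus_commute)
  qed
  then show "a \<in> {X. clin X \<and> approx D (\<lambda>_. X)}" using a by (simp add: carrier_L)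
next
  fix A B assume "A \<in> {X. clin X \<and> approx D (\<lambda>_. X)}" "B \<in> {X. clin X \<and> approx D (\<lambda>_. X)}"
  then show "A \<oplus>\<^bsub>L_ell2\<^esub> B \<in> {X. clin X \<and> approx D (\<lambda>_. X)}"
    "A \<otimes>\<^bsub>L_ell2\<^esub> B \<in> {X. clin X \<and> approx D (\<lambda>_. X)}"
    using approx_add[of "\<lambda>_. A" "\<lambda>_. B"]
      approx_mult[of "\<lambda>_. A" "\<lambda>_. B" "norm A + 1" "norm B + 1"] by (auto simp: add_nonneg_pos)
qed (use approx_zero approx_scale[of "\<lambda>_. A" for A] approx_adj[of "\<lambda>_. A" for A] in \<open>auto simp: carrier_L\<close>)

lemma cstar_subalgebra_F: "cstar_subalgebra {A \<in> carrier (F_alg \<eta>). approx D A} (F_alg \<eta>)"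
  unfolding cstar_subalgebra_def norm_closed_in_def
proof (intro conjI ballI allI impI)
  fix f :: "nat \<Rightarrow> nat \<Rightarrow> ell2 \<Rightarrow>\<^sub>L ell2" and a
  assume a: "a \<in> carrier (F_alg \<eta>)"
    and f: "(\<forall>n. f n \<in> {A \<in> carrier (F_alg \<eta>). approx D A}) \<and> (\<lambda>n. nrm (F_alg \<eta>) (f n \<ominus>\<^bsub>F_alg \<eta>\<^esub> a)) \<longlonglongrightarrow> 0"
  have "approx D a"
  proof (rule approx_closed)
    fix \<epsilon> :: real assume "\<epsilon> > 0"
    then have "\<forall>\<^sub>F n in sequentially. nrm (F_alg \<eta>) (f n \<ominus>\<^bsub>F_alg \<eta>\<^esub> a) < \<epsilon>"
      using f by (intro order_tendstoD[where y = 0]) auto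
    then obtain n where n: "nrm (F_alg \<eta>) (\<lambda>i. f n i - a i) < \<epsilon>"
      unfolding minus_F[OF a] eventually_sequentially by blast
    have "norm (f n i - a i) < \<epsilon>" for i
      using norm_le_nrm_F[OF F_closed2(2)[of "f n", OF _ a], of i] n f by auto
    then show "\<exists>B. approx D B \<and> (\<forall>\<^sub>F n in sequentially. norm (a n - B n) \<le> \<epsilon>)"
      using f by (intro exI[of _ "f n"]) (auto simp: norm_minus_commute less_imp_le)
  qed
  then show "a \<in> {A \<in> carrier (F_alg \<eta>). approx D A}" using a by simp
next
  fix A B assume "A \<in> {A \<in> carrier (F_alg \<eta>). approx D A}" "B \<in> {A \<in> carrier (F_alg \<eta>). approx D A}"
  moreover from this obtain a b where "a > 0" "\<And>n. norm (A n) \<le> a" "b > 0" "\<And>n. norm (B n) \<le> b"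
    by (metis (no_types, lifting) F_bound mem_Collect_eq)
  ultimately show "A \<oplus>\<^bsub>F_alg \<eta>\<^esub> B \<in> {A \<in> carrier (F_alg \<eta>). approx D A}"
    "A \<otimes>\<^bsub>F_alg \<eta>\<^esub> B \<in> {A \<in> carrier (F_alg \<eta>). approx D A}"
    using approx_add[of A B] approx_mult[of A B a b] by (auto simp: F_closed2)
qed (use approx_zero approx_scale approx_adj in \<open>auto simp: F_closed F_zero_one F_memD\<close>)

end

lemma germ_self: "A \<in> D \<Longrightarrow> \<exists>\<theta>\<in>D. \<forall>\<^sub>F n in sequentially. A n = \<theta> n"
  by (rule bexI[of _ A]) auto

text \<open>When \<open>D\<close> consists of all complex-linear sequences, every element of the two
  carriers approximates itself. Hence the carriers are subalgebras as special cases of the two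
  preceding closure results.\<close>

interpretation all_germs: star_algebra_germs "{\<phi>. \<forall>n. clin (\<phi> n)}"
  by unfold_locales ((rule germ_self)?, simp)+

lemma approx_self: "A \<in> D \<Longrightarrow> approx D A"
  unfolding approx_def by (auto intro!: bexI[of _ A])

lemma cstar_subalgebra_carrier_L: "cstar_subalgebra (carrier L_ell2) L_ell2"
proof -
  have "carrier L_ell2 = {X. clin X \<and> approx {\<phi>. \<forall>n. clin (\<phi> n)} (\<lambda>_. X)}"
    by (auto simp: carrier_L intro: approx_self)
  then show ?thesis using all_germs.cstar_subalgebra_L by simp
qed

lemma cstar_subalgebra_carrier_F: "cstar_subalgebra (carrier (F_alg \<eta>)) (F_alg \<eta>)"
proof -
  have "carrier (F_alg \<eta>) = {A \<in> carrier (F_alg \<eta>). approx {\<phi>. \<forall>n. clin (\<phi> n)} A}"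
    by (auto intro: approx_self F_memD(1))
  then show ?thesis
    by (rule ssubst[where P = "\<lambda>B. cstar_subalgebra B (F_alg \<eta>)"]) (rule all_germs.cstar_subalgebra_F)
qed

section \<open>Linear spans of monomial sequences, up to finitely many levels\<close>

inductive_set germ_span :: "op_seq set \<Rightarrow> op_seq set" for M where
  gen: "\<phi> \<in> M \<Longrightarrow> \<phi> \<in> germ_span M"
| zero: "(\<lambda>_. 0) \<in> germ_span M"
| add: "\<phi> \<in> germ_span M \<Longrightarrow> \<psi> \<in> germ_span M \<Longrightarrow> (\<lambda>n. \<phi> n + \<psi> n) \<in> germ_span M"
| scale: "\<phi> \<in> germ_span M \<Longrightarrow> (\<lambda>n. scaleC_op c o\<^sub>L \<phi> n) \<in> germ_span M"

definition in_germ :: "op_seq set \<Rightarrow> op_seq \<Rightarrow> bool" where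
  "in_germ M \<phi> \<longleftrightarrow> (\<exists>\<theta>\<in>germ_span M. \<forall>\<^sub>F n in sequentially. \<phi> n = \<theta> n)"

lemma in_germ_span: "\<phi> \<in> germ_span M \<Longrightarrow> in_germ M \<phi>"
  unfolding in_germ_def by (rule bexI[of _ \<phi>]) auto

lemma in_germ_cong: "\<forall>\<^sub>F n in sequentially. \<phi> n = \<psi> n \<Longrightarrow> in_germ M \<psi> \<Longrightarrow> in_germ M \<phi>"
  unfolding in_germ_def by (elim bexE, rule bexI[rotated], assumption) (auto elim: eventually_elim2)

lemma in_germ_add: "in_germ M \<phi> \<Longrightarrow> in_germ M \<psi> \<Longrightarrow> in_germ M (\<lambda>n. \<phi> n + \<psi> n)"
  unfolding in_germ_def
proof (elim bexE)
  fix \<theta> \<theta>'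
  assume "\<theta> \<in> germ_span M" "\<theta>' \<in> germ_span M" "\<forall>\<^sub>F n in sequentially. \<phi> n = \<theta> n" "\<forall>\<^sub>F n in sequentially. \<psi> n = \<theta>' n"
  then show "\<exists>\<theta>\<in>germ_span M. \<forall>\<^sub>F n in sequentially. \<phi> n + \<psi> n = \<theta> n"
    by (intro bexI[of _ "\<lambda>n. \<theta> n + \<theta>' n"] germ_span.add) (auto elim: eventually_elim2)
qed

lemma in_germ_scale: "in_germ M \<phi> \<Longrightarrow> in_germ M (\<lambda>n. scaleC_op c o\<^sub>L \<phi> n)"
  unfolding in_germ_def
  by (elim bexE, rule bexI[OF _ germ_span.scale]) (assumption | auto elim: eventually_mono)+

text \<open>The disjunction reflects that the product of two monomials is computed only when the
  digits deleted by the left factor are among those appended by the right one. In the other case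
  \<open>adj (\<psi> n) o\<^sub>L adj (\<phi> n)\<close> has the computable form, and its adjoint is
  the product.\<close>

lemma star_algebra_germs_span:
  assumes M: "\<And>\<phi> n. \<phi> \<in> M \<Longrightarrow> clin (\<phi> n)"
    and mult: "\<And>\<phi> \<psi>. \<phi> \<in> M \<Longrightarrow> \<psi> \<in> M \<Longrightarrow>
      (\<exists>\<theta>\<in>insert (\<lambda>_. 0) M. \<forall>\<^sub>F n in sequentially. \<phi> n o\<^sub>L \<psi> n = \<theta> n) \<or>
      (\<exists>\<theta>\<in>insert (\<lambda>_. 0) M. \<forall>\<^sub>F n in sequentially. adj (\<psi> n) o\<^sub>L adj (\<phi> n) = \<theta> n)"
    and adj: "\<And>\<phi>. \<phi> \<in> M \<Longrightarrow> (\<lambda>n. adj (\<phi> n)) \<in> M"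
  shows "star_algebra_germs (germ_span M)"
proof -
  have lin: "clin (\<phi> n)" if "\<phi> \<in> germ_span M" for \<phi> n
    using that by induction (auto intro: M)
  have assoc: "(scaleC_op c o\<^sub>L A) o\<^sub>L B = scaleC_op c o\<^sub>L (A o\<^sub>L B)" for c A B
    by (rule compose_assoc)
  have gen: "in_germ M \<phi>" if "\<theta> \<in> insert (\<lambda>_. 0) M" "\<forall>\<^sub>F n in sequentially. \<phi> n = \<theta> n" for \<phi> \<theta>
    by (rule in_germ_cong[OF that(2)]) (use that(1) in \<open>auto intro!: in_germ_span intro: germ_span.intros\<close>)
  have mult0: "in_germ M (\<lambda>n. \<phi> n o\<^sub>L \<psi> n)" if MM: "\<phi> \<in> M" "\<psi> \<in> M" for \<phi> \<psi>
    using mult[OF MM]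
  proof (elim disjE bexE)
    fix \<theta> assume \<theta>: "\<theta> \<in> insert (\<lambda>_. 0) M" "\<forall>\<^sub>F n in sequentially. adj (\<psi> n) o\<^sub>L adj (\<phi> n) = \<theta> n"
    have eq: "\<phi> n o\<^sub>L \<psi> n = adj (adj (\<psi> n) o\<^sub>L adj (\<phi> n))" for n
      by (simp add: adj_compose M MM)
    show ?thesis
    proof (rule gen)
      show "(\<lambda>n. adj (\<theta> n)) \<in> insert (\<lambda>_. 0) M" using \<theta>(1) adj by auto
      show "\<forall>\<^sub>F n in sequentially. \<phi> n o\<^sub>L \<psi> n = adj (\<theta> n)"
        using \<theta>(2) by eventually_elim (simp only: eq)
    qed
  qed (rule gen)
  have mult1: "in_germ M (\<lambda>n. \<phi> n o\<^sub>L \<psi> n)" if "\<phi> \<in> M" "\<psi> \<in> germ_span M" for \<phi> \<psi>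
    using that(2)
  proof induction
    case (scale \<psi> c)
    have "(\<lambda>n. \<phi> n o\<^sub>L (scaleC_op c o\<^sub>L \<psi> n)) = (\<lambda>n. scaleC_op c o\<^sub>L (\<phi> n o\<^sub>L \<psi> n))"
      using M[OF that(1)] by (simp add: compose_assoc[symmetric] scaleC_op_commute)
    then show ?case using in_germ_scale[OF scale.IH] by simp
  qed (use that mult0 in \<open>auto simp: compose_simps intro: in_germ_add in_germ_span germ_span.zero\<close>)
  have mult2: "in_germ M (\<lambda>n. \<phi> n o\<^sub>L \<psi> n)" if "\<phi> \<in> germ_span M" "\<psi> \<in> germ_span M" for \<phi> \<psi>
    using that(1)
    by induction
      (use that mult1 in \<open>auto simp: compose_simps assoc intro: in_germ_add in_germ_scale in_germ_span germ_span.zero\<close>)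
  have adj2: "in_germ M (\<lambda>n. adj (\<phi> n))" if "\<phi> \<in> germ_span M" for \<phi>
    using that
  proof induction
    case (add \<phi> \<psi>)
    then show ?case by (simp add: adj_add lin in_germ_add)
  next
    case (scale \<phi> c)
    have "(\<lambda>n. adj (scaleC_op c o\<^sub>L \<phi> n)) = (\<lambda>n. scaleC_op (cnj c) o\<^sub>L adj (\<phi> n))"
      using lin[OF scale(1)] by (simp add: adj_compose adj_scaleC_op scaleC_op_commute)
    then show ?case using in_germ_scale[OF scale.IH] by simp
  qed (auto intro: in_germ_span germ_span.zero germ_span.gen adj)
  show ?thesis
  proof
    show "\<exists>\<theta>\<in>germ_span M. \<forall>\<^sub>F n in sequentially. \<phi> n + \<psi> n = \<theta> n"
      if "\<phi> \<in> germ_span M" "\<psi> \<in> germ_span M" for \<phi> \<psi>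
      using in_germ_add[OF in_germ_span[OF that(1)] in_germ_span[OF that(2)]] by (simp add: in_germ_def)
    show "\<exists>\<theta>\<in>germ_span M. \<forall>\<^sub>F n in sequentially. scaleC_op c o\<^sub>L \<phi> n = \<theta> n"
      if "\<phi> \<in> germ_span M" for \<phi> c
      using in_germ_scale[OF in_germ_span[OF that(1)]] by (simp add: in_germ_def)
  qed (use lin mult2 adj2 in \<open>auto simp: in_germ_def intro: germ_span.zero\<close>)
qed

subsection \<open>Digit shifts\<close>

locale cuntz_sections =
  fixes N :: nat
  assumes N2: "N \<ge> 2"
begin

abbreviation \<eta> :: "nat \<Rightarrow> nat" where "\<eta> \<equiv> \<lambda>n. N ^ n"

lemma N_pos [simp]: "0 < N"
  using N2 by simp

lemma pow_less_iff [simp]: "N ^ a < N ^ b \<longleftrightarrow> a < b"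
  using N2 by simp

lemma pow_le_iff [simp]: "N ^ a \<le> N ^ b \<longleftrightarrow> a \<le> b"
  using N2 by simp

lemma less_pow: "j < N ^ j"
  using N2 by (simp add: power_gt_expt)

lemma digit_less: "r < M \<Longrightarrow> q * M + r < p * M \<longleftrightarrow> q < (p :: nat)"
proof
  assume r: "r < M" and "q < p"
  then have "(q + 1) * M \<le> p * M" by (intro mult_right_mono) auto
  then show "q * M + r < p * M" using r by simp
next
  assume "q * M + r < p * M"
  then have "q * M < p * M" by linarith
  then show "q < p" by simp
qed

lemma less_pow_split: "a \<le> n \<Longrightarrow> v < N ^ a \<Longrightarrow> q * N ^ a + v < N ^ n \<longleftrightarrow> q < N ^ (n - a)"
  using digit_less[of v "N ^ a" q "N ^ (n - a)"] by (simp add: power_add[symmetric])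

lemma less_pow_mono: "j < N ^ a \<Longrightarrow> a \<le> b \<Longrightarrow> j < N ^ b"
  by (erule less_le_trans) simp

lemma append_less: "q < N ^ (n - k) \<Longrightarrow> a \<le> k \<Longrightarrow> k \<le> n \<Longrightarrow> v < N ^ a \<Longrightarrow> q * N ^ a + v < N ^ n"
  using less_pow_split[of a n v q] less_pow_mono[of q "n - k" "n - a"] by simp

lemma marker_less: "w < N ^ k \<Longrightarrow> k < l \<Longrightarrow> N ^ k + w < N ^ l"
proof -
  assume "w < N ^ k" "k < l"
  then have "N ^ k + w < 2 * N ^ k" by simp
  also have "\<dots> \<le> N ^ Suc k" using N2 by simp
  also have "\<dots> \<le> N ^ l" using \<open>k < l\<close> by (simp del: power_Suc)
  finally show ?thesis .
qed

lemma div_less_pow: "b \<le> n \<Longrightarrow> j div N ^ b < N ^ (n - b) \<longleftrightarrow> j < N ^ n"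
  by (simp add: div_less_iff_less_mult power_add[symmetric])

text \<open>A basis vector below \<open>N ^ n\<close> is a word of \<open>n\<close> digits in base \<open>N\<close>, with leading zeros. \<open>T a v\<close> appends
  the \<open>a\<close> digits of \<open>v\<close>.\<close>

definition T :: "nat \<Rightarrow> nat \<Rightarrow> ell2 \<Rightarrow>\<^sub>L ell2" where
  "T a v = cuntz_iso (N ^ a) v"

lemma T_basis: "v < N ^ a \<Longrightarrow> T a v (basis j) = basis (j * N ^ a + v)"
  by (simp add: T_def cuntz_iso_basis)

lemma adj_T_basis: "v < N ^ a \<Longrightarrow> adj (T a v) (basis j) = (if j mod N ^ a = v then basis (j div N ^ a) else 0)"
  by (simp add: T_def adj_cuntz_iso_basis)

lemma clin_T [simp]: "clin (T a v)"
  by (simp add: T_def)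

lemma norm_T_le: "norm (T a v) \<le> 1"
  by (simp add: T_def norm_cuntz_iso_le)

lemma T_0: "T 0 0 = id_blinfun"
  by (rule clin_eqI) (auto simp: T_basis)

lemma adj_T_0: "adj (T 0 0) = id_blinfun"
  by (rule clin_eqI) (auto simp: adj_T_basis)

lemma T_Suc: "v < N ^ Suc a \<Longrightarrow> T (Suc a) v = T a (v mod N ^ a) o\<^sub>L cuntz_iso N (v div N ^ a)"
proof (rule clin_eqI)
  fix j assume "v < N ^ Suc a"
  then have "v div N ^ a < N" by (simp add: div_less_iff_less_mult)
  moreover have "(j * N + v div N ^ a) * N ^ a + v mod N ^ a = j * N ^ Suc a + v"
    by (simp add: algebra_simps)
  ultimately show "T (Suc a) v (basis j) = (T a (v mod N ^ a) o\<^sub>L cuntz_iso N (v div N ^ a)) (basis j)"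
    using \<open>v < N ^ Suc a\<close> by (simp add: T_basis cuntz_iso_basis)
qed auto

definition shift0 :: "nat \<Rightarrow> nat \<Rightarrow> nat \<Rightarrow> nat \<Rightarrow> ell2 \<Rightarrow>\<^sub>L ell2" where
  "shift0 a v b w = T a v o\<^sub>L adj (T b w)"

text \<open>Products of sections leave truncations behind, as in \<open>proj_eq_sections\<close>, so
  the monomials carry the extra parameter \<open>k\<close>: the word left after the deletion of
  \<open>w\<close> has to fit into \<open>n - k\<close> digits.\<close>

definition shift :: "nat \<Rightarrow> nat \<Rightarrow> nat \<Rightarrow> nat \<Rightarrow> nat \<Rightarrow> nat \<Rightarrow> ell2 \<Rightarrow>\<^sub>L ell2" where
  "shift k a v b w n = T a v o\<^sub>L proj (N ^ (n - k)) o\<^sub>L adj (T b w)"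

lemma shift_basis:
  assumes "v < N ^ a" "w < N ^ b"
  shows "shift0 a v b w (basis j) = (if j mod N ^ b = w then basis ((j div N ^ b) * N ^ a + v) else 0)"
    and "shift k a v b w n (basis j) =
      (if j mod N ^ b = w \<and> j div N ^ b < N ^ (n - k) then basis ((j div N ^ b) * N ^ a + v) else 0)"
  using assms by (auto simp: shift0_def shift_def T_basis adj_T_basis)

lemma clin_shift [simp]: "clin (shift0 a v b w)" "clin (shift k a v b w n)"
  by (auto simp: shift_def shift0_def)

lemma adj_shift: "adj (shift0 a v b w) = shift0 b w a v" "adj (shift k a v b w n) = shift k b w a v n"
  by (simp_all add: shift_def shift0_def adj_compose compose_assoc)

text \<open>\<open>a \<le> k\<close> and \<open>b \<le> k\<close> keep the words before and after
  the shift within \<open>n\<close> digits once \<open>n \<ge> k\<close>.\<close>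

definition shifts :: "op_seq set" where
  "shifts = {shift k a v b w | k a v b w. a \<le> k \<and> b \<le> k \<and> v < N ^ a \<and> w < N ^ b}"

definition shifts0 :: "op_seq set" where
  "shifts0 = {(\<lambda>_. shift0 a v b w) | a v b w. v < N ^ a \<and> w < N ^ b}"

lemma shift_digits:
  assumes "b \<le> a'" "v' < N ^ a'"
  shows "(q * N ^ a' + v') mod N ^ b = v' mod N ^ b"
    and "(q * N ^ a' + v') div N ^ b = q * N ^ (a' - b) + v' div N ^ b"
    and "v' div N ^ b < N ^ (a' - b)"
proof -
  have e: "N ^ a' = N ^ (a' - b) * N ^ b" using assms(1) by (simp add: power_add[symmetric])
  show "(q * N ^ a' + v') mod N ^ b = v' mod N ^ b" unfolding e by (simp add: mult.assoc[symmetric])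
  show "(q * N ^ a' + v') div N ^ b = q * N ^ (a' - b) + v' div N ^ b"
    unfolding e mult.assoc[symmetric] by (simp add: div_mult_self3)
  show "v' div N ^ b < N ^ (a' - b)" using assms by (simp add: div_less_pow)
qed

text \<open>The right factor appends \<open>v'\<close>, and the left one deletes its last
  \<open>b\<close> digits, which must be \<open>w\<close>. The other \<open>d\<close> digits of
  \<open>v'\<close> stay in front of \<open>v\<close>, which gives \<open>u\<close>. They also turn
  the truncation of the left factor into one that is \<open>d\<close> digits deeper for the word to
  their left, whence \<open>max (k + d) k'\<close>.\<close>

lemma shift_mult:
  assumes "v < N ^ a" "w < N ^ b" "v' < N ^ a'" "w' < N ^ b'" "b \<le> a'"
  defines "d \<equiv> a' - b" and "u \<equiv> (v' div N ^ b) * N ^ a + v"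
  shows "u < N ^ (a + d)"
    and "shift0 a v b w o\<^sub>L shift0 a' v' b' w' = (if v' mod N ^ b = w then shift0 (a + d) u b' w' else 0)"
    and "n \<ge> k + d \<Longrightarrow> shift k a v b w n o\<^sub>L shift k' a' v' b' w' n =
      (if v' mod N ^ b = w then shift (max (k + d) k') (a + d) u b' w' n else 0)"
proof -
  note sh = shift_digits[OF assms(5,3), folded d_def]
  show u: "u < N ^ (a + d)"
    unfolding u_def using digit_less[OF assms(1), of "v' div N ^ b" "N ^ d"] sh(3)
    by (simp add: power_add mult.commute)
  have e: "(q * N ^ d + v' div N ^ b) * N ^ a + v = q * N ^ (a + d) + u" for q
    by (simp add: u_def algebra_simps power_add)
  show "shift0 a v b w o\<^sub>L shift0 a' v' b' w' = (if v' mod N ^ b = w then shift0 (a + d) u b' w' else 0)"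
    by (rule clin_eqI) (use assms(1-4) u in \<open>auto simp: shift_basis sh e\<close>)
  assume n: "n \<ge> k + d"
  have lt: "q * N ^ d + v' div N ^ b < N ^ (n - k) \<longleftrightarrow> q < N ^ (n - (k + d))" for q
    using less_pow_split[of d "n - k" "v' div N ^ b" q] n sh(3) by (simp add: diff_diff_eq)
  have mx: "q < N ^ (n - max (k + d) k') \<longleftrightarrow> q < N ^ (n - (k + d)) \<and> q < N ^ (n - k')" for q
  proof -
    have "N ^ (n - max (k + d) k') = min (N ^ (n - (k + d))) (N ^ (n - k'))"
      by (simp add: max_def min_def) (metis diff_le_mono2 le_antisym nat_le_linear pow_le_iff)
    then show ?thesis by simp
  qed
  show "shift k a v b w n o\<^sub>L shift k' a' v' b' w' n =
      (if v' mod N ^ b = w then shift (max (k + d) k') (a + d) u b' w' n else 0)"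
    by (rule clin_eqI) (use assms(1-4) u in \<open>auto simp: shift_basis sh e lt mx\<close>)
qed

lemma star_algebra_germs_shifts: "star_algebra_germs (germ_span shifts)"
proof (rule star_algebra_germs_span)
  show adj: "(\<lambda>n. adj (\<phi> n)) \<in> shifts" if "\<phi> \<in> shifts" for \<phi>
    using that by (fastforce simp: shifts_def adj_shift)
  have *: "\<exists>\<theta>\<in>insert (\<lambda>_. 0) shifts. \<forall>\<^sub>F n in sequentially. shift k a v b w n o\<^sub>L shift k' a' v' b' w' n = \<theta> n"
    if "v < N ^ a" "w < N ^ b" "v' < N ^ a'" "w' < N ^ b'" "b \<le> a'" "a \<le> k" "b \<le> k" "a' \<le> k'" "b' \<le> k'"
    for k a v b w k' a' v' b' w'
  proof (cases "v' mod N ^ b = w")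
    case True
    let ?d = "a' - b" let ?u = "(v' div N ^ b) * N ^ a + v"
    note m = shift_mult[OF that(1-5)]
    have "shift (max (k + ?d) k') (a + ?d) ?u b' w' \<in> shifts"
      unfolding shifts_def using that m(1) by fastforce
    moreover have "\<forall>\<^sub>F n in sequentially. shift k a v b w n o\<^sub>L shift k' a' v' b' w' n =
        shift (max (k + ?d) k') (a + ?d) ?u b' w' n"
      using eventually_ge_at_top[of "k + ?d"] by eventually_elim (simp add: m(3) True)
    ultimately show ?thesis by blast
  next
    case False
    have "\<forall>\<^sub>F n in sequentially. shift k a v b w n o\<^sub>L shift k' a' v' b' w' n = 0"
      using eventually_ge_at_top[of "k + (a' - b)"] by eventually_elim (simp add: shift_mult[OF that(1-5)] False)
    then show ?thesis by (intro bexI[of _ "\<lambda>_. 0"]) auto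
  qed
  fix \<phi> \<psi> assume "\<phi> \<in> shifts" "\<psi> \<in> shifts"
  then obtain k a v b w k' a' v' b' w' where
    \<phi>: "\<phi> = shift k a v b w" "a \<le> k" "b \<le> k" "v < N ^ a" "w < N ^ b" and
    \<psi>: "\<psi> = shift k' a' v' b' w'" "a' \<le> k'" "b' \<le> k'" "v' < N ^ a'" "w' < N ^ b'"
    by (auto simp: shifts_def)
  show "(\<exists>\<theta>\<in>insert (\<lambda>_. 0) shifts. \<forall>\<^sub>F n in sequentially. \<phi> n o\<^sub>L \<psi> n = \<theta> n) \<or>
      (\<exists>\<theta>\<in>insert (\<lambda>_. 0) shifts. \<forall>\<^sub>F n in sequentially. adj (\<psi> n) o\<^sub>L adj (\<phi> n) = \<theta> n)"
    unfolding \<phi>(1) \<psi>(1) adj_shift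
    using *[OF \<phi>(4,5) \<psi>(4,5) _ \<phi>(2,3) \<psi>(2,3)] *[OF \<psi>(5,4) \<phi>(5,4) _ \<psi>(3,2) \<phi>(3,2)]
    by (meson nat_le_linear)
qed (auto simp: shifts_def)

lemma star_algebra_germs_shifts0: "star_algebra_germs (germ_span shifts0)"
proof (rule star_algebra_germs_span)
  show adj: "(\<lambda>n. adj (\<phi> n)) \<in> shifts0" if "\<phi> \<in> shifts0" for \<phi>
    using that by (fastforce simp: shifts0_def adj_shift)
  have *: "\<exists>\<theta>\<in>insert (\<lambda>_. 0) shifts0. \<forall>\<^sub>F n in sequentially. shift0 a v b w o\<^sub>L shift0 a' v' b' w' = \<theta> n"
    if "v < N ^ a" "w < N ^ b" "v' < N ^ a'" "w' < N ^ b'" "b \<le> a'" for a v b w a' v' b' w'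
  proof (cases "v' mod N ^ b = w")
    case True
    have "(\<lambda>_. shift0 (a + (a' - b)) ((v' div N ^ b) * N ^ a + v) b' w') \<in> shifts0"
      unfolding shifts0_def using that shift_mult(1)[OF that(1-5)] by fastforce
    then show ?thesis using shift_mult(2)[OF that] True
      by (intro bexI[of _ "\<lambda>_. shift0 (a + (a' - b)) ((v' div N ^ b) * N ^ a + v) b' w'"]) auto
  qed (use shift_mult(2)[OF that] in auto)
  fix \<phi> \<psi> assume "\<phi> \<in> shifts0" "\<psi> \<in> shifts0"
  then obtain a v b w a' v' b' w' where
    \<phi>: "\<phi> = (\<lambda>_. shift0 a v b w)" "v < N ^ a" "w < N ^ b" and
    \<psi>: "\<psi> = (\<lambda>_. shift0 a' v' b' w')" "v' < N ^ a'" "w' < N ^ b'"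
    by (auto simp: shifts0_def)
  show "(\<exists>\<theta>\<in>insert (\<lambda>_. 0) shifts0. \<forall>\<^sub>F n in sequentially. \<phi> n o\<^sub>L \<psi> n = \<theta> n) \<or>
      (\<exists>\<theta>\<in>insert (\<lambda>_. 0) shifts0. \<forall>\<^sub>F n in sequentially. adj (\<psi> n) o\<^sub>L adj (\<phi> n) = \<theta> n)"
    unfolding \<phi>(1) \<psi>(1) adj_shift
    using *[OF \<phi>(2,3) \<psi>(2,3)] *[OF \<psi>(3,2) \<phi>(3,2)] by (meson nat_le_linear)
qed (auto simp: shifts0_def)


subsection \<open>The section algebra\<close>

lemma cuntz_subalgebra: "cstar_subalgebra (cuntz N) L_ell2"
  and cuntz_iso_cuntz: "i < N \<Longrightarrow> cuntz_iso N i \<in> cuntz N"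
  unfolding cuntz_def
  using cstar_subalgebra_generated[OF cstar_subalgebra_carrier_L, of "cuntz_iso N ` {..<N}"]
  by (auto simp: carrier_L)

lemma cuntz_clin: "A \<in> cuntz N \<Longrightarrow> clin A"
  using cuntz_subalgebra by (auto simp: cstar_subalgebra_def norm_closed_in_def carrier_L)

lemma cuntz_closed:
  "0 \<in> cuntz N" "A \<in> cuntz N \<Longrightarrow> B \<in> cuntz N \<Longrightarrow> A + B \<in> cuntz N"
  "A \<in> cuntz N \<Longrightarrow> B \<in> cuntz N \<Longrightarrow> A o\<^sub>L B \<in> cuntz N" "A \<in> cuntz N \<Longrightarrow> adj A \<in> cuntz N"
  using cuntz_subalgebra by (auto simp: cstar_subalgebra_def)

lemma cuntz_sum: "finite I \<Longrightarrow> (\<And>i. i \<in> I \<Longrightarrow> f i \<in> cuntz N) \<Longrightarrow> sum f I \<in> cuntz N"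
  by (induction I rule: finite_induct) (auto intro: cuntz_closed)

text \<open>The identity is not among the generators; it is recovered from the Cuntz relation that
  the range projections of the isometries sum to it.\<close>

lemma id_cuntz: "id_blinfun \<in> cuntz N"
proof -
  have eq: "id_blinfun = (\<Sum>i<N. cuntz_iso N i o\<^sub>L adj (cuntz_iso N i))"
  proof (rule clin_eqI)
    fix j
    have "(\<Sum>i<N. cuntz_iso N i (adj (cuntz_iso N i) (basis j))) = (\<Sum>i\<in>{j mod N}. basis j)"
      by (rule sum.mono_neutral_cong_right) (auto simp: adj_cuntz_iso_basis cuntz_iso_basis)
    then show "id_blinfun (basis j) = (\<Sum>i<N. cuntz_iso N i o\<^sub>L adj (cuntz_iso N i)) (basis j)"
      by (simp add: blinfun.sum_left)
  qed auto
  show ?thesis unfolding eq by (intro cuntz_sum cuntz_closed cuntz_iso_cuntz) auto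
qed

lemma T_cuntz: "v < N ^ a \<Longrightarrow> T a v \<in> cuntz N"
proof (induction a arbitrary: v)
  case 0
  then show ?case using id_cuntz T_0 by simp
next
  case (Suc a)
  then have "v div N ^ a < N" by (simp add: div_less_iff_less_mult)
  then show ?case
    unfolding T_Suc[OF Suc.prems] by (intro cuntz_closed Suc.IH cuntz_iso_cuntz) auto
qed

abbreviation S :: "op_seq set" where "S \<equiv> carrier (S_eta N)"

lemma carrier_S: "S = cstar_generated (F_alg \<eta>) (sections \<eta> ` cuntz N)"
  by (simp add: S_eta_def section_algebra_def)

lemma S_subalgebra: "cstar_subalgebra S (F_alg \<eta>)"
  and sections_S: "A \<in> cuntz N \<Longrightarrow> sections \<eta> A \<in> S"
  unfolding carrier_S
  using cstar_subalgebra_generated[OF cstar_subalgebra_carrier_F, of "sections \<eta> ` cuntz N" \<eta>]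
  by (auto intro: sections_F cuntz_clin)

lemma S_F: "A \<in> S \<Longrightarrow> A \<in> carrier (F_alg \<eta>)"
  using S_subalgebra by (auto simp: cstar_subalgebra_def norm_closed_in_def)

lemma S_clin: "A \<in> S \<Longrightarrow> clin (A n)"
  using S_F F_memD by blast

lemma S_closed:
  "(\<lambda>n. 0) \<in> S" "A \<in> S \<Longrightarrow> B \<in> S \<Longrightarrow> (\<lambda>n. A n + B n) \<in> S"
  "A \<in> S \<Longrightarrow> B \<in> S \<Longrightarrow> (\<lambda>n. A n o\<^sub>L B n) \<in> S" "A \<in> S \<Longrightarrow> (\<lambda>n. adj (A n)) \<in> S"
  "A \<in> S \<Longrightarrow> (\<lambda>n. scaleC_op c o\<^sub>L A n) \<in> S"
  using S_subalgebra by (auto simp: cstar_subalgebra_def)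

lemma S_uminus: "A \<in> S \<Longrightarrow> (\<lambda>n. - A n) \<in> S"
proof -
  assume A: "A \<in> S"
  have "(\<lambda>n. - A n) = (\<lambda>n. scaleC_op (-1) o\<^sub>L A n)"
    by (auto intro!: ext blinfun_eqI ell2_eqI simp: blinfun.bilinear_simps)
  then show ?thesis using S_closed(5)[OF A, of "-1"] by metis
qed

lemma S_diff: "A \<in> S \<Longrightarrow> B \<in> S \<Longrightarrow> (\<lambda>n. A n - B n) \<in> S"
  using S_closed(2)[OF _ S_uminus] by fastforce

lemma S_sum: "finite I \<Longrightarrow> (\<And>i. i \<in> I \<Longrightarrow> f i \<in> S) \<Longrightarrow> (\<lambda>n. \<Sum>i\<in>I. f i n) \<in> S"
  by (induction I rule: finite_induct) (auto intro: S_closed)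

lemma S_limit:
  assumes A: "A \<in> carrier (F_alg \<eta>)" and lim: "\<And>\<epsilon>. \<epsilon> > 0 \<Longrightarrow> \<exists>B\<in>S. \<forall>n. norm (B n - A n) \<le> \<epsilon>"
  shows "A \<in> S"
proof -
  have "\<exists>B. B \<in> S \<and> (\<forall>n. norm (B n - A n) \<le> inverse (real (Suc i)))" for i
    using lim[of "inverse (real (Suc i))"] by auto
  then obtain f where f: "\<And>i. f i \<in> S" "\<And>i n. norm (f i n - A n) \<le> inverse (real (Suc i))"
    by metis
  have "(\<lambda>i. nrm (F_alg \<eta>) (f i \<ominus>\<^bsub>F_alg \<eta>\<^esub> A)) \<longlonglongrightarrow> 0"
  proof (rule Lim_null_comparison[OF _ LIMSEQ_inverse_real_of_nat], rule always_eventually, rule allI)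
    fix i
    have m: "(\<lambda>n. f i n - A n) \<in> carrier (F_alg \<eta>)" using F_closed2(2)[OF S_F[OF f(1)] A] .
    have "0 \<le> nrm (F_alg \<eta>) (\<lambda>n. f i n - A n)"
      using norm_le_nrm_F[OF m, of 0] norm_ge_zero order_trans by blast
    moreover have "nrm (F_alg \<eta>) (\<lambda>n. f i n - A n) \<le> inverse (real (Suc i))"
      by (rule nrm_F_le) (rule f)
    ultimately show "norm (nrm (F_alg \<eta>) (f i \<ominus>\<^bsub>F_alg \<eta>\<^esub> A)) \<le> inverse (real (Suc i))"
      by (simp only: minus_F[OF A] real_norm_def abs_of_nonneg)
  qed
  then show ?thesis
    using S_subalgebra A f(1) unfolding cstar_subalgebra_def norm_closed_in_def by blast
qed

lemma sections_basis:
  "clin X \<Longrightarrow> sections \<eta> X n (basis j) = (if j < N ^ n then proj (N ^ n) (X (basis j)) else 0)"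
  by (simp add: sections_def)

lemma sections_T_basis:
  "v < N ^ a \<Longrightarrow> sections \<eta> (T a v) n (basis j) =
    (if j < N ^ n \<and> j * N ^ a + v < N ^ n then basis (j * N ^ a + v) else 0)"
  by (simp add: sections_basis T_basis)

lemma adj_sections: "clin X \<Longrightarrow> adj (sections \<eta> X n) = sections \<eta> (adj X) n"
  by (simp add: sections_def adj_compose compose_assoc)

lemma adj_sections_T_basis:
  "v < N ^ a \<Longrightarrow> adj (sections \<eta> (T a v) n) (basis j) =
    (if j < N ^ n \<and> j mod N ^ a = v then basis (j div N ^ a) else 0)"
  by (auto simp: adj_sections sections_basis adj_T_basis intro: le_less_trans[OF div_le_dividend])

text \<open>The outer projections require \<open>q < N ^ (n - b)\<close> for the old word and
  \<open>q < N ^ (n - a)\<close> for the new one, where \<open>q\<close> is what remains after the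
  deletion. Together they are a single truncation inside the monomial, at depth
  \<open>max a b\<close>.\<close>

lemma sections_shift0:
  assumes "v < N ^ a" "w < N ^ b" "n \<ge> max a b"
  shows "sections \<eta> (shift0 a v b w) n = shift (max a b) a v b w n"
proof (rule clin_eqI)
  fix j
  let ?q = "j div N ^ b"
  have "j < N ^ n \<and> ?q * N ^ a + v < N ^ n \<longleftrightarrow> ?q < N ^ (n - b) \<and> ?q < N ^ (n - a)"
    using assms by (auto simp: div_less_pow less_pow_split)
  also have "\<dots> \<longleftrightarrow> ?q < N ^ (n - max a b)"
    by (cases "a \<le> b") (auto simp: max_def elim!: less_le_trans)
  finally show "sections \<eta> (shift0 a v b w) n (basis j) = shift (max a b) a v b w n (basis j)"
    using assms by (auto simp: sections_basis shift_basis)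
qed (auto simp: sections_def)

abbreviation poly :: "op_seq set" where "poly \<equiv> germ_span shifts"

lemma cuntz_approx: "cuntz N \<subseteq> {X. clin X \<and> approx (germ_span shifts0) (\<lambda>_. X)}"
  unfolding cuntz_def
proof (rule cstar_generated_least[OF star_algebra_germs.cstar_subalgebra_L[OF star_algebra_germs_shifts0]])
  have "cuntz_iso N i = shift0 1 i 0 0" for i
    by (simp add: shift0_def adj_T_0 compose_simps) (simp add: T_def)
  then have "(\<lambda>_. cuntz_iso N i) \<in> shifts0" if "i < N" for i
    using that by (force simp: shifts0_def)
  then show "cuntz_iso N ` {..<N} \<subseteq> {X. clin X \<and> approx (germ_span shifts0) (\<lambda>_. X)}"
    by (auto intro: approx_self germ_span.gen)
qed

lemma sections_add: "sections \<eta> (A + B) n = sections \<eta> A n + sections \<eta> B n"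
  by (simp add: sections_def compose_simps)

lemma sections_diff: "sections \<eta> (A - B) n = sections \<eta> A n - sections \<eta> B n"
  by (simp add: sections_def compose_simps)

lemma sections_scale: "sections \<eta> (scaleC_op c o\<^sub>L A) n = scaleC_op c o\<^sub>L sections \<eta> A n"
  by (metis clin_intros(3) compose_assoc scaleC_op_commute sections_def)

lemma norm_sections_le: "norm (sections \<eta> A n) \<le> norm A"
  unfolding sections_def
  using norm_compose_le[OF norm_compose_le[OF norm_proj_le order_refl] norm_proj_le] by simp

text \<open>Compression does not increase norms, so an approximation of \<open>X\<close> by Cuntz
  monomials turns into one of its sections, uniformly in the level.\<close>

lemma approx_sections:
  assumes X: "X \<in> cuntz N"
  shows "approx poly (sections \<eta> X)"
proof (rule approx_closed)
  fix \<epsilon> :: real assume e: "\<epsilon> > 0"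
  have "approx (germ_span shifts0) (\<lambda>_. X)" using X cuntz_approx by blast
  then obtain \<phi> where \<phi>: "\<phi> \<in> germ_span shifts0" "\<forall>\<^sub>F n in sequentially. norm (X - \<phi> n) \<le> \<epsilon>"
    using approxE[OF _ e] by blast
  have "in_germ shifts (\<lambda>n. sections \<eta> (\<phi> n) n)"
    using \<phi>(1)
  proof induction
    case (gen \<phi>)
    then obtain a v b w where w: "\<phi> = (\<lambda>_. shift0 a v b w)" "v < N ^ a" "w < N ^ b"
      by (auto simp: shifts0_def)
    have "shift (max a b) a v b w \<in> shifts" using w by (fastforce simp: shifts_def)
    moreover have "\<forall>\<^sub>F n in sequentially. sections \<eta> (\<phi> n) n = shift (max a b) a v b w n"
      using eventually_ge_at_top[of "max a b"] by eventually_elim (simp add: sections_shift0 w)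
    ultimately show ?case by (intro in_germ_cong[OF _ in_germ_span[OF germ_span.gen]])
  next
    case zero
    have "sections \<eta> 0 n = 0" for n by (simp add: sections_def compose_simps)
    then show ?case by (simp add: in_germ_span germ_span.zero)
  qed (simp_all add: sections_add sections_scale in_germ_add in_germ_scale)
  then obtain \<theta> where \<theta>: "\<theta> \<in> poly" "\<forall>\<^sub>F n in sequentially. sections \<eta> (\<phi> n) n = \<theta> n"
    by (auto simp: in_germ_def)
  have "\<forall>\<^sub>F n in sequentially. norm (sections \<eta> X n - \<theta> n) \<le> \<epsilon>"
    using \<phi>(2) \<theta>(2)
  proof eventually_elim
    case (elim n)
    then show ?case using norm_sections_le[of "X - \<phi> n" n] by (simp add: sections_diff)
  qed
  then show "\<exists>B. approx poly B \<and> (\<forall>\<^sub>F n in sequentially. norm (sections \<eta> X n - B n) \<le> \<epsilon>)"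
    using approx_self[OF \<theta>(1)] by blast
qed

lemma S_approx: "A \<in> S \<Longrightarrow> approx poly A"
proof -
  have "S \<subseteq> {A \<in> carrier (F_alg \<eta>). approx poly A}"
    unfolding carrier_S
    by (rule cstar_generated_least[OF star_algebra_germs.cstar_subalgebra_F[OF star_algebra_germs_shifts]])
       (auto intro: approx_sections sections_F cuntz_clin)
  then show "A \<in> S \<Longrightarrow> approx poly A" by blast
qed

text \<open>Appending \<open>c\<close> zeros keeps a word within \<open>n\<close> digits exactly
  when it starts with \<open>c\<close> zeros; this is the origin of the inner truncations, and
  \<open>c = 1\<close> gives \<open>p_1\<close>. For \<open>n < c\<close> only the word 0 survives,
  in agreement with \<open>n - c = 0\<close> on the naturals.\<close>

lemma proj_eq_sections: "adj (sections \<eta> (T c 0) n) o\<^sub>L sections \<eta> (T c 0) n = proj (N ^ (n - c))"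
proof (rule clin_eqI)
  fix j
  have "j < N ^ n \<and> j * N ^ c < N ^ n \<longleftrightarrow> j < N ^ (n - c)"
  proof (cases "c \<le> n")
    case True
    then have "j * N ^ c < N ^ n \<longleftrightarrow> j < N ^ (n - c)" using less_pow_split[of c n 0 j] by simp
    moreover have "j < N ^ (n - c) \<Longrightarrow> j < N ^ n" by (erule less_le_trans) simp
    ultimately show ?thesis by blast
  next
    case False
    then have "j * N ^ c < N ^ n \<Longrightarrow> j = 0"
      by (metis (no_types, lifting) le_less_trans less_or_eq_imp_le linorder_not_le mult_le_mono1 nat_mult_1
          not_less_eq_eq One_nat_def pow_less_iff less_nat_zero_code neq0_conv Suc_leI)
    then show ?thesis using False by auto
  qed
  then show "(adj (sections \<eta> (T c 0) n) o\<^sub>L sections \<eta> (T c 0) n) (basis j) = proj (N ^ (n - c)) (basis j)"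
    by (auto simp: sections_T_basis adj_sections_T_basis)
qed (auto simp: sections_def)

lemma proj_S: "(\<lambda>n. proj (N ^ (n - c))) \<in> S"
  unfolding proj_eq_sections[symmetric]
  by (intro S_closed sections_S T_cuntz) simp_all

lemma one_S: "(\<lambda>n. proj (N ^ n)) \<in> S"
  using proj_S[of 0] by simp

section \<open>Null sequences belong to the section algebra\<close>

abbreviation G :: "op_seq set" where "G \<equiv> G_ideal \<eta>"

lemma G_iff: "A \<in> G \<longleftrightarrow> A \<in> carrier (F_alg \<eta>) \<and> (\<lambda>n. norm (A n)) \<longlonglongrightarrow> 0"
  by (simp add: G_ideal_def)

text \<open>\<open>T (r + 1) (N ^ r - 1)\<close> and \<open>T (r + 1) (N ^ r)\<close> have the same initial space, but at level \<open>r\<close> only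
  the first of them keeps \<open>basis 0\<close> inside the range of \<open>proj (N ^ r)\<close>.\<close>

lemma rank_one_S: "(\<lambda>n. if n = r then proj 1 else 0) \<in> S"
proof -
  let ?U = "\<lambda>v n. adj (sections \<eta> (T (Suc r) v) n) o\<^sub>L sections \<eta> (T (Suc r) v) n"
  have v: "N ^ r - 1 < N ^ Suc r" "N ^ r < N ^ Suc r"
    by (rule le_less_trans[OF diff_le_self], rule power_strict_increasing) (use N2 in auto)
  have "(if n = r then proj 1 else 0) = ?U (N ^ r - 1) n - ?U (N ^ r) n" for n
  proof (rule clin_eqI)
    fix j
    consider "n > r" | "n = r" | "n < r" by linarith
    then have "j < N ^ n \<and> j * N ^ Suc r + (N ^ r - 1) < N ^ n \<longleftrightarrow>
        (j < N ^ n \<and> j * N ^ Suc r + N ^ r < N ^ n) \<or> n = r \<and> j = 0"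
    proof cases
      case 1
      then show ?thesis using v by (simp only: less_pow_split Suc_leI) auto
    next
      case 2
      have le: "N ^ r \<le> j * N ^ Suc r" if "j \<noteq> 0"
        using mult_le_mono[of 1 j "N ^ r" "N ^ Suc r"] that N2 by simp
      then have "\<not> j * N ^ Suc r + (N ^ r - 1) < N ^ r" if "j \<noteq> 0"
        using le[OF that] by linarith
      then show ?thesis using 2 by auto
    next
      case 3
      then have "N ^ n < N ^ r" by simp
      then have "\<not> j * N ^ Suc r + (N ^ r - 1) < N ^ n" "\<not> j * N ^ Suc r + N ^ r < N ^ n" by linarith+
      then show ?thesis using 3 by blast
    qed
    moreover have "\<not> j * N ^ Suc r + N ^ r < N ^ r" by simp
    moreover have "N ^ r - 1 < N ^ n" if "r \<le> n"
    proof -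
      have "N ^ r \<le> N ^ n" "0 < N ^ r" using that by simp_all
      then show ?thesis by linarith
    qed
    ultimately show "(if n = r then proj 1 else 0) (basis j) = (?U (N ^ r - 1) n - ?U (N ^ r) n) (basis j)"
      using v by (auto simp: sections_T_basis adj_sections_T_basis blinfun.diff_left simp del: power_Suc)
  qed (auto simp: sections_def)
  then show ?thesis using v by (auto intro!: S_diff S_closed sections_S T_cuntz simp del: power_Suc)
qed

text \<open>At level \<open>r\<close>, \<open>?E v w\<close> is the matrix unit that maps
  \<open>basis w\<close> to \<open>basis v\<close>, built from the rank one projection onto
  \<open>basis 0\<close>. A matrix at one level is a finite combination of these.\<close>

lemma level_S:
  assumes A: "A \<in> carrier (F_alg \<eta>)"
  shows "(\<lambda>n. if n = r then A r else 0) \<in> S"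
proof -
  note A = F_memD[OF A, of r]
  let ?E = "\<lambda>v w n. sections \<eta> (T r v) n o\<^sub>L (if n = r then proj 1 else 0) o\<^sub>L adj (sections \<eta> (T r w) n)"
  have "(if n = r then A r else 0) =
      (\<Sum>v<N ^ r. \<Sum>w<N ^ r. scaleC_op (coord (A r (basis w)) v) o\<^sub>L ?E v w n)" for n
  proof (cases "n = r")
    case True
    have "A r = (\<Sum>v<N ^ r. \<Sum>w<N ^ r. scaleC_op (coord (A r (basis w)) v) o\<^sub>L ?E v w r)" (is "_ = ?R")
    proof (rule clin_eqI)
      fix j
      have E: "?E v w r (basis j) = (if j = w then basis v else 0)" if "v < N ^ r" "w < N ^ r" for v w
        using that by (auto simp: sections_T_basis adj_sections_T_basis)
      have "?R (basis j) = (\<Sum>v<N ^ r. \<Sum>w<N ^ r. coord (A r (basis w)) v *\<^sub>C (if j = w then basis v else 0))"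
        unfolding blinfun.sum_left by (intro sum.cong refl) (use E in auto)
      also have "\<dots> = (\<Sum>v<N ^ r. if j < N ^ r then coord (A r (basis j)) v *\<^sub>C basis v else 0)"
        by (intro sum.cong refl) (simp add: if_distrib[of "\<lambda>x. _ *\<^sub>C x"] cong: if_cong)
      also have "\<dots> = (if j < N ^ r then trunc (N ^ r) (A r (basis j)) else 0)"
        by (simp add: trunc_eq_sum)
      also have "trunc (N ^ r) (A r (basis j)) = proj (N ^ r) (A r (basis j))"
        by (simp add: proj.rep_eq)
      also have "(if j < N ^ r then \<dots> else 0) = (proj (N ^ r) o\<^sub>L A r o\<^sub>L proj (N ^ r)) (basis j)"
        by simp
      also have "\<dots> = A r (basis j)" by (simp only: A)
      finally show "A r (basis j) = ?R (basis j)" by simp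
    qed (auto intro!: clin_sum simp: A sections_def)
    then show ?thesis using True by simp
  next
    case False
    then show ?thesis by (simp add: compose_simps)
  qed
  then show ?thesis
    by (auto intro!: S_sum S_closed sections_S T_cuntz rank_one_S)
qed

text \<open>A null sequence is the uniform limit of its restrictions to finitely many
  levels.\<close>

lemma G_S: "G \<subseteq> S"
proof
  fix A assume "A \<in> G"
  then have A: "A \<in> carrier (F_alg \<eta>)" "(\<lambda>n. norm (A n)) \<longlonglongrightarrow> 0" by (auto simp: G_iff)
  show "A \<in> S"
  proof (rule S_limit[OF A(1)])
    fix \<epsilon> :: real assume "\<epsilon> > 0"
    then obtain m where m: "\<And>n. n \<ge> m \<Longrightarrow> norm (A n) < \<epsilon>"
      using order_tendstoD(2)[OF A(2)] by (auto simp: eventually_sequentially)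
    have "(\<lambda>n. \<Sum>r<m. if n = r then A r else 0) \<in> S"
      by (intro S_sum level_S A) auto
    moreover have "norm ((\<Sum>r<m. if n = r then A r else 0) - A n) \<le> \<epsilon>" for n
      using m[of n] \<open>\<epsilon> > 0\<close> by (cases "n < m") auto
    ultimately show "\<exists>B\<in>S. \<forall>n. norm (B n - A n) \<le> \<epsilon>"
      by (intro bexI[of _ "\<lambda>n. \<Sum>r<m. if n = r then A r else 0"] allI)
  qed
qed


subsection \<open>Inserting a block of digits\<close>

text \<open>\<open>ins m s j\<close> inserts the digits \<open>1 0 \<dots> 0\<close> (\<open>m\<close> of them) before the last \<open>s\<close> digits of \<open>j\<close>.
  This block does not overlap with a proper shift of itself, so \<open>s\<close> and \<open>j\<close> can be recovered.\<close>

definition ins :: "nat \<Rightarrow> nat \<Rightarrow> nat \<Rightarrow> nat" where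
  "ins m s j = (j div N ^ s) * N ^ (s + m) + (N ^ (s + m - 1) + j mod N ^ s)"

lemma ins_small: "m \<ge> 1 \<Longrightarrow> N ^ (s + m - 1) + j mod N ^ s < N ^ (s + m)"
proof -
  assume m: "m \<ge> 1"
  have "j mod N ^ s < N ^ s" by simp
  also have "\<dots> \<le> N ^ (s + m - 1)" using m by simp
  finally have "N ^ (s + m - 1) + j mod N ^ s < 2 * N ^ (s + m - 1)" by simp
  also have "\<dots> \<le> N * N ^ (s + m - 1)" using N2 by simp
  also have "\<dots> = N ^ (s + m)" using m by (simp flip: power_Suc)
  finally show ?thesis .
qed

lemma ins_ge: "N ^ (m - 1) \<le> ins m s j"
proof -
  have "N ^ (m - 1) \<le> N ^ (s + m - 1)" by simp
  then show ?thesis unfolding ins_def by linarith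
qed

lemma ins_less_iff: "m \<ge> 1 \<Longrightarrow> s \<le> h \<Longrightarrow> ins m s j < N ^ (h + m) \<longleftrightarrow> j < N ^ h"
  unfolding ins_def
  using less_pow_split[of "s + m" "h + m" "N ^ (s + m - 1) + j mod N ^ s" "j div N ^ s"]
    ins_small[of m s j] div_less_pow[of s h j] by simp

lemma ins_append:
  assumes "m \<ge> 1" "v < N ^ a"
  shows "ins m (s + a) (y * N ^ a + v) = ins m s y * N ^ a + v"
proof -
  have d: "(y * N ^ a + v) div N ^ a = y" "v mod N ^ a = v"
    using assms(2) by (simp_all add: mod_less[OF assms(2)])
  have "(y * N ^ a + v) div N ^ (s + a) = y div N ^ s"
    by (simp only: power_add mult.commute[of "N ^ s"] div_mult2_eq d)
  moreover have "(y * N ^ a + v) mod N ^ (s + a) = N ^ a * (y mod N ^ s) + v"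
    by (simp only: power_add mult.commute[of "N ^ s"] mod_mult2_eq d mod_mult_self3)
  moreover have "s + a + m - 1 = (s + m - 1) + a" using assms(1) by simp
  ultimately show ?thesis by (simp add: ins_def algebra_simps power_add)
qed

lemma ins_mod_div:
  assumes "m \<ge> 1" "b \<le> s"
  shows "ins m s j mod N ^ b = j mod N ^ b" "ins m s j div N ^ b = ins m (s - b) (j div N ^ b)"
proof -
  have "ins m s j = ins m (s - b) (j div N ^ b) * N ^ b + j mod N ^ b"
    using ins_append[OF assms(1), of "j mod N ^ b" b "s - b" "j div N ^ b"] assms(2)
    unfolding div_mult_mod_eq by simp
  then show "ins m s j mod N ^ b = j mod N ^ b" "ins m s j div N ^ b = ins m (s - b) (j div N ^ b)"
    by simp_all
qed

lemma ins_inject_same: "m \<ge> 1 \<Longrightarrow> ins m s j = ins m s j' \<Longrightarrow> j = j'"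
proof -
  assume m: "m \<ge> 1" and eq: "ins m s j = ins m s j'"
  have "ins m s i div N ^ (s + m) = i div N ^ s" for i
    unfolding ins_def using ins_small[OF m, of s i] by simp
  moreover have "ins m s i mod N ^ s = i mod N ^ s" for i
    by (rule ins_mod_div[OF m order_refl])
  ultimately show "j = j'" by (metis eq div_mult_mod_eq)
qed

lemma div_mult_add: "r < M \<Longrightarrow> (q * M + r) div M = (q :: nat)"
  by simp

text \<open>Compare the digits at position \<open>s + m - 1\<close>. On the left it is the leading 1
  of the block. On the right the position falls among the zeros of the block: \<open>s < s'\<close>
  puts the leading 1 higher, and \<open>s' < s + m\<close> keeps the position from falling below the
  block.\<close>

lemma ins_inject_aux: "m \<ge> 1 \<Longrightarrow> s < s' \<Longrightarrow> s' < s + m \<Longrightarrow> ins m s j \<noteq> ins m s' j'"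
proof
  assume m: "m \<ge> 1" and s: "s < s'" "s' < s + m" and eq: "ins m s j = ins m s' j'"
  obtain p where p: "s + m = Suc p" "s + m - 1 = p" using m by (cases "s + m") auto
  have "j mod N ^ s < N ^ s" by simp
  also have "N ^ s \<le> N ^ p" using m p by simp
  finally have r: "j mod N ^ s < N ^ p" .
  have "ins m s j = (j div N ^ s * N + 1) * N ^ p + j mod N ^ s"
    unfolding ins_def p by (simp add: algebra_simps)
  then have "ins m s j div N ^ p = j div N ^ s * N + 1" by (simp only: div_mult_add[OF r])
  moreover have "1 mod N = 1" using N2 by simp
  ultimately have 1: "ins m s j div N ^ p mod N = 1" by (simp only: mod_mult_self3)
  have "j' mod N ^ s' < N ^ s'" by simp
  also have "N ^ s' \<le> N ^ p" using s p by simp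
  finally have r': "j' mod N ^ s' < N ^ p" .
  obtain e where "s' + m = Suc p + Suc e" using less_imp_Suc_add[of "Suc p" "s' + m"] s p by auto
  then have e: "s' + m = Suc (Suc e) + p" "s' + m - 1 = Suc e + p" by simp_all
  have "ins m s' j' = ((j' div N ^ s') * N ^ Suc e + N ^ e) * N * N ^ p + j' mod N ^ s'"
    unfolding ins_def e by (simp add: algebra_simps power_add)
  then have "ins m s' j' div N ^ p = ((j' div N ^ s') * N ^ Suc e + N ^ e) * N" by (simp only: div_mult_add[OF r'])
  then have "ins m s' j' div N ^ p mod N = 0" by simp
  then show False using 1 eq by simp
qed

lemma ins_inject:
  assumes "m \<ge> 1" "s < s' + m" "s' < s + m"
  shows "ins m s j = ins m s' j' \<longleftrightarrow> s = s' \<and> j = j'"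
  using ins_inject_same[OF assms(1)] ins_inject_aux[OF assms(1)] assms(2,3)
  by (metis linorder_neqE_nat)

lemma norm_sum_basis:
  assumes "finite I" "inj_on g I"
  shows "(norm (\<Sum>i\<in>I. c i *\<^sub>C basis (g i)))\<^sup>2 = (\<Sum>i\<in>I. (cmod (c i))\<^sup>2)"
proof -
  let ?x = "\<Sum>i\<in>I. c i *\<^sub>C basis (g i)"
  have co: "coord ?x (g i) = c i" if "i \<in> I" for i
  proof -
    have "coord ?x (g i) = (\<Sum>k\<in>I. if k = i then c k else 0)"
      by (simp, intro sum.cong refl) (use assms(2) that in \<open>auto dest: inj_onD\<close>)
    then show ?thesis using assms(1) that by simp
  qed
  have "(norm ?x)\<^sup>2 = (\<Sum>n\<in>g ` I. (cmod (coord ?x n))\<^sup>2)"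
    by (rule norm_finite_support) (use assms(1) in \<open>auto intro!: sum.neutral\<close>)
  also have "\<dots> = (\<Sum>i\<in>I. (cmod (c i))\<^sup>2)"
    by (simp only: sum.reindex[OF assms(2)] o_def, intro sum.cong refl) (simp only: co)
  finally show ?thesis .
qed

definition ins_vec :: "nat \<Rightarrow> nat \<Rightarrow> nat \<Rightarrow> ell2 \<Rightarrow> ell2" where
  "ins_vec n m s x = (\<Sum>j<N ^ n. coord x j *\<^sub>C basis (ins m s j))"

lemma ins_vec_basis: "j < N ^ n \<Longrightarrow> ins_vec n m s (basis j) = basis (ins m s j)"
  unfolding ins_vec_def by (simp add: if_distrib[of "\<lambda>c. c *\<^sub>C _"] cong: if_cong)

lemma ins_vec_add: "ins_vec n m s (x + y) = ins_vec n m s x + ins_vec n m s y"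
  unfolding ins_vec_def by (auto intro!: ell2_eqI simp: algebra_simps sum.distrib)

lemma ins_vec_scaleC: "ins_vec n m s (c *\<^sub>C x) = c *\<^sub>C ins_vec n m s x"
  unfolding ins_vec_def by (auto intro!: ell2_eqI simp: algebra_simps sum_distrib_left)

lemma ins_vec_zero: "ins_vec n m s 0 = 0"
  unfolding ins_vec_def by simp

lemma ins_vec_sum: "ins_vec n m s (sum f I) = (\<Sum>i\<in>I. ins_vec n m s (f i))"
  by (induction I rule: infinite_finite_induct) (auto simp: ins_vec_add ins_vec_zero)

lemma norm_ins_vec_le: "m \<ge> 1 \<Longrightarrow> norm (ins_vec n m s x) \<le> norm x"
proof -
  assume "m \<ge> 1"
  then have "(norm (ins_vec n m s x))\<^sup>2 = (\<Sum>j<N ^ n. (cmod (coord x j))\<^sup>2)"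
    unfolding ins_vec_def by (intro norm_sum_basis inj_onI) (auto intro: ins_inject_same[of m s])
  also have "\<dots> \<le> (norm x)\<^sup>2" by (rule norm_trunc_le)
  finally show ?thesis by (simp add: power2_le_iff_abs_le)
qed

text \<open>Despite the name, the sum is not divided by \<open>L\<close>. Its terms will be
  orthogonal and of equal norm, so its natural size is \<open>sqrt L\<close>, as
  \<open>norm_ins_avg\<close> makes exact.\<close>

definition ins_avg :: "nat \<Rightarrow> nat \<Rightarrow> nat \<Rightarrow> nat \<Rightarrow> ell2 \<Rightarrow> ell2" where
  "ins_avg n m s L x = (\<Sum>t\<in>{s..<s + L}. ins_vec n m t x)"

lemma ins_avg_lin: "ins_avg n m s L (x + y) = ins_avg n m s L x + ins_avg n m s L y"
  "ins_avg n m s L (c *\<^sub>C x) = c *\<^sub>C ins_avg n m s L x" "ins_avg n m s L 0 = 0"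
  by (simp_all add: ins_avg_def ins_vec_add ins_vec_scaleC ins_vec_zero sum.distrib scaleC_sum)

lemma norm_proj_fixed: "proj M x = x \<Longrightarrow> (norm x)\<^sup>2 = (\<Sum>j<M. (cmod (coord x j))\<^sup>2)"
  by (rule norm_finite_support) (auto, metis proj_apply)

text \<open>\<open>m \<ge> L\<close> forces any two positions in the window to differ by less than
  \<open>m\<close>, so by \<open>ins_inject\<close> all basis vectors in the double sum are
  distinct.\<close>

lemma norm_ins_avg:
  assumes "m \<ge> L" "m \<ge> 1" "proj (N ^ n) x = x"
  shows "norm (ins_avg n m s L x) = sqrt (real L) * norm x"
proof -
  let ?I = "{s..<s + L} \<times> {..<N ^ n}"
  have "ins_avg n m s L x = (\<Sum>(t, j)\<in>?I. coord x j *\<^sub>C basis (ins m t j))"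
    by (simp add: ins_avg_def ins_vec_def sum.cartesian_product)
  also have "\<dots> = (\<Sum>p\<in>?I. coord x (snd p) *\<^sub>C basis (ins m (fst p) (snd p)))"
    by (simp add: case_prod_beta)
  finally have "(norm (ins_avg n m s L x))\<^sup>2 = (\<Sum>p\<in>?I. (cmod (coord x (snd p)))\<^sup>2)"
    by (simp only:) (rule norm_sum_basis, use assms in \<open>auto intro!: inj_onI simp: ins_inject\<close>)
  also have "\<dots> = (\<Sum>(t, j)\<in>?I. (cmod (coord x j))\<^sup>2)" by (simp add: case_prod_beta)
  also have "\<dots> = real L * (\<Sum>j<N ^ n. (cmod (coord x j))\<^sup>2)"
    by (simp add: sum.cartesian_product[symmetric])
  also have "\<dots> = (sqrt (real L) * norm x)\<^sup>2"
    by (simp add: norm_proj_fixed[OF assms(3)] power_mult_distrib)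
  finally show ?thesis by (rule power2_eq_imp_eq) auto
qed

lemma norm_shift_le: "norm (shift k a v b w n) \<le> 1"
proof -
  have "norm (adj (T b w)) \<le> 1" by (rule order_trans[OF norm_adj_le norm_T_le]) simp
  then show ?thesis
    unfolding shift_def using norm_compose_le[OF norm_compose_le[OF norm_T_le norm_proj_le]] by fastforce
qed

text \<open>\<open>k \<le> s\<close> places the block to the left of all digits that the monomial
  deletes, and \<open>s + k \<le> n\<close> places it to the right of the leading digits that the
  truncation tests. So the monomial acts as on the shorter word, and only the position of the block
  changes, by \<open>a - b\<close>.\<close>

lemma shift_ins_vec:
  assumes "a \<le> k" "b \<le> k" "v < N ^ a" "w < N ^ b" "k \<le> s" "s + k \<le> n" "m \<ge> 1" "proj (N ^ n) x = x"
  shows "shift k a v b w (n + m) (ins_vec n m s x) = ins_vec n m (s - b + a) (shift k a v b w n x)"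
proof -
  have eq: "shift k a v b w (n + m) (basis (ins m s j)) = ins_vec n m (s - b + a) (shift k a v b w n (basis j))"
    for j
  proof -
    have lt: "ins m (s - b) (j div N ^ b) < N ^ (n + m - k) \<longleftrightarrow> j div N ^ b < N ^ (n - k)"
      using ins_less_iff[OF assms(7), of "s - b" "n - k" "j div N ^ b"] assms(5,6) by simp
    have "j div N ^ b < N ^ (n - k) \<Longrightarrow> (j div N ^ b) * N ^ a + v < N ^ n"
      using append_less[of _ n k a v] assms by simp
    moreover have "ins m (s - b) q * N ^ a + v = ins m (s + a - b) (q * N ^ a + v)" for q
      using ins_append[of m v a "s - b" q] assms by simp
    ultimately show ?thesis
      using assms by (auto simp: shift_basis ins_mod_div lt ins_vec_basis ins_vec_zero)
  qed
  have x: "x = (\<Sum>j<N ^ n. coord x j *\<^sub>C basis j)"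
    using assms(8) by (simp add: proj.rep_eq trunc_eq_sum)
  have "shift k a v b w (n + m) (ins_vec n m s x) =
      (\<Sum>j<N ^ n. coord x j *\<^sub>C ins_vec n m (s - b + a) (shift k a v b w n (basis j)))"
    unfolding ins_vec_def[of n m s] by (simp add: blinfun.sum_right clin_scaleC eq)
  also have "\<dots> = ins_vec n m (s - b + a) (shift k a v b w n (\<Sum>j<N ^ n. coord x j *\<^sub>C basis j))"
    by (simp add: blinfun.sum_right clin_scaleC ins_vec_sum ins_vec_scaleC)
  finally show ?thesis using x by simp
qed

text \<open>Two windows of equal length at distance \<open>d\<close> differ by at most
  \<open>d\<close> terms at either end, so the bound is independent of \<open>L\<close>.\<close>

lemma norm_window_diff:
  fixes f :: "nat \<Rightarrow> 'b :: real_normed_vector"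
  assumes "\<And>s. norm (f s) \<le> C"
  shows "norm (sum f {p..<p + L} - sum f {q..<q + L}) \<le> 2 * (real (max p q) - real (min p q)) * C"
proof -
  have *: "norm (sum f {q + d..<q + d + L} - sum f {q..<q + L}) \<le> 2 * real d * C" for q d
  proof -
    have "sum f {q..<q + d} + sum f {q + d..<q + d + L} = sum f {q..<q + L} + sum f {q + L..<q + d + L}"
      by (simp add: sum.atLeastLessThan_concat)
    then have "sum f {q + d..<q + d + L} - sum f {q..<q + L} = sum f {q + L..<q + d + L} - sum f {q..<q + d}"
      by (simp add: algebra_simps)
    also have "norm \<dots> \<le> real d * C + real d * C"
      using sum_norm_bound[of "{q + L..<q + d + L}" f C] sum_norm_bound[of "{q..<q + d}" f C] assms
      by (intro order_trans[OF norm_triangle_ineq4] add_mono) auto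
    finally show ?thesis by (simp add: ac_simps)
  qed
  show ?thesis
  proof (cases "q \<le> p")
    case True
    then show ?thesis using *[of q "p - q"] by (simp add: of_nat_diff max_def min_def)
  next
    case False
    then show ?thesis using *[of p "q - p"] by (simp add: of_nat_diff max_def min_def norm_minus_commute)
  qed
qed

section \<open>Approximate commutation with insertion, and large columns\<close>

definition almost_commutes :: "op_seq \<Rightarrow> nat \<Rightarrow> real \<Rightarrow> bool" where
  "almost_commutes \<phi> k M \<longleftrightarrow> 0 \<le> M \<and> (\<forall>n\<ge>k. \<forall>x. proj (N ^ n) (\<phi> n x) = \<phi> n x) \<and>
    (\<forall>n m s L x. k \<le> s \<and> s + L + k \<le> n \<and> 1 \<le> m \<and> proj (N ^ n) x = x \<longrightarrow>
      norm (\<phi> (n + m) (ins_avg n m s L x) - ins_avg n m s L (\<phi> n x)) \<le> M * norm x)"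

lemma almost_commutesD:
  assumes "almost_commutes \<phi> k M"
  shows "0 \<le> M" "n \<ge> k \<Longrightarrow> proj (N ^ n) (\<phi> n x) = \<phi> n x"
    "k \<le> s \<Longrightarrow> s + L + k \<le> n \<Longrightarrow> 1 \<le> m \<Longrightarrow> proj (N ^ n) x = x \<Longrightarrow>
      norm (\<phi> (n + m) (ins_avg n m s L x) - ins_avg n m s L (\<phi> n x)) \<le> M * norm x"
  using assms unfolding almost_commutes_def by simp_all

text \<open>A monomial turns the insertion at position \<open>t\<close> into the insertion at a translate of \<open>t\<close>. Hence it
  commutes with the sum over \<open>L\<close> consecutive positions up to boundary terms, whose number does not grow with \<open>L\<close>,
  while the norm of the sum grows like \<open>sqrt L\<close>.\<close>

lemma poly_almost_commutes:
  assumes "\<phi> \<in> poly"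
  shows "\<exists>k M. almost_commutes \<phi> k M"
  using assms
proof induction
  case (gen \<phi>)
  then obtain k a v b w where \<phi>: "\<phi> = shift k a v b w" and w: "a \<le> k" "b \<le> k" "v < N ^ a" "w < N ^ b"
    by (auto simp: shifts_def)
  show ?case
    unfolding almost_commutes_def
  proof (intro exI[of _ k] exI[of _ "2 * real k"] conjI allI impI)
    fix n x assume n: "n \<ge> k"
    have "proj (N ^ n) o\<^sub>L shift k a v b w n = shift k a v b w n"
      by (rule clin_eqI) (use w n append_less[of _ n k a v] in \<open>auto simp: shift_basis\<close>)
    then show "proj (N ^ n) (\<phi> n x) = \<phi> n x" by (metis \<phi> blinfun_apply_blinfun_compose)
  next
    fix n m s L :: nat and x assume *: "k \<le> s \<and> s + L + k \<le> n \<and> 1 \<le> m \<and> proj (N ^ n) x = x"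
    let ?y = "\<phi> n x"
    have "norm ?y \<le> norm x" unfolding \<phi> by (rule norm_contraction[OF norm_shift_le])
    then have b: "norm (ins_vec n m t ?y) \<le> norm x" for t
      using norm_ins_vec_le[of m n t ?y] * by linarith
    have "\<phi> (n + m) (ins_avg n m s L x) = (\<Sum>t\<in>{s..<s + L}. ins_vec n m (t - b + a) ?y)"
      unfolding ins_avg_def \<phi> blinfun.sum_right
      by (intro sum.cong refl shift_ins_vec) (use * w in auto)
    also have "\<dots> = (\<Sum>t\<in>{s - b + a..<s - b + a + L}. ins_vec n m t ?y)"
      by (rule sum.reindex_bij_witness[of _ "\<lambda>t. t + b - a" "\<lambda>t. t - b + a"]) (use * w in auto)
    finally have "norm (\<phi> (n + m) (ins_avg n m s L x) - ins_avg n m s L ?y) \<le>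
        2 * (real (max (s - b + a) s) - real (min (s - b + a) s)) * norm x"
      unfolding ins_avg_def[of _ _ _ _ ?y] using norm_window_diff[of "\<lambda>t. ins_vec n m t ?y", OF b] by simp
    also have "\<dots> \<le> 2 * real k * norm x"
      using * w by (intro mult_right_mono mult_left_mono) (auto simp: max_def min_def of_nat_diff)
    finally show "norm (\<phi> (n + m) (ins_avg n m s L x) - ins_avg n m s L ?y) \<le> 2 * real k * norm x" .
  qed auto
next
  case zero
  show ?case by (rule exI[of _ 0], rule exI[of _ 0]) (simp add: almost_commutes_def ins_avg_lin blinfun.zero_left blinfun.zero_right)
next
  case (add \<phi> \<psi>)
  then obtain k M k' M' where "almost_commutes \<phi> k M" "almost_commutes \<psi> k' M'" by blast
  note 1 = almost_commutesD[OF this(1)] and 2 = almost_commutesD[OF this(2)]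
  show ?case
    unfolding almost_commutes_def
  proof (intro exI[of _ "max k k'"] exI[of _ "M + M'"] conjI allI impI)
    fix n m s L :: nat and x assume *: "max k k' \<le> s \<and> s + L + max k k' \<le> n \<and> 1 \<le> m \<and> proj (N ^ n) x = x"
    have "(\<phi> (n + m) + \<psi> (n + m)) (ins_avg n m s L x) - ins_avg n m s L ((\<phi> n + \<psi> n) x) =
        (\<phi> (n + m) (ins_avg n m s L x) - ins_avg n m s L (\<phi> n x)) +
        (\<psi> (n + m) (ins_avg n m s L x) - ins_avg n m s L (\<psi> n x))"
      by (simp add: blinfun.add_left ins_avg_lin)
    also have "norm \<dots> \<le> M * norm x + M' * norm x"
      using * by (intro norm_triangle_mono 1(3) 2(3)) auto
    finally show "norm ((\<phi> (n + m) + \<psi> (n + m)) (ins_avg n m s L x) - ins_avg n m s L ((\<phi> n + \<psi> n) x))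
        \<le> (M + M') * norm x" by (simp add: algebra_simps)
  qed (use 1 2 in \<open>auto simp: blinfun.bilinear_simps\<close>)
next
  case (scale \<phi> c)
  then obtain k M where "almost_commutes \<phi> k M" by blast
  note 1 = almost_commutesD[OF this]
  show ?case
    unfolding almost_commutes_def
  proof (intro exI[of _ k] exI[of _ "cmod c * M"] conjI allI impI)
    fix n m s L :: nat and x assume *: "k \<le> s \<and> s + L + k \<le> n \<and> 1 \<le> m \<and> proj (N ^ n) x = x"
    have "(scaleC_op c o\<^sub>L \<phi> (n + m)) (ins_avg n m s L x) - ins_avg n m s L ((scaleC_op c o\<^sub>L \<phi> n) x) =
        c *\<^sub>C (\<phi> (n + m) (ins_avg n m s L x) - ins_avg n m s L (\<phi> n x))"
      by (simp add: ins_avg_lin scaleC_diff)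
    then show "norm ((scaleC_op c o\<^sub>L \<phi> (n + m)) (ins_avg n m s L x) - ins_avg n m s L ((scaleC_op c o\<^sub>L \<phi> n) x))
        \<le> cmod c * M * norm x"
      using 1(3)[of s L n m x] * by (simp add: mult.assoc mult_left_mono)
  qed (use 1 in \<open>auto simp: clin_scaleC\<close>)
qed

text \<open>It is essential that \<open>\<delta>\<close> does not depend on \<open>m\<close>: below, the polynomial that approximates \<open>A\<^sup>* A\<close> has to
  be chosen after \<open>\<delta>\<close>, and only columns that are far away compared to its degree are useful.\<close>

definition large_columns ::
    "op_seq \<Rightarrow> op_seq \<Rightarrow> real \<Rightarrow> nat \<Rightarrow> real \<Rightarrow> bool" where
  "large_columns A \<phi> \<kappa> h \<delta> \<longleftrightarrow> (\<forall>\<^sub>F m in sequentially. \<forall>n\<ge>h. \<forall>x.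
    x \<noteq> 0 \<and> proj (N ^ h) x = x \<and> \<kappa> * norm x \<le> norm (\<phi> n x) \<longrightarrow>
    (\<exists>j. N ^ (m - 1) \<le> j \<and> j < N ^ (h + m) \<and> \<delta> \<le> norm (A (n + m) (basis j))))"

text \<open>Apply \<open>A\<close> to \<open>u = ins_avg n m k L x\<close>, whose norm is
  \<open>sqrt L * norm x\<close>. In units of \<open>sqrt L * norm x\<close>, the lower bound
  \<open>\<kappa>\<close> for \<open>\<phi>\<close> loses at most \<open>\<kappa>/2\<close> by
  almost commutation and \<open>\<kappa>/4\<close> by the approximation of \<open>A\<close>, so
  \<open>\<kappa>/4\<close> is left. Since \<open>u\<close> involves only \<open>L * N ^ h\<close>
  columns of \<open>A\<close>, they cannot all be small.\<close>

lemma column_lower_bound: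
  assumes \<phi>: "\<phi> \<in> poly" and \<kappa>: "\<kappa> > 0" and ev: "\<forall>\<^sub>F n in sequentially. norm (A n - \<phi> n) \<le> \<kappa> / 4"
    and A: "\<And>n. clin (A n)"
  obtains h\<^sub>0 where "\<And>h. h \<ge> h\<^sub>0 \<Longrightarrow> \<exists>\<delta>>0. large_columns A \<phi> \<kappa> h \<delta>"
proof -
  obtain k M where "almost_commutes \<phi> k M" using poly_almost_commutes[OF \<phi>] by blast
  note M = almost_commutesD(1)[OF this] and pr = almost_commutesD(2)[OF this] and avg = almost_commutesD(3)[OF this]
  \<comment> \<open>\<open>L\<close> is large enough for the commutation error \<open>M\<close> to
    be at most \<open>\<kappa>/2 * sqrt L\<close>; this is possible because \<open>M\<close> does
    not depend on \<open>L\<close>.\<close>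
  obtain L :: nat where L: "(2 * M / \<kappa>)\<^sup>2 < real L" using reals_Archimedean2 by blast
  have "2 * M / \<kappa> < sqrt (real L)" using L by (simp add: real_less_rsqrt)
  then have sL: "M \<le> \<kappa> / 2 * sqrt (real L)" using \<kappa> by (simp add: field_simps)
  have L0: "0 < real L" using L by (rule le_less_trans[OF zero_le_power2])
  show ?thesis
  \<comment> \<open>The threshold leaves \<open>k\<close> digits on either side of the window
    \<open>{k..<k + L}\<close>.\<close>
  proof (rule that[of "2 * k + L"])
    fix h assume h: "2 * k + L \<le> h"
    \<comment> \<open>If all \<open>L * N ^ h\<close> columns in \<open>u\<close> were at most
      \<open>\<delta>\<close>, the image of \<open>u\<close> would have norm at most
      \<open>\<kappa>/8 * sqrt L * norm x\<close>, half of the lower bound.\<close>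
    define \<delta> where "\<delta> = \<kappa> * sqrt (real L) / (8 * real L * real (N ^ h))"
    have d: "\<delta> > 0" using \<kappa> L0 N2 by (simp add: \<delta>_def)
    obtain n\<^sub>0 where n0: "\<And>n. n \<ge> n\<^sub>0 \<Longrightarrow> norm (A n - \<phi> n) \<le> \<kappa> / 4"
      using ev by (auto simp: eventually_sequentially)
    have "\<exists>j. N ^ (m - 1) \<le> j \<and> j < N ^ (h + m) \<and> \<delta> \<le> norm (A (n + m) (basis j))"
      if m: "m \<ge> max n\<^sub>0 (max L 1)" and n: "n \<ge> h" and x: "x \<noteq> 0" "proj (N ^ h) x = x" "\<kappa> * norm x \<le> norm (\<phi> n x)"
      for m n x
    proof (rule ccontr)
      assume "\<not> ?thesis"
      then have small: "norm (A (n + m) (basis j)) \<le> \<delta>" if "N ^ (m - 1) \<le> j" "j < N ^ (h + m)" for j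
        using that by force
      have nx: "norm x > 0" using x by simp
      let ?u = "ins_avg n m k L x"
      have xc: "coord x j = 0" if "\<not> j < N ^ h" for j
        using x(2) that by (metis proj_apply)
      have px: "proj (N ^ n) x = x"
      proof (rule ell2_eqI)
        fix j
        have "\<not> j < N ^ n \<Longrightarrow> \<not> j < N ^ h" using n less_pow_mono by blast
        then show "coord (proj (N ^ n) x) j = coord x j" using xc[of j] by auto
      qed
      have uu: "norm ?u = sqrt (real L) * norm x" by (rule norm_ins_avg) (use m px in auto)
      have "norm (ins_avg n m k L (\<phi> n x)) = sqrt (real L) * norm (\<phi> n x)"
        by (rule norm_ins_avg) (use m n h pr in auto)
      also have "\<dots> \<ge> sqrt (real L) * (\<kappa> * norm x)" by (intro mult_left_mono x) simp
      finally have 1: "sqrt (real L) * (\<kappa> * norm x) \<le> norm (ins_avg n m k L (\<phi> n x))" .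
      have "norm (\<phi> (n + m) ?u - ins_avg n m k L (\<phi> n x)) \<le> M * norm x"
        by (rule avg) (use m n h px in auto)
      also have "\<dots> \<le> \<kappa> / 2 * sqrt (real L) * norm x" by (intro mult_right_mono sL) simp
      finally have 2: "norm (\<phi> (n + m) ?u - ins_avg n m k L (\<phi> n x)) \<le> \<kappa> / 2 * sqrt (real L) * norm x" .
      have "norm ((A (n + m) - \<phi> (n + m)) ?u) \<le> norm (A (n + m) - \<phi> (n + m)) * norm ?u"
        by (rule norm_blinfun)
      also have "\<dots> \<le> \<kappa> / 4 * norm ?u"
        using m n0[of "n + m"] by (intro mult_right_mono) auto
      finally have 3: "norm (A (n + m) ?u - \<phi> (n + m) ?u) \<le> \<kappa> / 4 * (sqrt (real L) * norm x)"
        unfolding uu by (simp add: blinfun.diff_left)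
      have "norm (ins_avg n m k L (\<phi> n x)) \<le> norm (A (n + m) ?u) +
          norm (A (n + m) ?u - \<phi> (n + m) ?u) + norm (\<phi> (n + m) ?u - ins_avg n m k L (\<phi> n x))"
        using norm_triangle_ineq4[of "A (n + m) ?u" "A (n + m) ?u - \<phi> (n + m) ?u"]
          norm_triangle_ineq4[of "\<phi> (n + m) ?u" "\<phi> (n + m) ?u - ins_avg n m k L (\<phi> n x)"] by simp
      with 1 2 3 have lower: "\<kappa> / 4 * sqrt (real L) * norm x \<le> norm (A (n + m) ?u)"
        by (simp add: algebra_simps)
      have if0: "coord x j = 0 \<or> norm (A (n + m) (basis (ins m t j))) \<le> \<delta>" if "t \<in> {k..<k + L}" for t j
      proof (cases "j < N ^ h")
        case True
        then show ?thesis using small[OF ins_ge] ins_less_iff[of m t h j] m that h by auto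
      qed (use xc in auto)
      have "norm (A (n + m) (ins_vec n m t x)) \<le> real (N ^ h) * (norm x * \<delta>)" if t: "t \<in> {k..<k + L}" for t
      proof -
        have "ins_vec n m t x = (\<Sum>j<N ^ h. coord x j *\<^sub>C basis (ins m t j))"
          unfolding ins_vec_def
          by (rule sum.mono_neutral_right) (use xc n less_pow_mono in auto)
        then have "A (n + m) (ins_vec n m t x) = (\<Sum>j<N ^ h. coord x j *\<^sub>C A (n + m) (basis (ins m t j)))"
          by (simp add: blinfun.sum_right clin_scaleC[OF A])
        moreover have "norm (coord x j *\<^sub>C A (n + m) (basis (ins m t j))) \<le> norm x * \<delta>" for j
          using if0[OF t, of j] d by (cases "coord x j = 0") (auto intro!: mult_mono coord_le_norm)
        ultimately show ?thesis
          using sum_norm_bound[of "{..<N ^ h}" "\<lambda>j. coord x j *\<^sub>C A (n + m) (basis (ins m t j))" "norm x * \<delta>"]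
          by simp
      qed
      then have "norm (A (n + m) ?u) \<le> real L * (real (N ^ h) * (norm x * \<delta>))"
        unfolding ins_avg_def blinfun.sum_right
        using sum_norm_bound[of "{k..<k + L}" "\<lambda>t. A (n + m) (ins_vec n m t x)"] by simp
      also have "\<dots> = \<kappa> / 8 * sqrt (real L) * norm x"
        using L0 N2 by (simp add: \<delta>_def field_simps)
      also have "\<dots> < \<kappa> / 4 * sqrt (real L) * norm x"
        using \<kappa> L0 nx by simp
      finally show False using lower by simp
    qed
    then show "\<exists>\<delta>>0. large_columns A \<phi> \<kappa> h \<delta>"
      using d unfolding large_columns_def eventually_sequentially by blast
  qed
qed


subsection \<open>Compressions of polynomials to scalars\<close>

lemma compress_scalar:
  assumes "u < N ^ c" "clin \<phi>" "clin P" "\<And>z. P (basis z) = (if z \<in> Z then basis z else 0)"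
    and "\<And>z z'. z \<in> Z \<Longrightarrow> z' \<in> Z \<Longrightarrow> coord (\<phi> (basis (z * N ^ c + u))) (z' * N ^ c + u) = (if z = z' then \<alpha> else 0)"
  shows "adj (T c u o\<^sub>L P) o\<^sub>L \<phi> o\<^sub>L (T c u o\<^sub>L P) = scaleC_op \<alpha> o\<^sub>L P"
proof (rule clin_eqI)
  fix z
  show "(adj (T c u o\<^sub>L P) o\<^sub>L \<phi> o\<^sub>L (T c u o\<^sub>L P)) (basis z) = (scaleC_op \<alpha> o\<^sub>L P) (basis z)"
    by (rule ell2_eqI) (use assms in \<open>auto simp: coord_adj T_basis blinfun.zero_right\<close>)
qed (use assms in auto)

text \<open>A monomial of degree 0 only replaces the last \<open>b\<close> digits \<open>w'\<close>
  by \<open>v\<close>. Since \<open>i\<close> and \<open>j\<close> end in the same digits, its entry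
  vanishes unless \<open>v = w'\<close>, and then it is diagonal. Excluding nonzero degrees is left
  to the hypothesis \<open>ab\<close>, which holds for different reasons in the two compressions
  below.\<close>

lemma shift_entry:
  assumes "b \<le> k" "v < N ^ a" "w' < N ^ b" "i mod N ^ k = w" "j mod N ^ k = w"
    and ab: "(j div N ^ b) * N ^ a + v = i \<Longrightarrow> a = b"
  shows "coord (shift k\<^sub>0 a v b w' n (basis j)) i =
    (if i = j \<and> a = b \<and> v = w' \<and> w mod N ^ b = w' \<and> j div N ^ b < N ^ (n - k\<^sub>0) then 1 else 0)"
proof -
  let ?i = "(j div N ^ b) * N ^ a + v"
  have mb: "i mod N ^ b = w mod N ^ b" "j mod N ^ b = w mod N ^ b"
    using assms by (metis mod_mod_cancel le_imp_power_dvd)+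
  have "?i = i \<longleftrightarrow> a = b \<and> v = w' \<and> i = j" if "w mod N ^ b = w'"
  proof
    assume eq: "?i = i"
    then have "v = i mod N ^ b" using ab assms(2) by auto
    then have "v = w'" using mb that by simp
    then show "a = b \<and> v = w' \<and> i = j" using ab[OF eq] eq mb that by (metis div_mult_mod_eq)
  next
    assume "a = b \<and> v = w' \<and> i = j"
    then show "?i = i" using mb that by (metis div_mult_mod_eq)
  qed
  then show ?thesis using assms(2,3) by (auto simp: shift_basis mb)
qed

text \<open>Between basis vectors with the same number of leading zeros, only the monomials of degree 0 have
  nonzero entries.\<close>

definition band_scalar :: "op_seq \<Rightarrow> nat \<Rightarrow> nat \<Rightarrow> nat \<Rightarrow> complex \<Rightarrow> bool" where
  "band_scalar \<phi> k w t \<alpha> \<longleftrightarrow> (\<forall>n\<ge>t + k + 1. \<forall>i j.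
    N ^ (n - t - 1) \<le> i \<and> i < N ^ (n - t) \<and> N ^ (n - t - 1) \<le> j \<and> j < N ^ (n - t) \<and>
    i mod N ^ k = w \<and> j mod N ^ k = w \<longrightarrow> coord (\<phi> n (basis j)) i = (if i = j then \<alpha> else 0))"

text \<open>Exchanging the last \<open>b\<close> digits for \<open>a\<close> others changes the
  length of a word by \<open>a - b\<close>, so equal lengths give \<open>a = b\<close>. The inner
  truncation passes exactly when \<open>t + b \<ge> k\<^sub>0\<close>; hence \<open>\<alpha>\<close>
  depends on \<open>w\<close> and \<open>t\<close>, but not on the level or the indices. Having the
  claim for all large \<open>k\<close> lets a sum use a common \<open>k\<close>.\<close>

lemma poly_band_scalar:
  assumes "\<phi> \<in> poly"
  shows "\<exists>k\<^sub>0. \<forall>k\<ge>k\<^sub>0. \<forall>w t. \<exists>\<alpha>. band_scalar \<phi> k w t \<alpha>"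
  using assms
proof induction
  case (gen \<phi>)
  then obtain k\<^sub>0 a v b w' where \<phi>: "\<phi> = shift k\<^sub>0 a v b w'" and w: "a \<le> k\<^sub>0" "b \<le> k\<^sub>0" "v < N ^ a" "w' < N ^ b"
    by (auto simp: shifts_def)
  show ?case
  proof (intro exI[of _ k\<^sub>0] allI impI)
    fix k w t assume k: "k \<ge> k\<^sub>0"
    define \<alpha> :: complex where "\<alpha> = (if a = b \<and> v = w' \<and> w mod N ^ b = w' \<and> t + b \<ge> k\<^sub>0 then 1 else 0)"
    have "coord (\<phi> n (basis j)) i = (if i = j then \<alpha> else 0)"
      if n: "n \<ge> t + k + 1" and i: "N ^ (n - t - 1) \<le> i" "i < N ^ (n - t)" and
        j: "N ^ (n - t - 1) \<le> j" "j < N ^ (n - t)" and m: "i mod N ^ k = w" "j mod N ^ k = w" for n i j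
    proof -
      obtain p where p: "n - t = Suc p" "n - t - 1 = p" "k \<le> p" using n by (cases "n - t") auto
      let ?q = "j div N ^ b"
      let ?i = "?q * N ^ a + v"
      have "?q < N ^ (n - k\<^sub>0) \<longleftrightarrow> j < N ^ (n - k\<^sub>0 + b)"
        using div_less_pow[of b "n - k\<^sub>0 + b" j] by simp
      also have "\<dots> \<longleftrightarrow> t + b \<ge> k\<^sub>0"
      proof
        assume "t + b \<ge> k\<^sub>0"
        then show "j < N ^ (n - k\<^sub>0 + b)" using n k by (intro less_pow_mono[OF j(2)]) simp
      next
        assume "j < N ^ (n - k\<^sub>0 + b)"
        then have "N ^ (n - t - 1) < N ^ (n - k\<^sub>0 + b)" using j by linarith
        then show "t + b \<ge> k\<^sub>0" using n k by simp
      qed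
      finally have c: "?q < N ^ (n - k\<^sub>0) \<longleftrightarrow> t + b \<ge> k\<^sub>0" .
      have ab: "a = b" if eq: "?i = i"
      proof -
        have bp: "b \<le> p" "a \<le> p" using w k p by auto
        have "j < N ^ Suc p" "\<not> j < N ^ p" using j unfolding p by simp_all
        then have q: "?q < N ^ (Suc p - b)" "\<not> ?q < N ^ (p - b)"
          using div_less_pow[of b "Suc p" j] div_less_pow[of b p j] bp by auto
        have "?i < N ^ (Suc p - b + a)" "\<not> ?i < N ^ (p - b + a)"
          using q less_pow_split[of a "Suc p - b + a" v ?q] less_pow_split[of a "p - b + a" v ?q] w by auto
        moreover have "i < N ^ Suc p" "\<not> i < N ^ p" using i unfolding p by simp_all
        ultimately have "N ^ (p - b + a) < N ^ Suc p" "N ^ p < N ^ (Suc p - b + a)"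
          unfolding eq by linarith+
        then have "p - b + a < Suc p" "p < Suc p - b + a" by (simp_all only: pow_less_iff)
        then show "a = b" using bp by simp
      qed
      have "b \<le> k" using w k by simp
      then show ?thesis
        unfolding \<phi> using shift_entry[OF _ w(3,4) m ab] by (simp add: \<alpha>_def c)
    qed
    then show "\<exists>\<alpha>. band_scalar \<phi> k w t \<alpha>"
      unfolding band_scalar_def by blast
  qed
next
  case zero
  then show ?case by (intro exI[of _ 0] allI impI) (simp add: band_scalar_def)
next
  case (add \<phi> \<psi>)
  have sum: "band_scalar (\<lambda>n. \<phi> n + \<psi> n) k w t (\<alpha> + \<beta>)"
    if "band_scalar \<phi> k w t \<alpha>" "band_scalar \<psi> k w t \<beta>" for k w t \<alpha> \<beta>
    using that unfolding band_scalar_def by (simp add: blinfun.add_left)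
  from add.IH obtain k\<^sub>1 k\<^sub>2 where "\<forall>k\<ge>k\<^sub>1. \<forall>w t. \<exists>\<alpha>. band_scalar \<phi> k w t \<alpha>"
    "\<forall>k\<ge>k\<^sub>2. \<forall>w t. \<exists>\<alpha>. band_scalar \<psi> k w t \<alpha>" by blast
  then have "\<exists>\<alpha>. band_scalar (\<lambda>n. \<phi> n + \<psi> n) k w t \<alpha>" if "k \<ge> max k\<^sub>1 k\<^sub>2" for k w t
    using that by (metis sum max.bounded_iff)
  then show ?case by blast
next
  case (scale \<phi> c)
  have "band_scalar (\<lambda>n. scaleC_op c o\<^sub>L \<phi> n) k w t (c * \<alpha>)" if "band_scalar \<phi> k w t \<alpha>" for k w t \<alpha>
    using that unfolding band_scalar_def by simp
  then show ?case using scale.IH by blast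
qed

text \<open>In base \<open>N\<close> the index is the word \<open>z\<close>, followed by
  \<open>k\<close> zeros, the digit 1 and the \<open>k\<close> digits of \<open>w\<close>.\<close>

lemma marked_digits:
  assumes "w < N ^ k"
  shows "(z * N ^ (2 * k + 1) + (N ^ k + w)) div N ^ k mod N = 1"
    and "1 \<le> d \<Longrightarrow> d \<le> k \<Longrightarrow> (z * N ^ (2 * k + 1) + (N ^ k + w)) div N ^ (k + d) mod N = 0"
proof -
  have "z * N ^ (2 * k + 1) + (N ^ k + w) = (z * N ^ k * N + 1) * N ^ k + w"
    by (simp add: algebra_simps power_add power_mult power2_eq_square mult_2)
  then have "(z * N ^ (2 * k + 1) + (N ^ k + w)) div N ^ k = z * N ^ k * N + 1"
    by (simp only: div_mult_add[OF assms])
  moreover have "1 mod N = 1" using N2 by simp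
  ultimately show "(z * N ^ (2 * k + 1) + (N ^ k + w)) div N ^ k mod N = 1" by (simp only: mod_mult_self3)
  assume d: "1 \<le> d" "d \<le> k"
  have l: "N ^ k + w < N ^ (k + d)" by (rule marker_less[OF assms]) (use d in simp)
  have "2 * k + 1 = (k - d) + 1 + (k + d)" using d by simp
  then have "z * N ^ (2 * k + 1) + (N ^ k + w) = (z * N ^ (k - d) * N) * N ^ (k + d) + (N ^ k + w)"
    by (simp only: power_add) simp
  then have "(z * N ^ (2 * k + 1) + (N ^ k + w)) div N ^ (k + d) = z * N ^ (k - d) * N"
    by (simp only: div_mult_add[OF l])
  then show "(z * N ^ (2 * k + 1) + (N ^ k + w)) div N ^ (k + d) mod N = 0" by simp
qed

text \<open>The digits \<open>0 \<dots> 0 1\<close> (\<open>k\<close> zeros) in front of the last \<open>k\<close> digits do not agree with a proper shift of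
  themselves, so the compression to such indices kills all monomials of nonzero degree.\<close>

lemma marked_degree:
  assumes "w < N ^ k" "a \<le> k" "b \<le> k" "v < N ^ a"
    and "((z * N ^ (2 * k + 1) + (N ^ k + w)) div N ^ b) * N ^ a + v = z' * N ^ (2 * k + 1) + (N ^ k + w)"
      (is "(?j div _) * _ + _ = ?i")
  shows "a = b"
proof (rule ccontr)
  assume "a \<noteq> b"
  have "?i div N ^ a = ?j div N ^ b" unfolding assms(5)[symmetric] by (rule div_mult_add[OF assms(4)])
  then have sh: "?i div N ^ (a + p) = ?j div N ^ (b + p)" for p
    by (simp only: power_add div_mult2_eq)
  consider "b < a" | "a < b" using \<open>a \<noteq> b\<close> by linarith
  then show False
  proof cases
    case 1
    then have "a + (k - b) = k + (a - b)" "b + (k - b) = k" using assms by auto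
    then have "?i div N ^ (k + (a - b)) = ?j div N ^ k" using sh[of "k - b"] by simp
    moreover have "?i div N ^ (k + (a - b)) mod N = 0"
      by (rule marked_digits(2)[OF assms(1)]) (use 1 assms in auto)
    ultimately show False using marked_digits(1)[OF assms(1), of z] by simp
  next
    case 2
    then have "b + (k - a) = k + (b - a)" "a + (k - a) = k" using assms by auto
    then have "?j div N ^ (k + (b - a)) = ?i div N ^ k" using sh[of "k - a"] by simp
    moreover have "?j div N ^ (k + (b - a)) mod N = 0"
      by (rule marked_digits(2)[OF assms(1)]) (use 2 assms in auto)
    ultimately show False using marked_digits(1)[OF assms(1), of z'] by simp
  qed
qed

text \<open>The second clause is there because the large column found later need not carry the
  marker \<open>0 \<dots> 0 1\<close>, but its diagonal entry must still determine
  \<open>\<alpha>\<close>. In \<open>3 * k + 1\<close>, the marked suffix takes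
  \<open>2 * k + 1\<close> digits, and \<open>k\<close> leading zeros bring the word past the inner
  truncations.\<close>

definition marked_scalar :: "op_seq \<Rightarrow> nat \<Rightarrow> nat \<Rightarrow> complex \<Rightarrow> bool" where
  "marked_scalar \<phi> k w \<alpha> \<longleftrightarrow> (\<forall>n\<ge>3 * k + 1.
    (\<forall>z z'. z < N ^ (n - (3 * k + 1)) \<and> z' < N ^ (n - (3 * k + 1)) \<longrightarrow>
      coord (\<phi> n (basis (z * N ^ (2 * k + 1) + (N ^ k + w)))) (z' * N ^ (2 * k + 1) + (N ^ k + w)) =
        (if z = z' then \<alpha> else 0)) \<and>
    (\<forall>j. N ^ k \<le> j \<and> j < N ^ (n - k) \<and> j mod N ^ k = w \<longrightarrow> coord (\<phi> n (basis j)) j = \<alpha>))"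

text \<open>For a diagonal entry, a monomial of nonzero degree would need
  \<open>j div N ^ a = j div N ^ b\<close>, which is impossible when \<open>j \<ge> N ^ k\<close>.
  At least \<open>k\<close> leading zeros let the word pass every inner truncation, so
  \<open>\<alpha>\<close> does not depend on their exact number, unlike in the band case.\<close>

lemma poly_marked_scalar:
  assumes "\<phi> \<in> poly"
  shows "\<exists>k\<^sub>0. \<forall>k\<ge>k\<^sub>0. \<forall>w<N ^ k. \<exists>\<alpha>. marked_scalar \<phi> k w \<alpha>"
  using assms
proof induction
  case (gen \<phi>)
  then obtain k\<^sub>0 a v b w' where \<phi>: "\<phi> = shift k\<^sub>0 a v b w'" and w: "a \<le> k\<^sub>0" "b \<le> k\<^sub>0" "v < N ^ a" "w' < N ^ b"
    by (auto simp: shifts_def)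
  show ?case
  proof (intro exI[of _ k\<^sub>0] allI impI)
    fix k u assume k: "k \<ge> k\<^sub>0" and u: "u < N ^ k"
    define \<alpha> :: complex where "\<alpha> = (if a = b \<and> v = w' \<and> u mod N ^ b = w' then 1 else 0)"
    have entry: "coord (\<phi> n (basis j)) i = (if i = j then \<alpha> else 0)"
      if n: "n \<ge> 3 * k + 1" and j: "j < N ^ (n - k)" and m: "i mod N ^ k = u" "j mod N ^ k = u"
        and ab: "(j div N ^ b) * N ^ a + v = i \<Longrightarrow> a = b" for n i j
    proof -
      have "j < N ^ (n - k\<^sub>0 + b)" using k by (intro less_pow_mono[OF j]) simp
      then have c: "j div N ^ b < N ^ (n - k\<^sub>0)" using div_less_pow[of b "n - k\<^sub>0 + b" j] by simp
      have "b \<le> k" using w k by simp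
      then show ?thesis
        unfolding \<phi> using shift_entry[OF _ w(3,4) m ab] by (simp add: \<alpha>_def c)
    qed
    show "\<exists>\<alpha>. marked_scalar \<phi> k u \<alpha>"
      unfolding marked_scalar_def
    proof (intro exI[of _ \<alpha>] allI impI conjI)
      fix n z z' assume n: "n \<ge> 3 * k + 1" and z: "z < N ^ (n - (3 * k + 1)) \<and> z' < N ^ (n - (3 * k + 1))"
      have l: "N ^ k + u < N ^ (2 * k + 1)" by (rule marker_less[OF u]) simp
      have m: "(y * N ^ (2 * k + 1) + (N ^ k + u)) mod N ^ k = u" for y
      proof -
        have "y * N ^ (2 * k + 1) + (N ^ k + u) = (y * N ^ (k + 1) + 1) * N ^ k + u"
          by (simp add: algebra_simps power_add power_mult power2_eq_square mult_2)
        then show ?thesis using u by (simp only: mod_mult_self3 mod_less)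
      qed
      have "n - k - (2 * k + 1) = n - (3 * k + 1)" by simp
      then have "z * N ^ (2 * k + 1) + (N ^ k + u) < N ^ (n - k)"
        using less_pow_split[of "2 * k + 1" "n - k", OF _ l, of z] n z by simp
      moreover have "(z * N ^ (2 * k + 1) + (N ^ k + u)) div N ^ b * N ^ a + v =
          z' * N ^ (2 * k + 1) + (N ^ k + u) \<Longrightarrow> a = b"
        by (rule marked_degree[OF u]) (use w k in auto)
      ultimately have "coord (\<phi> n (basis (z * N ^ (2 * k + 1) + (N ^ k + u)))) (z' * N ^ (2 * k + 1) + (N ^ k + u)) =
          (if z' * N ^ (2 * k + 1) + (N ^ k + u) = z * N ^ (2 * k + 1) + (N ^ k + u) then \<alpha> else 0)"
        using n m by (intro entry)
      moreover have "z' * N ^ (2 * k + 1) + (N ^ k + u) = z * N ^ (2 * k + 1) + (N ^ k + u) \<longleftrightarrow> z = z'"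
        using N2 by auto
      ultimately show "coord (\<phi> n (basis (z * N ^ (2 * k + 1) + (N ^ k + u)))) (z' * N ^ (2 * k + 1) + (N ^ k + u)) =
          (if z = z' then \<alpha> else 0)" by (simp only:)
    next
      fix n j assume n: "n \<ge> 3 * k + 1" and j: "N ^ k \<le> j \<and> j < N ^ (n - k) \<and> j mod N ^ k = u"
      have "a = b" if eq: "(j div N ^ b) * N ^ a + v = j"
      proof (rule ccontr)
        assume ne: "a \<noteq> b"
        have q: "j div N ^ a = j div N ^ b"
          using arg_cong[OF eq, of "\<lambda>x. x div N ^ a"] by (simp only: div_mult_add[OF w(3)])
        have small: "j div N ^ y < j div N ^ x" if "x < y" "y \<le> k" for x y
        proof -
          have "N ^ x \<le> N ^ k" using that by simp
          then have "N ^ x \<le> j" using j by linarith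
          then have "j div N ^ x > 0" by (simp add: div_greater_zero_iff)
          moreover have "j div N ^ y = j div N ^ x div N ^ (y - x)"
            using that by (simp add: div_mult2_eq[symmetric] power_add[symmetric])
          moreover have "1 < N ^ (y - x)" using that N2 by (intro one_less_power) auto
          ultimately show ?thesis by (simp add: div_less_dividend)
        qed
        show False using small[of a b] small[of b a] q ne w k by (metis le_trans linorder_neqE_nat less_irrefl)
      qed
      then show "coord (\<phi> n (basis j)) j = \<alpha>"
        using entry[of n j j] n j by simp
    qed
  qed
next
  case zero
  then show ?case by (intro exI[of _ 0] allI impI) (simp add: marked_scalar_def)
next
  case (add \<phi> \<psi>)
  have sum: "marked_scalar (\<lambda>n. \<phi> n + \<psi> n) k w (\<alpha> + \<beta>)"
    if "marked_scalar \<phi> k w \<alpha>" "marked_scalar \<psi> k w \<beta>" for k w \<alpha> \<beta>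
    using that unfolding marked_scalar_def by (simp add: blinfun.add_left)
  from add.IH obtain k\<^sub>1 k\<^sub>2 where "\<forall>k\<ge>k\<^sub>1. \<forall>w<N ^ k. \<exists>\<alpha>. marked_scalar \<phi> k w \<alpha>"
    "\<forall>k\<ge>k\<^sub>2. \<forall>w<N ^ k. \<exists>\<alpha>. marked_scalar \<psi> k w \<alpha>" by blast
  then have "\<exists>\<alpha>. marked_scalar (\<lambda>n. \<phi> n + \<psi> n) k w \<alpha>" if "k \<ge> max k\<^sub>1 k\<^sub>2" "w < N ^ k" for k w
    using that by (metis sum max.bounded_iff)
  then show ?case by blast
next
  case (scale \<phi> c)
  have "marked_scalar (\<lambda>n. scaleC_op c o\<^sub>L \<phi> n) k w (c * \<alpha>)" if "marked_scalar \<phi> k w \<alpha>" for k w \<alpha>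
    using that unfolding marked_scalar_def by simp
  then show ?case using scale.IH by blast
qed


subsection \<open>Closed ideals containing the null sequences\<close>

text \<open>These are the preimages in \<open>S\<close> of the closed ideals of the quotient, by
  \<open>closed_ideal_preimage\<close> and \<open>closed_ideal_image\<close>. Working with sequences
  postpones the quotient norm to the end.\<close>

definition section_ideal :: "op_seq set \<Rightarrow> bool" where
  "section_ideal K \<longleftrightarrow> K \<subseteq> S \<and> G \<subseteq> K \<and> (\<forall>A\<in>K. \<forall>B\<in>K. (\<lambda>n. A n + B n) \<in> K) \<and>
    (\<forall>A\<in>K. \<forall>B\<in>S. (\<lambda>n. A n o\<^sub>L B n) \<in> K \<and> (\<lambda>n. B n o\<^sub>L A n) \<in> K) \<and>
    (\<forall>A\<in>S. (\<forall>\<epsilon>>0. \<exists>B\<in>K. \<forall>n. norm (B n - A n) \<le> \<epsilon>) \<longrightarrow> A \<in> K)"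

lemma finite_level_G: "A \<in> carrier (F_alg \<eta>) \<Longrightarrow> (\<lambda>n. if n < n\<^sub>0 then A n else 0) \<in> G"
proof -
  assume A: "A \<in> carrier (F_alg \<eta>)"
  obtain C where C: "C > 0" "\<And>n. norm (A n) \<le> C" using F_bound[OF A] by blast
  have "(\<lambda>n. if n < n\<^sub>0 then A n else 0) \<in> carrier (F_alg \<eta>)"
    by (rule F_memI[where C = C]) (use F_memD[OF A] C in \<open>auto simp: compose_simps less_imp_le\<close>)
  moreover have "(\<lambda>n. norm (if n < n\<^sub>0 then A n else 0)) \<longlonglongrightarrow> 0"
    by (rule tendsto_eventually) (auto simp: eventually_sequentially intro!: exI[of _ n\<^sub>0])
  ultimately show ?thesis by (simp add: G_iff)
qed

context
  fixes K
  assumes K: "section_ideal K"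
begin

lemma ideal_S: "A \<in> K \<Longrightarrow> A \<in> S" and ideal_G: "A \<in> G \<Longrightarrow> A \<in> K"
  and ideal_add: "A \<in> K \<Longrightarrow> B \<in> K \<Longrightarrow> (\<lambda>n. A n + B n) \<in> K"
  and ideal_right: "A \<in> K \<Longrightarrow> B \<in> S \<Longrightarrow> (\<lambda>n. A n o\<^sub>L B n) \<in> K"
  and ideal_left: "A \<in> K \<Longrightarrow> B \<in> S \<Longrightarrow> (\<lambda>n. B n o\<^sub>L A n) \<in> K"
  using K by (auto simp: section_ideal_def)

lemma ideal_zero: "(\<lambda>n. 0) \<in> K"
  by (rule ideal_G) (simp add: G_iff F_zero_one)

lemma ideal_scale: "A \<in> K \<Longrightarrow> (\<lambda>n. scaleC_op c o\<^sub>L A n) \<in> K"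
proof -
  assume A: "A \<in> K"
  have "(\<lambda>n. (scaleC_op c o\<^sub>L proj (N ^ n)) o\<^sub>L A n) \<in> K"
    by (rule ideal_left[OF A S_closed(5)[OF one_S]])
  moreover have "(\<lambda>n. (scaleC_op c o\<^sub>L proj (N ^ n)) o\<^sub>L A n) = (\<lambda>n. scaleC_op c o\<^sub>L A n)"
    using F_memD(2)[OF S_F[OF ideal_S[OF A]]] by (simp add: compose_assoc)
  ultimately show ?thesis by simp
qed

lemma ideal_uminus: "A \<in> K \<Longrightarrow> (\<lambda>n. - A n) \<in> K"
proof -
  assume A: "A \<in> K"
  have "(\<lambda>n. - A n) = (\<lambda>n. scaleC_op (-1) o\<^sub>L A n)"
    by (auto intro!: ext blinfun_eqI ell2_eqI simp: blinfun.bilinear_simps)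
  then show ?thesis using ideal_scale[OF A, of "-1"] by metis
qed

lemma ideal_diff: "A \<in> K \<Longrightarrow> B \<in> K \<Longrightarrow> (\<lambda>n. A n - B n) \<in> K"
  using ideal_add[OF _ ideal_uminus] by fastforce

lemma ideal_sum: "finite I \<Longrightarrow> (\<And>i. i \<in> I \<Longrightarrow> f i \<in> K) \<Longrightarrow> (\<lambda>n. \<Sum>i\<in>I. f i n) \<in> K"
  by (induction I rule: finite_induct) (auto intro: ideal_add ideal_zero)

text \<open>An approximation that holds from some level on is corrected below that level by a
  sequence with finitely many nonzero entries, which lies in \<open>G\<close>.\<close>

lemma ideal_limit:
  assumes A: "A \<in> S" and lim: "\<And>\<epsilon>. \<epsilon> > 0 \<Longrightarrow> \<exists>B\<in>K. \<forall>\<^sub>F n in sequentially. norm (B n - A n) \<le> \<epsilon>"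
  shows "A \<in> K"
proof -
  have "\<exists>B\<in>K. \<forall>n. norm (B n - A n) \<le> \<epsilon>" if "\<epsilon> > 0" for \<epsilon>
  proof -
    obtain B n\<^sub>0 where B: "B \<in> K" "\<And>n. n \<ge> n\<^sub>0 \<Longrightarrow> norm (B n - A n) \<le> \<epsilon>"
      using lim[OF \<open>\<epsilon> > 0\<close>] unfolding eventually_sequentially by blast
    let ?E = "\<lambda>n. if n < n\<^sub>0 then A n - B n else 0"
    have "?E \<in> G"
      by (rule finite_level_G) (intro S_F S_diff A ideal_S B)
    then have "(\<lambda>n. B n + ?E n) \<in> K" by (intro ideal_add B ideal_G)
    moreover have "norm (B n + ?E n - A n) \<le> \<epsilon>" for n
      using B(2)[of n] \<open>\<epsilon> > 0\<close> by auto
    ultimately show ?thesis by (intro bexI[of _ "\<lambda>n. B n + ?E n"] allI)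
  qed
  then show ?thesis using K A unfolding section_ideal_def by blast
qed

lemma ideal_cong:
  assumes "A \<in> S" "B \<in> K" "\<forall>\<^sub>F n in sequentially. A n = B n"
  shows "A \<in> K"
proof (rule ideal_limit[OF assms(1)])
  fix \<epsilon> :: real assume "\<epsilon> > 0"
  then have "\<forall>\<^sub>F n in sequentially. norm (B n - A n) \<le> \<epsilon>"
    using assms(3) by (auto elim: eventually_mono)
  then show "\<exists>B\<in>K. \<forall>\<^sub>F n in sequentially. norm (B n - A n) \<le> \<epsilon>" using assms(2) by blast
qed

text \<open>With \<open>D = f - C\<close>, the powers of \<open>D\<close> tend to \<open>0\<close> and differ from \<open>f\<close> by elements of the ideal.\<close>

lemma ideal_idempotent:
  assumes f: "f \<in> S" "\<And>n. f n o\<^sub>L f n = f n" and C: "C \<in> K"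
    and close: "\<forall>\<^sub>F n in sequentially. norm (f n - C n) \<le> 1/2"
  shows "f \<in> K"
proof (rule ideal_limit[OF f(1)])
  have pow: "\<exists>B\<in>K. \<forall>\<^sub>F n in sequentially. norm (f n - B n) \<le> (1/2) ^ Suc i" for i
  proof (induction i)
    case 0
    then show ?case using C close by auto
  next
    case (Suc i)
    then obtain B where B: "B \<in> K" "\<forall>\<^sub>F n in sequentially. norm (f n - B n) \<le> (1/2) ^ Suc i" by blast
    let ?B = "\<lambda>n. (f n o\<^sub>L C n) + ((B n o\<^sub>L f n) - (B n o\<^sub>L C n))"
    have "(\<lambda>n. f n o\<^sub>L C n) \<in> K" by (rule ideal_left[OF C f(1)])
    moreover have "(\<lambda>n. (B n o\<^sub>L f n) - (B n o\<^sub>L C n)) \<in> K"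
      by (rule ideal_diff[OF ideal_right[OF B(1) f(1)] ideal_right[OF B(1) ideal_S[OF C]]])
    ultimately have "?B \<in> K" by (rule ideal_add)
    moreover have "\<forall>\<^sub>F n in sequentially. norm (f n - ?B n) \<le> (1/2) ^ Suc (Suc i)"
      using B(2) close
    proof eventually_elim
      case (elim n)
      have "f n - ?B n = (f n - B n) o\<^sub>L (f n - C n)"
        by (simp add: compose_simps f(2))
      also have "norm \<dots> \<le> (1/2) ^ Suc i * (1/2)" by (rule norm_compose_le[OF elim])
      finally show ?case by simp
    qed
    ultimately show ?case by (intro bexI[of _ ?B])
  qed
  fix \<epsilon> :: real assume "\<epsilon> > 0"
  then obtain i where i: "(1/2 :: real) ^ i < \<epsilon>" using real_arch_pow_inv[of \<epsilon> "1/2"] by auto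
  have "(1/2 :: real) ^ Suc i \<le> (1/2) ^ i" by simp
  then have le: "(1/2 :: real) ^ Suc i \<le> \<epsilon>" using i by linarith
  obtain B where B: "B \<in> K" "\<forall>\<^sub>F n in sequentially. norm (f n - B n) \<le> (1/2) ^ Suc i"
    using pow[of i] by blast
  from B(2) have "\<forall>\<^sub>F n in sequentially. norm (f n - B n) \<le> \<epsilon>"
    by (rule eventually_mono) (use le in linarith)
  with B(1) show "\<exists>B\<in>K. \<forall>\<^sub>F n in sequentially. norm (B n - f n) \<le> \<epsilon>"
    by (auto simp: norm_minus_commute)
qed

text \<open>After division by \<open>\<alpha>\<close>, the compression of \<open>B\<close> differs
  from \<open>P\<close> by at most \<open>4 * \<epsilon> / cmod \<alpha> \<le> 4/15\<close>, so
  \<open>ideal_idempotent\<close> applies. The factor 4 comes from the crude bound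
  \<open>norm (P n) \<le> 2\<close>, which is what the triangle inequality yields for a
  band.\<close>

lemma ideal_compression:
  assumes B: "B \<in> K" and close: "\<forall>\<^sub>F n in sequentially. norm (B n - \<psi> n) \<le> \<epsilon>" and \<alpha>: "15 * \<epsilon> \<le> cmod \<alpha>" "0 < \<epsilon>"
    and u: "u < N ^ c" and P: "P \<in> S" "\<And>n. P n o\<^sub>L P n = P n" "\<And>n. norm (P n) \<le> 2"
    and TP: "\<forall>\<^sub>F n in sequentially. sections \<eta> (T c u) n o\<^sub>L P n = T c u o\<^sub>L P n"
    and comp: "\<forall>\<^sub>F n in sequentially. adj (T c u o\<^sub>L P n) o\<^sub>L \<psi> n o\<^sub>L (T c u o\<^sub>L P n) = scaleC_op \<alpha> o\<^sub>L P n"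
  shows "P \<in> K"
proof -
  let ?R = "\<lambda>n. sections \<eta> (T c u) n o\<^sub>L P n"
  let ?C = "\<lambda>n. scaleC_op (1 / \<alpha>) o\<^sub>L (adj (?R n) o\<^sub>L B n o\<^sub>L ?R n)"
  have R: "?R \<in> S" by (intro S_closed sections_S T_cuntz u P)
  have "?C \<in> K" by (intro ideal_scale ideal_right ideal_left B S_closed(4)[of ?R] R)
  have \<alpha>0: "\<alpha> \<noteq> 0" "cmod \<alpha> > 0" using \<alpha> by auto
  have "\<forall>\<^sub>F n in sequentially. norm (P n - ?C n) \<le> 1/2"
    using close TP comp
  proof eventually_elim
    case (elim n)
    let ?r = "T c u o\<^sub>L P n"
    have r: "norm ?r \<le> 2" using norm_compose_le[OF norm_T_le P(3)] by simp
    then have ar: "norm (adj ?r) \<le> 2" using norm_adj_le[of ?r] S_clin[OF P(1)] by auto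
    have "scaleC_op (1 / \<alpha>) o\<^sub>L (scaleC_op \<alpha> o\<^sub>L P n) = P n"
      using \<alpha>0 by (intro blinfun_eqI) simp
    then have "P n - ?C n = scaleC_op (1 / \<alpha>) o\<^sub>L (adj ?r o\<^sub>L (\<psi> n - B n) o\<^sub>L ?r)"
      using elim(2,3) by (simp add: compose_simps)
    also have "norm \<dots> \<le> cmod (1 / \<alpha>) * (2 * \<epsilon> * 2)"
      by (intro norm_compose_le norm_scaleC_op_le ar r) (use elim(1) in \<open>simp add: norm_minus_commute\<close>)
    also have "\<dots> \<le> 1/2" using \<alpha> \<alpha>0 by (simp add: norm_divide field_simps)
    finally show ?case .
  qed
  then show "P \<in> K" by (rule ideal_idempotent[OF P(1,2) \<open>?C \<in> K\<close>])
qed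

end

text \<open>The class of this sequence is \<open>e - p_1\<close>, see \<open>one_minus_p1\<close>.
  For \<open>n \<ge> 1\<close> it selects the words of \<open>n\<close> digits with nonzero leading
  digit; at level 0 it is 0.\<close>

definition top_band :: "op_seq" where
  "top_band n = proj (N ^ n) - proj (N ^ (n - 1))"

definition band :: "nat \<Rightarrow> nat \<Rightarrow> ell2 \<Rightarrow>\<^sub>L ell2" where
  "band c n = proj (N ^ (n - c)) - proj (N ^ (n - Suc c))"

lemma band_0: "band 0 = top_band"
  by (auto simp: band_def top_band_def)

lemma band_S: "band c \<in> S"
  using S_diff[OF proj_S[of c] proj_S[of "Suc c"]] by (simp add: band_def[abs_def])

lemma band_basis: "band c n (basis z) = (if N ^ (n - Suc c) \<le> z \<and> z < N ^ (n - c) then basis z else 0)"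
proof -
  have "z < N ^ (n - Suc c) \<Longrightarrow> z < N ^ (n - c)" by (erule less_pow_mono) simp
  then show ?thesis by (auto simp: band_def blinfun.diff_left)
qed

lemma clin_band [simp]: "clin (band c n)"
  by (simp add: band_def)

lemma band_idem: "band c n o\<^sub>L band c n = band c n"
  by (rule clin_eqI) (auto simp: band_basis blinfun.zero_right)

lemma norm_band_le: "norm (band c n) \<le> 2"
  unfolding band_def using norm_triangle_ineq4[of "proj (N ^ (n - c))" "proj (N ^ (n - Suc c))"]
    norm_proj_le[of "N ^ (n - c)"] norm_proj_le[of "N ^ (n - Suc c)"] by linarith

lemma band_range:
  assumes "Suc c \<le> n" "u < N ^ a" "a \<le> n - Suc c"
  shows "N ^ (n - Suc c) \<le> z * N ^ a + u \<and> z * N ^ a + u < N ^ (n - c) \<longleftrightarrow>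
    N ^ (n - Suc (c + a)) \<le> z \<and> z < N ^ (n - (c + a))"
  using less_pow_split[of a "n - Suc c" u z] less_pow_split[of a "n - c" u z] assms
  by (simp add: diff_diff_eq not_less[symmetric] add.commute)

text \<open>\<open>band c\<close> is eventually equivalent to a subprojection of \<open>top_band\<close>, and \<open>top_band\<close> is the sum of \<open>N ^ c\<close>
  projections equivalent to \<open>band c\<close>.\<close>

lemma ideal_band_imp:
  assumes K: "section_ideal K" and "top_band \<in> K"
  shows "band c \<in> K"
proof (rule ideal_cong[OF K band_S])
  let ?T = "sections \<eta> (T c 0)"
  have T: "?T \<in> S" by (simp add: sections_S T_cuntz)
  show "(\<lambda>n. adj (?T n) o\<^sub>L top_band n o\<^sub>L ?T n) \<in> K"
    by (intro ideal_right[OF K] ideal_left[OF K] assms S_closed(4)[of ?T] T)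
  show "\<forall>\<^sub>F n in sequentially. band c n = adj (?T n) o\<^sub>L top_band n o\<^sub>L ?T n"
    using eventually_ge_at_top[of "Suc c"]
  proof eventually_elim
    case (elim n)
    show ?case
    proof (rule clin_eqI)
      fix z
      have r: "N ^ (n - Suc 0) \<le> z * N ^ c \<and> z * N ^ c < N ^ n \<longleftrightarrow> N ^ (n - Suc c) \<le> z \<and> z < N ^ (n - c)"
        using band_range[of 0 n 0 c z] elim by simp
      have "z < N ^ (n - c) \<Longrightarrow> z < N ^ n" by (erule less_pow_mono) simp
      moreover have "z * N ^ c < N ^ n \<longleftrightarrow> z < N ^ (n - c)"
        using less_pow_split[of c n 0 z] elim by simp
      ultimately show "band c n (basis z) = (adj (?T n) o\<^sub>L top_band n o\<^sub>L ?T n) (basis z)"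
        using r by (auto simp: band_basis sections_T_basis adj_sections_T_basis blinfun.zero_right
            band_0[symmetric] simp del: One_nat_def)
    qed (auto simp: sections_def top_band_def)
  qed
qed

lemma ideal_band:
  assumes K: "section_ideal K" and "band c \<in> K"
  shows "top_band \<in> K"
proof -
  let ?T = "\<lambda>u. sections \<eta> (T c u)"
  have T: "?T u \<in> S" if "u < N ^ c" for u using that by (simp add: sections_S T_cuntz)
  have "(\<lambda>n. \<Sum>u<N ^ c. ?T u n o\<^sub>L band c n o\<^sub>L adj (?T u n)) \<in> K"
    by (intro ideal_sum[OF K] ideal_right[OF K] ideal_left[OF K] assms S_closed(4)[of "?T _"] T) auto
  moreover have "\<forall>\<^sub>F n in sequentially. top_band n = (\<Sum>u<N ^ c. ?T u n o\<^sub>L band c n o\<^sub>L adj (?T u n))"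
    using eventually_ge_at_top[of "Suc c"]
  proof eventually_elim
    case (elim n)
    show ?case
    proof (rule clin_eqI)
      fix j
      let ?u = "j mod N ^ c" and ?z = "j div N ^ c"
      have r: "N ^ (n - Suc 0) \<le> j \<and> j < N ^ n \<longleftrightarrow> N ^ (n - Suc c) \<le> ?z \<and> ?z < N ^ (n - c)"
        using band_range[of 0 n ?u c ?z] elim unfolding div_mult_mod_eq by simp
      have zn: "?z < N ^ (n - c) \<Longrightarrow> ?z < N ^ n" by (erule less_pow_mono) simp
      have "(\<Sum>u<N ^ c. ?T u n o\<^sub>L band c n o\<^sub>L adj (?T u n)) (basis j) =
          (\<Sum>u\<in>{?u}. (?T u n o\<^sub>L band c n o\<^sub>L adj (?T u n)) (basis j))"
        unfolding blinfun.sum_left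
        by (rule sum.mono_neutral_right) (auto simp: adj_sections_T_basis blinfun.zero_right)
      also have "\<dots> = top_band n (basis j)"
        using r zn by (auto simp: div_mult_mod_eq band_basis sections_T_basis adj_sections_T_basis blinfun.zero_right
            band_0[symmetric] simp del: One_nat_def)
      finally show "top_band n (basis j) = (\<Sum>u<N ^ c. ?T u n o\<^sub>L band c n o\<^sub>L adj (?T u n)) (basis j)" by simp
    qed (auto intro!: clin_sum simp: sections_def top_band_def)
  qed
  ultimately show ?thesis
    using band_S[of 0] ideal_cong[OF K] by (simp add: band_0)
qed

lemma ideal_tail:
  assumes K: "section_ideal K" and "top_band \<in> K"
  shows "(\<lambda>n. proj (N ^ n) - proj (N ^ (n - c))) \<in> K"
proof -
  have "(\<lambda>n. \<Sum>i<c. band i n) \<in> K"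
    by (intro ideal_sum[OF K] ideal_band_imp[OF assms]) auto
  moreover have "(\<Sum>i<c. band i n) = proj (N ^ n) - proj (N ^ (n - c))" for n
    by (induction c) (auto simp: band_def)
  ultimately show ?thesis by simp
qed


subsection \<open>Every closed ideal other than the null sequences contains the top band\<close>

text \<open>The diagonal entry of \<open>adj A o\<^sub>L A\<close> at \<open>j\<close> is the
  squared norm of column \<open>j\<close>, hence at least \<open>\<delta>\<^sup>2\<close>, and the
  perturbation costs at most a sixteenth of that. The remaining fifteen sixteenths supply the factor
  15 in \<open>ideal_compression\<close>.\<close>

lemma column_square:
  assumes "clin A" "norm ((adj A o\<^sub>L A) - X) \<le> \<delta>\<^sup>2 / 16" "\<delta> \<le> norm (A (basis j))" "0 < \<delta>"
  shows "15 * (\<delta>\<^sup>2 / 16) \<le> cmod (coord (X (basis j)) j)"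
proof -
  have "coord ((adj A o\<^sub>L A) (basis j)) j = complex_of_real ((norm (A (basis j)))\<^sup>2)"
    using assms(1) by (simp add: coord_adj cinner_self)
  then have "(norm (A (basis j)))\<^sup>2 = cmod (coord ((adj A o\<^sub>L A) (basis j)) j)"
    by (simp add: norm_power)
  also have "\<dots> \<le> cmod (coord (X (basis j)) j) + cmod (coord (((adj A o\<^sub>L A) - X) (basis j)) j)"
    using norm_triangle_sub[of "coord ((adj A o\<^sub>L A) (basis j)) j" "coord (X (basis j)) j"]
    by (simp add: blinfun.diff_left)
  also have "cmod (coord (((adj A o\<^sub>L A) - X) (basis j)) j) \<le> \<delta>\<^sup>2 / 16"
    using coord_le_norm[of "((adj A o\<^sub>L A) - X) (basis j)" j] norm_blinfun[of "(adj A o\<^sub>L A) - X" "basis j"] assms(2)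
    by simp
  finally have "(norm (A (basis j)))\<^sup>2 \<le> cmod (coord (X (basis j)) j) + \<delta>\<^sup>2 / 16" by simp
  moreover have "\<delta>\<^sup>2 \<le> (norm (A (basis j)))\<^sup>2" using assms(3,4) by (intro power_mono) auto
  ultimately show ?thesis by simp
qed

lemma norm_gt_witness:
  assumes "norm A > C" "0 \<le> C" "A o\<^sub>L proj m = A"
  obtains x where "x \<noteq> 0" "proj m x = x" "C * norm x < norm (A x)"
proof -
  obtain x where x: "\<not> norm (A x) \<le> C * norm x"
    using norm_blinfun_bound[OF assms(2)] assms(1) by (meson not_le)
  have Ax: "A (proj m x) = A x" by (metis assms(3) blinfun_apply_blinfun_compose)
  have "norm (proj m x) \<le> norm x" by (rule norm_contraction[OF norm_proj_le])
  then have "C * norm (proj m x) \<le> C * norm x" using assms(2) by (rule mult_left_mono)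
  then have c: "C * norm (proj m x) < norm (A (proj m x))" using x Ax by simp
  show ?thesis
  proof (rule that[OF _ _ c])
    show "proj m x \<noteq> 0" using c by (auto simp: blinfun.zero_right)
    show "proj m (proj m x) = proj m x"
      by (metis blinfun_apply_blinfun_compose min.idem proj_proj)
  qed
qed

lemma leading_digit:
  assumes "1 \<le> j"
  obtains p where "N ^ p \<le> j" "j < N ^ Suc p"
proof -
  define p where "p = (LEAST p. j < N ^ Suc p)"
  have "j < N ^ Suc j" using less_pow[of j] less_le_trans[of j "N ^ j" "N ^ Suc j"] by (simp del: power_Suc)
  then have 1: "j < N ^ Suc p" unfolding p_def by (rule LeastI)
  have "N ^ p \<le> j"
  proof (cases p)
    case (Suc q)
    then have "\<not> j < N ^ Suc q" using not_less_Least[of q "\<lambda>p. j < N ^ Suc p"] p_def by auto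
    then show ?thesis using Suc by simp
  qed (use assms in auto)
  then show ?thesis using 1 that by blast
qed

lemma sections_T_proj:
  assumes "u < N ^ c" "c \<le> n" "\<And>z. blinfun_apply P (basis z) = (if z \<in> Z then basis z else 0)"
    "\<And>z. z \<in> Z \<Longrightarrow> z < N ^ (n - c)" "clin P"
  shows "sections \<eta> (T c u) n o\<^sub>L P = T c u o\<^sub>L P"
proof (rule clin_eqI)
  fix z
  have "z < N ^ n" if "z \<in> Z" by (rule less_pow_mono[OF assms(4)[OF that]]) simp
  then show "(sections \<eta> (T c u) n o\<^sub>L P) (basis z) = (T c u o\<^sub>L P) (basis z)"
    using assms(1-4) less_pow_split[of c n u z] by (auto simp: sections_T_basis T_basis blinfun.zero_right)
qed (use assms in \<open>auto simp: sections_def\<close>)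

lemma eventually_witness:
  fixes a l :: nat
  assumes "\<forall>\<^sub>F n in sequentially. P n" "\<forall>\<^sub>F m in sequentially. Q m"
  obtains m where "m \<ge> l" "P (a + m)" "Q m"
proof -
  obtain n\<^sub>1 n\<^sub>2 where "\<And>n. n \<ge> n\<^sub>1 \<Longrightarrow> P n" "\<And>m. m \<ge> n\<^sub>2 \<Longrightarrow> Q m"
    using assms unfolding eventually_sequentially by blast
  then show ?thesis using that[of "max l (max n\<^sub>1 n\<^sub>2)"] by simp
qed

lemma ideal_contains_top_band:
  assumes K: "section_ideal K" and A: "A \<in> K" "A \<notin> G"
  shows "top_band \<in> K"
proof -
  have AS: "A \<in> S" and AF: "A \<in> carrier (F_alg \<eta>)" using ideal_S[OF K A(1)] S_F by auto
  have "\<not> (\<lambda>n. norm (A n)) \<longlonglongrightarrow> 0" using A(2) AF by (simp add: G_iff)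
  then obtain e where e: "e > 0" "\<not> (\<forall>\<^sub>F n in sequentially. norm (A n) < e)"
    by (auto simp: tendsto_iff)
  \<comment> \<open>With a third, \<open>2 * \<kappa> < e\<close>: one \<open>\<kappa>\<close> is
    the lower bound wanted for \<open>\<phi>\<close>, the other absorbs the approximation
    error.\<close>
  define \<kappa> where "\<kappa> = e / 3"
  have \<kappa>: "\<kappa> > 0" using e by (simp add: \<kappa>_def)
  obtain \<phi> where \<phi>: "\<phi> \<in> poly" "\<forall>\<^sub>F n in sequentially. norm (A n - \<phi> n) \<le> \<kappa> / 4"
    using approxE[OF S_approx[OF AS], of "\<kappa> / 4"] \<kappa> by auto
  obtain h\<^sub>0 where h0: "\<And>h. h \<ge> h\<^sub>0 \<Longrightarrow> \<exists>\<delta>>0. large_columns A \<phi> \<kappa> h \<delta>"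
    using column_lower_bound[OF \<phi>(1) \<kappa> \<phi>(2) S_clin[OF AS]] by blast
  obtain h\<^sub>1 where h1: "\<And>n. n \<ge> h\<^sub>1 \<Longrightarrow> norm (A n - \<phi> n) \<le> \<kappa> / 4"
    using \<phi>(2) by (auto simp: eventually_sequentially)
  obtain h where h: "h \<ge> max h\<^sub>0 h\<^sub>1" "norm (A h) \<ge> e"
    using e(2) unfolding eventually_sequentially by (meson not_le)
  have "2 * \<kappa> < norm (A h)" using h e by (simp add: \<kappa>_def)
  then obtain x where x: "x \<noteq> 0" "proj (N ^ h) x = x" "2 * \<kappa> * norm x < norm (A h x)"
    using norm_gt_witness[of "2 * \<kappa>" "A h" "N ^ h"] \<kappa> F_memD(3)[OF AF] by auto
  have "norm ((A h - \<phi> h) x) \<le> \<kappa> / 4 * norm x"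
    using h h1[of h] by (intro order_trans[OF norm_blinfun] mult_right_mono) auto
  moreover have "norm (A h x) \<le> norm (\<phi> h x) + norm ((A h - \<phi> h) x)"
    using norm_triangle_sub[of "A h x" "\<phi> h x"] by (simp add: blinfun.diff_left)
  moreover have "\<kappa> * norm x > 0" using \<kappa> x by simp
  ultimately have \<phi>x: "\<kappa> * norm x \<le> norm (\<phi> h x)" using x(3) by (simp add: algebra_simps)
  obtain \<delta> where \<delta>: "\<delta> > 0" "large_columns A \<phi> \<kappa> h \<delta>" using h0[of h] h by auto
  have col: "\<forall>\<^sub>F m in sequentially. \<exists>j. N ^ (m - 1) \<le> j \<and> j < N ^ (h + m) \<and> \<delta> \<le> norm (A (h + m) (basis j))"
    using \<delta>(2) unfolding large_columns_def by (rule eventually_mono) (use x \<phi>x in blast)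
  let ?B = "\<lambda>n. adj (A n) o\<^sub>L A n"
  have B: "?B \<in> K" by (intro ideal_left[OF K A(1)] S_closed(4) AS)
  obtain \<psi> where \<psi>: "\<psi> \<in> poly" "\<forall>\<^sub>F n in sequentially. norm (?B n - \<psi> n) \<le> \<delta>\<^sup>2 / 16"
    using approxE[OF S_approx[OF ideal_S[OF K B]], of "\<delta>\<^sup>2 / 16"] \<delta>(1) by auto
  obtain k where k: "\<And>w t. \<exists>\<alpha>. band_scalar \<psi> k w t \<alpha>"
    using poly_band_scalar[OF \<psi>(1)] by blast
  \<comment> \<open>A column with index at least \<open>N ^ (m - 1)\<close> is then long enough for
    \<open>band_scalar\<close>: more than \<open>k\<close> digits follow its leading zeros.\<close>
  obtain m where m: "m \<ge> k + 2" "norm (?B (h + m) - \<psi> (h + m)) \<le> \<delta>\<^sup>2 / 16"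
    "\<exists>j. N ^ (m - 1) \<le> j \<and> j < N ^ (h + m) \<and> \<delta> \<le> norm (A (h + m) (basis j))"
    by (rule eventually_witness[OF \<psi>(2) col])
  then obtain j where j: "N ^ (m - 1) \<le> j" "j < N ^ (h + m)" "\<delta> \<le> norm (A (h + m) (basis j))" by blast
  have "1 \<le> N ^ (m - 1)" using N2 by simp
  then have "1 \<le> j" using j(1) by linarith
  then obtain p where p: "N ^ p \<le> j" "j < N ^ Suc p" by (rule leading_digit)
  have "N ^ p < N ^ (h + m)" "N ^ (m - 1) < N ^ Suc p" using j p by linarith+
  then have pm: "p < h + m" "m - 1 < Suc p" by (simp_all only: pow_less_iff)
  \<comment> \<open>\<open>t\<close> counts the leading zeros of \<open>j\<close> as a word of
    \<open>h + m\<close> digits.\<close>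
  define t where "t = h + m - 1 - p"
  define w where "w = j mod N ^ k"
  have t: "h + m - t = Suc p" "t + k + 1 \<le> h + m" using pm m(1) by (auto simp: t_def)
  obtain \<alpha> where \<alpha>\<^sub>0: "band_scalar \<psi> k w t \<alpha>" using k by blast
  note \<alpha> = \<alpha>\<^sub>0[unfolded band_scalar_def, rule_format]
  \<comment> \<open>One level is enough: \<open>band_scalar\<close> provides the same
    \<open>\<alpha>\<close> at all large levels, so the lower bound read off at level
    \<open>h + m\<close> holds throughout.\<close>
  have "coord (\<psi> (h + m) (basis j)) j = (if j = j then \<alpha> else 0)"
    by (rule \<alpha>[OF t(2)], intro conjI) (use p in \<open>simp_all only: t(1) diff_Suc_1 w_def\<close>)
  then have a: "15 * (\<delta>\<^sup>2 / 16) \<le> cmod \<alpha>"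
    using column_square[OF S_clin[OF AS] m(2) j(3) \<delta>(1)] by simp
  \<comment> \<open>Words with \<open>t + k\<close> leading zeros are those that have
    \<open>t\<close> of them after the \<open>k\<close> digits of \<open>w\<close> are
    appended.\<close>
  let ?P = "band (t + k)"
  have w: "w < N ^ k" by (simp add: w_def)
  have "?P \<in> K"
  proof (rule ideal_compression[OF K B \<psi>(2) a _ w band_S band_idem norm_band_le])
    let ?Z = "\<lambda>n. {z. N ^ (n - Suc (t + k)) \<le> z \<and> z < N ^ (n - (t + k))}"
    show "\<forall>\<^sub>F n in sequentially. sections \<eta> (T k w) n o\<^sub>L ?P n = T k w o\<^sub>L ?P n"
      using eventually_ge_at_top[of k]
    proof eventually_elim
      case (elim n)
      have "z < N ^ (n - k)" if "z \<in> ?Z n" for z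
        by (rule less_pow_mono[of _ "n - (t + k)"]) (use that in auto)
      then show ?case by (intro sections_T_proj[OF w elim, where Z = "?Z n"]) (auto simp: band_basis)
    qed
    show "\<forall>\<^sub>F n in sequentially. adj (T k w o\<^sub>L ?P n) o\<^sub>L \<psi> n o\<^sub>L (T k w o\<^sub>L ?P n) = scaleC_op \<alpha> o\<^sub>L ?P n"
      using eventually_ge_at_top[of "t + k + 1"]
    proof eventually_elim
      case (elim n)
      have r: "N ^ (n - t - 1) \<le> z * N ^ k + w \<and> z * N ^ k + w < N ^ (n - t)" if "z \<in> ?Z n" for z
        using band_range[of t n w k z] that w elim by simp
      show ?case
      proof (rule compress_scalar[OF w, where Z = "?Z n"])
        show "clin (\<psi> n)" using star_algebra_germs.lin[OF star_algebra_germs_shifts \<psi>(1)] .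
        fix z z' assume z: "z \<in> ?Z n" "z' \<in> ?Z n"
        show "coord (\<psi> n (basis (z * N ^ k + w))) (z' * N ^ k + w) = (if z = z' then \<alpha> else 0)"
          using \<alpha>[OF elim, of "z' * N ^ k + w" "z * N ^ k + w"] r[OF z(1)] r[OF z(2)] w N2 by auto
      qed (auto simp: band_basis)
    qed
  qed (use \<delta>(1) in auto)
  then show ?thesis by (rule ideal_band[OF K])
qed

subsection \<open>Closed ideals above an ideal that contains the top band\<close>

text \<open>\<open>\<phi>\<^sub>0\<close> arises from \<open>\<phi>\<close> by removing the truncations inside the monomials. It consists of the sections
  of an element of the Cuntz algebra and agrees with \<open>\<phi>\<close> modulo the top band.\<close>

definition untruncates :: "op_seq set \<Rightarrow> op_seq \<Rightarrow> op_seq \<Rightarrow> nat \<Rightarrow> bool" where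
  "untruncates J \<phi> \<phi>\<^sub>0 k \<longleftrightarrow> (\<exists>B\<in>J. \<forall>\<^sub>F n in sequentially. \<phi> n - \<phi>\<^sub>0 n = B n) \<and>
    (\<forall>h n. k \<le> h \<and> h + k \<le> n \<longrightarrow> proj (N ^ h) o\<^sub>L \<phi> n o\<^sub>L proj (N ^ h) = \<phi>\<^sub>0 h)"

text \<open>Replacing the depth \<open>k\<close> of a monomial by \<open>max a b\<close>, the depth
  of a true section, changes it by a product with a difference of two tails, which lie in
  \<open>J\<close> by \<open>ideal_tail\<close>. On words with enough leading zeros the inner
  truncation never takes effect, so the corner of size \<open>N ^ h\<close> is the same at every
  level \<open>n \<ge> h + k\<close>.\<close>

lemma poly_untruncate:
  assumes J: "section_ideal J" "top_band \<in> J" and "\<phi> \<in> poly"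
  shows "\<exists>\<phi>\<^sub>0 k. untruncates J \<phi> \<phi>\<^sub>0 k"
  using assms(3)
proof induction
  case (gen \<phi>)
  then obtain k a v b w where \<phi>: "\<phi> = shift k a v b w" and w: "a \<le> k" "b \<le> k" "v < N ^ a" "w < N ^ b"
    by (auto simp: shifts_def)
  let ?l = "max a b"
  let ?D = "\<lambda>n. (proj (N ^ n) - proj (N ^ (n - k))) - (proj (N ^ n) - proj (N ^ (n - ?l)))"
  let ?B = "\<lambda>n. - (sections \<eta> (T a v) n o\<^sub>L (?D n) o\<^sub>L adj (sections \<eta> (T b w) n))"
  have S: "sections \<eta> (T a v) \<in> S" "sections \<eta> (T b w) \<in> S" using w by (auto intro: sections_S T_cuntz)
  show ?case
    unfolding untruncates_def
  proof (intro exI conjI allI impI bexI)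
    show "?B \<in> J"
      by (intro ideal_uminus ideal_right ideal_left ideal_diff ideal_tail J S S_closed(4)[of "sections \<eta> (T b w)"])
    show "\<forall>\<^sub>F n in sequentially. \<phi> n - shift ?l a v b w n = ?B n"
      using eventually_ge_at_top[of k]
    proof eventually_elim
      case (elim n)
      show ?case
      proof (rule clin_eqI)
        fix j
        let ?q = "j div N ^ b"
        have "?q < N ^ (n - k) \<Longrightarrow> ?q < N ^ (n - ?l)" "?q < N ^ (n - ?l) \<Longrightarrow> ?q < N ^ (n - b)"
          "?q < N ^ (n - ?l) \<Longrightarrow> ?q < N ^ (n - a)" "?q < N ^ (n - a) \<Longrightarrow> ?q < N ^ n"
          using w by (auto elim: less_pow_mono)
        moreover have "?q < N ^ (n - b) \<longleftrightarrow> j < N ^ n" using div_less_pow[of b n j] w elim by simp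
        moreover have "?q < N ^ (n - a) \<longleftrightarrow> ?q * N ^ a + v < N ^ n"
          using less_pow_split[of a n v ?q] w elim by simp
        ultimately show "(\<phi> n - shift ?l a v b w n) (basis j) = ?B n (basis j)"
          using w by (auto simp: \<phi> shift_basis blinfun.bilinear_simps sections_T_basis adj_sections_T_basis)
      qed (auto simp: \<phi> sections_def)
    qed
    fix h n assume hn: "k \<le> h \<and> h + k \<le> n"
    have "proj (N ^ h) o\<^sub>L \<phi> n o\<^sub>L proj (N ^ h) = sections \<eta> (shift0 a v b w) h"
    proof (rule clin_eqI)
      fix j
      have "h \<le> n - k" using hn by linarith
      then have "j < N ^ h \<Longrightarrow> j div N ^ b < N ^ (n - k)"
        using less_pow_mono[of "j div N ^ b" h "n - k"] div_le_dividend[of j "N ^ b"] by linarith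
      then show "(proj (N ^ h) o\<^sub>L \<phi> n o\<^sub>L proj (N ^ h)) (basis j) = sections \<eta> (shift0 a v b w) h (basis j)"
        using w by (auto simp: \<phi> shift_basis sections_basis blinfun.zero_right)
    qed (auto simp: \<phi> sections_def)
    then show "proj (N ^ h) o\<^sub>L \<phi> n o\<^sub>L proj (N ^ h) = shift ?l a v b w h"
      using sections_shift0[of v a w b h] w hn by simp
  qed
next
  case zero
  show ?case
    unfolding untruncates_def
    by (rule exI[of _ "\<lambda>_. 0"]) (auto simp: compose_simps intro!: bexI[of _ "\<lambda>_. 0"] ideal_zero[OF J(1)])
next
  case (add \<phi> \<psi>)
  then obtain \<phi>\<^sub>0 B k \<psi>\<^sub>0 C l where 1: "untruncates J \<phi> \<phi>\<^sub>0 k" "B \<in> J" "\<forall>\<^sub>F n in sequentially. \<phi> n - \<phi>\<^sub>0 n = B n"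
    and 2: "untruncates J \<psi> \<psi>\<^sub>0 l" "C \<in> J" "\<forall>\<^sub>F n in sequentially. \<psi> n - \<psi>\<^sub>0 n = C n"
    unfolding untruncates_def by blast
  show ?case
    unfolding untruncates_def
  proof (intro exI conjI allI impI bexI)
    show "(\<lambda>n. B n + C n) \<in> J" by (rule ideal_add[OF J(1) 1(2) 2(2)])
    show "\<forall>\<^sub>F n in sequentially. (\<phi> n + \<psi> n) - (\<phi>\<^sub>0 n + \<psi>\<^sub>0 n) = B n + C n"
      using 1(3) 2(3) by eventually_elim (simp add: algebra_simps)
    fix h n assume "max k l \<le> h \<and> h + max k l \<le> n"
    then have "k \<le> h \<and> h + k \<le> n" "l \<le> h \<and> h + l \<le> n" by auto
    then show "proj (N ^ h) o\<^sub>L (\<phi> n + \<psi> n) o\<^sub>L proj (N ^ h) = \<phi>\<^sub>0 h + \<psi>\<^sub>0 h"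
      using 1(1) 2(1) unfolding untruncates_def by (simp add: compose_simps)
  qed
next
  case (scale \<phi> c)
  then obtain \<phi>\<^sub>0 B k where 1: "untruncates J \<phi> \<phi>\<^sub>0 k" "B \<in> J" "\<forall>\<^sub>F n in sequentially. \<phi> n - \<phi>\<^sub>0 n = B n"
    unfolding untruncates_def by blast
  show ?case
    unfolding untruncates_def
  proof (intro exI conjI allI impI bexI)
    show "(\<lambda>n. scaleC_op c o\<^sub>L B n) \<in> J" by (rule ideal_scale[OF J(1) 1(2)])
    show "\<forall>\<^sub>F n in sequentially. (scaleC_op c o\<^sub>L \<phi> n) - (scaleC_op c o\<^sub>L \<phi>\<^sub>0 n) = scaleC_op c o\<^sub>L B n"
      using 1(3) by eventually_elim (simp flip: compose_simps)
    fix h n assume "k \<le> h \<and> h + k \<le> n"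
    then have "scaleC_op c o\<^sub>L \<phi>\<^sub>0 h = scaleC_op c o\<^sub>L (proj (N ^ h) o\<^sub>L \<phi> n o\<^sub>L proj (N ^ h))"
      using 1(1) unfolding untruncates_def by simp
    then show "proj (N ^ h) o\<^sub>L (scaleC_op c o\<^sub>L \<phi> n) o\<^sub>L proj (N ^ h) = scaleC_op c o\<^sub>L \<phi>\<^sub>0 h"
      by (metis clin_intros(3) compose_assoc scaleC_op_commute)
  qed
qed

lemma ideal_above_top_band:
  assumes J: "section_ideal J" "top_band \<in> J" and K: "section_ideal K" "J \<subseteq> K" and A: "A \<in> K" "A \<notin> J"
  shows "K = S"
proof -
  have AS: "A \<in> S" using ideal_S[OF K(1) A(1)] .
  \<comment> \<open>\<open>e\<close> bounds the distance from \<open>A\<close> to \<open>J\<close>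
    from below, and does so up to finitely many levels.\<close>
  obtain e where e: "e > 0" "\<And>B. B \<in> J \<Longrightarrow> \<not> (\<forall>\<^sub>F n in sequentially. norm (B n - A n) \<le> e)"
    using ideal_limit[OF J(1) AS] A(2) by blast
  define \<kappa> where "\<kappa> = e / 3"
  have \<kappa>: "\<kappa> > 0" using e by (simp add: \<kappa>_def)
  obtain \<phi> where \<phi>: "\<phi> \<in> poly" "\<forall>\<^sub>F n in sequentially. norm (A n - \<phi> n) \<le> \<kappa> / 4"
    using approxE[OF S_approx[OF AS], of "\<kappa> / 4"] \<kappa> by auto
  obtain h\<^sub>0 where h0: "\<And>h. h \<ge> h\<^sub>0 \<Longrightarrow> \<exists>\<delta>>0. large_columns A \<phi> \<kappa> h \<delta>"
    using column_lower_bound[OF \<phi>(1) \<kappa> \<phi>(2) S_clin[OF AS]] by blast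
  obtain \<phi>\<^sub>0 B\<^sub>0 k where un: "B\<^sub>0 \<in> J" "\<forall>\<^sub>F n in sequentially. \<phi> n - \<phi>\<^sub>0 n = B\<^sub>0 n" "untruncates J \<phi> \<phi>\<^sub>0 k"
    using poly_untruncate[OF J \<phi>(1)] unfolding untruncates_def by blast
  \<comment> \<open>If \<open>\<phi>\<^sub>0\<close> were small, then \<open>B\<^sub>0\<close>,
    which is eventually \<open>\<phi> - \<phi>\<^sub>0\<close>, would be an element of
    \<open>J\<close> too close to \<open>A\<close>.\<close>
  have "\<not> (\<forall>\<^sub>F n in sequentially. norm (\<phi>\<^sub>0 n) \<le> 2 * \<kappa>)"
  proof
    assume "\<forall>\<^sub>F n in sequentially. norm (\<phi>\<^sub>0 n) \<le> 2 * \<kappa>"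
    then have "\<forall>\<^sub>F n in sequentially. norm (B\<^sub>0 n - A n) \<le> e"
      using \<phi>(2) un(2)
    proof eventually_elim
      case (elim n)
      have "B\<^sub>0 n - A n = - (A n - \<phi> n) - \<phi>\<^sub>0 n" by (simp flip: elim(3))
      also have "norm \<dots> \<le> \<kappa> / 4 + 2 * \<kappa>"
        using norm_triangle_ineq4[of "- (A n - \<phi> n)" "\<phi>\<^sub>0 n"] elim by (simp only: norm_minus_cancel)
      also have "\<dots> \<le> e" using e by (simp add: \<kappa>_def)
      finally show ?case .
    qed
    then show False using e un(1) by blast
  qed
  then obtain h where h: "h \<ge> max h\<^sub>0 k" "2 * \<kappa> < norm (\<phi>\<^sub>0 h)"
    unfolding eventually_sequentially by (meson not_le)
  have \<phi>0: "proj (N ^ h) o\<^sub>L \<phi> n o\<^sub>L proj (N ^ h) = \<phi>\<^sub>0 h" if "n \<ge> h + k" for n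
    using un(3) that h unfolding untruncates_def by auto
  have "\<phi>\<^sub>0 h o\<^sub>L proj (N ^ h) = \<phi>\<^sub>0 h"
    by (metis \<phi>0 compose_assoc min.idem order_refl proj_proj)
  then obtain x where x: "x \<noteq> 0" "proj (N ^ h) x = x" "2 * \<kappa> * norm x < norm (\<phi>\<^sub>0 h x)"
    using norm_gt_witness[of "2 * \<kappa>" "\<phi>\<^sub>0 h" "N ^ h"] h \<kappa> by auto
  \<comment> \<open>The corner of size \<open>N ^ h\<close> stays fixed while \<open>n\<close>
    grows, so the same \<open>x\<close> witnesses a large norm of \<open>\<phi> n\<close> at every
    level \<open>n \<ge> h + k\<close>. This is the gain from removing the truncations.\<close>
  have \<phi>x: "\<kappa> * norm x \<le> norm (\<phi> n x)" if "n \<ge> h + k" for n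
  proof -
    have "\<phi>\<^sub>0 h x = proj (N ^ h) (\<phi> n x)"
      using x(2) by (simp flip: \<phi>0[OF that])
    then have "norm (\<phi>\<^sub>0 h x) \<le> norm (\<phi> n x)"
      by (simp add: norm_contraction norm_proj_le)
    moreover have "\<kappa> * norm x > 0" using \<kappa> x by simp
    ultimately show ?thesis using x(3) by simp
  qed
  obtain \<delta> where \<delta>: "\<delta> > 0" "large_columns A \<phi> \<kappa> h \<delta>" using h0[of h] h by auto
  have col: "\<forall>\<^sub>F m in sequentially. \<forall>n\<ge>h + k.
      \<exists>j. N ^ (m - 1) \<le> j \<and> j < N ^ (h + m) \<and> \<delta> \<le> norm (A (n + m) (basis j))"
    using \<delta>(2) unfolding large_columns_def
    by (rule eventually_mono) (use x \<phi>x in \<open>meson le_add1 order_trans\<close>)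
  let ?B = "\<lambda>n. adj (A n) o\<^sub>L A n"
  have B: "?B \<in> K" by (intro ideal_left[OF K(1) A(1)] S_closed(4) AS)
  obtain \<psi> where \<psi>: "\<psi> \<in> poly" "\<forall>\<^sub>F n in sequentially. norm (?B n - \<psi> n) \<le> \<delta>\<^sup>2 / 16"
    using approxE[OF S_approx[OF ideal_S[OF K(1) B]], of "\<delta>\<^sup>2 / 16"] \<delta>(1) by auto
  obtain r where r: "\<And>w. w < N ^ r \<Longrightarrow> \<exists>\<alpha>. marked_scalar \<psi> r w \<alpha>"
    using poly_marked_scalar[OF \<psi>(1)] by blast
  \<comment> \<open>The bound \<open>j < N ^ (h + m)\<close> is unaffected by the additional
    \<open>k + r\<close> digits of the level, so \<open>j\<close> has at least \<open>r\<close>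
    leading zeros there.\<close>
  let ?n = "\<lambda>m. h + k + r + m"
  obtain m where m: "m \<ge> 3 * r + 1" "norm (?B (?n m) - \<psi> (?n m)) \<le> \<delta>\<^sup>2 / 16"
    "\<forall>n\<ge>h + k. \<exists>j. N ^ (m - 1) \<le> j \<and> j < N ^ (h + m) \<and> \<delta> \<le> norm (A (n + m) (basis j))"
    by (rule eventually_witness[OF \<psi>(2) col])
  obtain j where j: "N ^ (m - 1) \<le> j" "j < N ^ (h + m)" "\<delta> \<le> norm (A (?n m) (basis j))"
    using m(3)[rule_format, of "h + k + r"] by auto
  define w where "w = j mod N ^ r"
  have w: "w < N ^ r" by (simp add: w_def)
  obtain \<alpha> where \<alpha>\<^sub>0: "marked_scalar \<psi> r w \<alpha>" using r[OF w] by blast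
  have \<alpha>: "n \<ge> 3 * r + 1 \<Longrightarrow> z < N ^ (n - (3 * r + 1)) \<Longrightarrow> z' < N ^ (n - (3 * r + 1)) \<Longrightarrow>
      coord (\<psi> n (basis (z * N ^ (2 * r + 1) + (N ^ r + w)))) (z' * N ^ (2 * r + 1) + (N ^ r + w)) = (if z = z' then \<alpha> else 0)"
    and \<alpha>': "n \<ge> 3 * r + 1 \<Longrightarrow> N ^ r \<le> j \<Longrightarrow> j < N ^ (n - r) \<Longrightarrow> j mod N ^ r = w \<Longrightarrow> coord (\<psi> n (basis j)) j = \<alpha>"
    for n z z' j using \<alpha>\<^sub>0 unfolding marked_scalar_def by blast+
  have "N ^ r \<le> N ^ (m - 1)" "N ^ (h + m) \<le> N ^ (?n m - r)" using m(1) by auto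
  then have "N ^ r \<le> j" "j < N ^ (?n m - r)" using j by linarith+
  then have "coord (\<psi> (?n m) (basis j)) j = \<alpha>"
    using m(1) by (intro \<alpha>') (simp_all add: w_def)
  then have a: "15 * (\<delta>\<^sup>2 / 16) \<le> cmod \<alpha>"
    using column_square[OF S_clin[OF AS] m(2) j(3) \<delta>(1)] by simp
  \<comment> \<open>The marked suffix takes \<open>2 * r + 1\<close> digits, and at least
    \<open>r\<close> leading zeros remain after it is appended.\<close>
  let ?P = "\<lambda>n. proj (N ^ (n - (3 * r + 1)))"
  have u: "N ^ r + w < N ^ (2 * r + 1)" by (rule marker_less[OF w]) simp
  have "?P \<in> K"
  proof (rule ideal_compression[OF K(1) B \<psi>(2) a _ u proj_S])
    show "norm (?P n) \<le> 2" for n by (rule order_trans[OF norm_proj_le]) simp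
    let ?Z = "\<lambda>n. {z. z < N ^ (n - (3 * r + 1))}"
    show "\<forall>\<^sub>F n in sequentially. sections \<eta> (T (2 * r + 1) (N ^ r + w)) n o\<^sub>L ?P n = T (2 * r + 1) (N ^ r + w) o\<^sub>L ?P n"
      using eventually_ge_at_top[of "2 * r + 1"]
    proof eventually_elim
      case (elim n)
      have "z < N ^ (n - (2 * r + 1))" if "z \<in> ?Z n" for z
        by (rule less_pow_mono[of _ "n - (3 * r + 1)"]) (use that in auto)
      then show ?case by (intro sections_T_proj[OF u elim, where Z = "?Z n"]) auto
    qed
    show "\<forall>\<^sub>F n in sequentially. adj (T (2 * r + 1) (N ^ r + w) o\<^sub>L ?P n) o\<^sub>L \<psi> n o\<^sub>L (T (2 * r + 1) (N ^ r + w) o\<^sub>L ?P n) =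
        scaleC_op \<alpha> o\<^sub>L ?P n"
      using eventually_ge_at_top[of "3 * r + 1"]
    proof eventually_elim
      case (elim n)
      show ?case
      proof (rule compress_scalar[OF u, where Z = "?Z n"])
        show "clin (\<psi> n)" using star_algebra_germs.lin[OF star_algebra_germs_shifts \<psi>(1)] .
        fix z z' assume z: "z \<in> ?Z n" "z' \<in> ?Z n"
        then show "coord (\<psi> n (basis (z * N ^ (2 * r + 1) + (N ^ r + w)))) (z' * N ^ (2 * r + 1) + (N ^ r + w)) = (if z = z' then \<alpha> else 0)"
          using \<alpha>[OF elim] by auto
      qed auto
    qed
  qed (use \<delta>(1) in auto)
  moreover have "(\<lambda>n. proj (N ^ n) - ?P n) \<in> K" using ideal_tail[OF J] K(2) by blast
  ultimately have "(\<lambda>n. ?P n + (proj (N ^ n) - ?P n)) \<in> K" by (rule ideal_add[OF K(1)])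
  then have one: "(\<lambda>n. proj (N ^ n)) \<in> K" by simp
  have "X \<in> K" if "X \<in> S" for X
    using ideal_right[OF K(1) one that] F_memD(2)[OF S_F[OF that]] by simp
  then show ?thesis using ideal_S[OF K(1)] by blast
qed

subsection \<open>Sequences that converge strongly to zero\<close>

text \<open>The sequences with strong limit 0; by boundedness it is enough to test basis vectors.
  This section ideal contains \<open>top_band\<close> but not the unit, so it separates the ideal
  generated by \<open>top_band\<close> from \<open>S\<close>.\<close>

definition strong_null :: "op_seq set" where
  "strong_null = {A \<in> S. \<forall>j. (\<lambda>n. A n (basis j)) \<longlonglongrightarrow> 0}"

text \<open>This prepares the harder half of the ideal property, multiplication on the right:
  \<open>B n (basis j)\<close> moves with \<open>n\<close>, but a polynomial that approximates
  \<open>B\<close> sends \<open>basis j\<close> to one vector \<open>y\<close> from some level on,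
  and \<open>A n y\<close> tends to 0.\<close>

lemma poly_eventually_const:
  assumes "\<phi> \<in> poly" "A \<in> strong_null"
  shows "\<exists>y. (\<forall>\<^sub>F n in sequentially. \<phi> n (basis j) = y) \<and> (\<lambda>n. A n y) \<longlonglongrightarrow> 0"
  using assms(1)
proof induction
  case (gen \<phi>)
  then obtain k a v b w where \<phi>: "\<phi> = shift k a v b w" and w: "v < N ^ a" "w < N ^ b"
    by (auto simp: shifts_def)
  let ?y = "if j mod N ^ b = w then basis ((j div N ^ b) * N ^ a + v) else 0"
  have "\<forall>\<^sub>F n in sequentially. \<phi> n (basis j) = ?y"
    using eventually_ge_at_top[of "k + j"]
  proof eventually_elim
    case (elim n)
    have "N ^ j \<le> N ^ (n - k)" using elim by simp
    then have "j div N ^ b < N ^ (n - k)" using less_pow[of j] div_le_dividend[of j "N ^ b"] by linarith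
    then show ?case using w by (simp add: \<phi> shift_basis)
  qed
  moreover have "(\<lambda>n. A n ?y) \<longlonglongrightarrow> 0"
    using assms(2) by (auto simp: strong_null_def blinfun.zero_right)
  ultimately show ?case by blast
next
  case zero
  then show ?case by (intro exI[of _ 0]) (simp add: blinfun.zero_right blinfun.zero_left)
next
  case (add \<phi> \<psi>)
  then obtain y z where y: "\<forall>\<^sub>F n in sequentially. \<phi> n (basis j) = y" "(\<lambda>n. A n y) \<longlonglongrightarrow> 0"
    and z: "\<forall>\<^sub>F n in sequentially. \<psi> n (basis j) = z" "(\<lambda>n. A n z) \<longlonglongrightarrow> 0" by blast
  have "\<forall>\<^sub>F n in sequentially. (\<phi> n + \<psi> n) (basis j) = y + z"
    using y(1) z(1) by eventually_elim (simp add: blinfun.add_left)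
  moreover have "(\<lambda>n. A n (y + z)) \<longlonglongrightarrow> 0"
    using tendsto_add[OF y(2) z(2)] by (simp add: blinfun.add_right)
  ultimately show ?case by blast
next
  case (scale \<phi> c)
  then obtain y where y: "\<forall>\<^sub>F n in sequentially. \<phi> n (basis j) = y" "(\<lambda>n. A n y) \<longlonglongrightarrow> 0" by blast
  have "\<forall>\<^sub>F n in sequentially. (scaleC_op c o\<^sub>L \<phi> n) (basis j) = c *\<^sub>C y"
    using y(1) by eventually_elim simp
  moreover have "(\<lambda>n. A n (c *\<^sub>C y)) \<longlonglongrightarrow> 0"
  proof -
    have "clin (A n)" for n using assms(2) S_clin by (auto simp: strong_null_def)
    then have "(\<lambda>n. norm (A n (c *\<^sub>C y))) \<longlonglongrightarrow> 0"
      using tendsto_mult_right_zero[OF tendsto_norm_zero[OF y(2)], of "cmod c"] by (simp add: clin_scaleC)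
    then show ?thesis by (rule tendsto_norm_zero_cancel)
  qed
  ultimately show ?case by blast
qed

lemma tendsto_zero_epsilon:
  fixes f :: "nat \<Rightarrow> 'b :: real_normed_vector"
  assumes "\<And>\<epsilon>. \<epsilon> > 0 \<Longrightarrow> \<exists>g. g \<longlonglongrightarrow> 0 \<and> (\<forall>\<^sub>F n in sequentially. norm (f n) \<le> \<epsilon> + norm (g n :: 'b))"
  shows "f \<longlonglongrightarrow> 0"
proof (rule tendstoI)
  fix \<epsilon> :: real assume "\<epsilon> > 0"
  then have "\<epsilon>/2 > 0" by simp
  from assms[OF this] obtain g :: "nat \<Rightarrow> 'b" where
    g: "g \<longlonglongrightarrow> 0" "\<forall>\<^sub>F n in sequentially. norm (f n) \<le> \<epsilon>/2 + norm (g n)" by blast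
  have "\<forall>\<^sub>F n in sequentially. norm (g n) < \<epsilon>/2"
    using tendstoD[OF g(1), of "\<epsilon>/2"] \<open>\<epsilon> > 0\<close> by simp
  then show "\<forall>\<^sub>F n in sequentially. dist (f n) 0 < \<epsilon>"
    using g(2) by eventually_elim simp
qed

lemma section_ideal_strong_null: "section_ideal strong_null"
  unfolding section_ideal_def
proof (intro conjI ballI allI impI)
  show "strong_null \<subseteq> S" by (auto simp: strong_null_def)
  show "G \<subseteq> strong_null"
  proof
    fix A assume A: "A \<in> G"
    have "(\<lambda>n. A n (basis j)) \<longlonglongrightarrow> 0" for j
    proof (rule Lim_null_comparison)
      show "(\<lambda>n. norm (A n)) \<longlonglongrightarrow> 0" using A by (simp add: G_iff)
      show "\<forall>\<^sub>F n in sequentially. norm (A n (basis j)) \<le> norm (A n)"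
        using norm_blinfun[of "A _" "basis j"] by simp
    qed
    then show "A \<in> strong_null" using A G_S by (auto simp: strong_null_def)
  qed
next
  fix A B assume "A \<in> strong_null" "B \<in> strong_null"
  then show "(\<lambda>n. A n + B n) \<in> strong_null"
    unfolding strong_null_def by (auto intro: S_closed tendsto_add_zero simp: blinfun.add_left)
next
  fix A B assume A: "A \<in> strong_null" and B: "B \<in> S"
  then have AS: "A \<in> S" by (simp add: strong_null_def)
  obtain a where a: "a > 0" "\<And>n. norm (A n) \<le> a" using F_bound[OF S_F[OF AS]] by blast
  obtain b where b: "b > 0" "\<And>n. norm (B n) \<le> b" using F_bound[OF S_F[OF B]] by blast
  have "(\<lambda>n. (B n o\<^sub>L A n) (basis j)) \<longlonglongrightarrow> 0" for j
  proof (rule Lim_null_comparison)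
    show "(\<lambda>n. b * norm (A n (basis j))) \<longlonglongrightarrow> 0"
      using A by (intro tendsto_mult_right_zero tendsto_norm_zero) (simp add: strong_null_def)
    show "\<forall>\<^sub>F n in sequentially. norm ((B n o\<^sub>L A n) (basis j)) \<le> b * norm (A n (basis j))"
      using order_trans[OF norm_blinfun mult_right_mono[OF b(2) norm_ge_zero]] by simp
  qed
  then show "(\<lambda>n. B n o\<^sub>L A n) \<in> strong_null" using AS B by (simp add: strong_null_def S_closed)
  have "(\<lambda>n. (A n o\<^sub>L B n) (basis j)) \<longlonglongrightarrow> 0" for j
  proof (rule tendsto_zero_epsilon)
    fix \<epsilon> :: real assume "\<epsilon> > 0"
    then obtain \<phi> where \<phi>: "\<phi> \<in> poly" "\<forall>\<^sub>F n in sequentially. norm (B n - \<phi> n) \<le> \<epsilon> / a"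
      using approxE[OF S_approx[OF B], of "\<epsilon> / a"] a by auto
    obtain y where y: "\<forall>\<^sub>F n in sequentially. \<phi> n (basis j) = y" "(\<lambda>n. A n y) \<longlonglongrightarrow> 0"
      using poly_eventually_const[OF \<phi>(1) A] by blast
    have "\<forall>\<^sub>F n in sequentially. norm ((A n o\<^sub>L B n) (basis j)) \<le> \<epsilon> + norm (A n y)"
      using \<phi>(2) y(1)
    proof eventually_elim
      case (elim n)
      have "norm ((A n o\<^sub>L (B n - \<phi> n)) (basis j)) \<le> norm (A n o\<^sub>L (B n - \<phi> n)) * norm (basis j)"
        by (rule norm_blinfun)
      also have "\<dots> \<le> a * (\<epsilon> / a)" using norm_compose_le[OF a(2) elim(1)] by simp
      also have "\<dots> = \<epsilon>" using a(1) by simp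
      finally have 1: "norm ((A n o\<^sub>L (B n - \<phi> n)) (basis j)) \<le> \<epsilon>" .
      have "(A n o\<^sub>L B n) (basis j) = (A n o\<^sub>L (B n - \<phi> n)) (basis j) + A n y"
        using elim(2) by (simp add: blinfun.bilinear_simps)
      then show ?case using norm_triangle_mono[OF 1 order_refl] by simp
    qed
    then show "\<exists>g. g \<longlonglongrightarrow> 0 \<and> (\<forall>\<^sub>F n in sequentially. norm ((A n o\<^sub>L B n) (basis j)) \<le> \<epsilon> + norm (g n :: ell2))"
      using y(2) by blast
  qed
  then show "(\<lambda>n. A n o\<^sub>L B n) \<in> strong_null" using AS B by (simp add: strong_null_def S_closed)
next
  fix A assume A: "A \<in> S" and lim: "\<forall>\<epsilon>>0. \<exists>B\<in>strong_null. \<forall>n. norm (B n - A n) \<le> \<epsilon>"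
  have "(\<lambda>n. A n (basis j)) \<longlonglongrightarrow> 0" for j
  proof (rule tendsto_zero_epsilon)
    fix \<epsilon> :: real assume "\<epsilon> > 0"
    then obtain B where B: "B \<in> strong_null" "\<And>n. norm (B n - A n) \<le> \<epsilon>" using lim by blast
    have "norm (A n (basis j)) \<le> \<epsilon> + norm (B n (basis j))" for n
    proof -
      have "norm ((B n - A n) (basis j)) \<le> \<epsilon>"
        using norm_blinfun[of "B n - A n" "basis j"] B(2)[of n] by simp
      then show ?thesis
        using norm_triangle_ineq4[of "B n (basis j)" "(B n - A n) (basis j)"] by (simp add: blinfun.diff_left)
    qed
    then show "\<exists>g. g \<longlonglongrightarrow> 0 \<and> (\<forall>\<^sub>F n in sequentially. norm (A n (basis j)) \<le> \<epsilon> + norm (g n :: ell2))"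
      using B(1) by (intro exI[of _ "\<lambda>n. B n (basis j)"]) (auto simp: strong_null_def)
  qed
  then show "A \<in> strong_null" using A by (simp add: strong_null_def)
qed

lemma top_band_strong_null: "top_band \<in> strong_null"
proof -
  have "(\<lambda>n. top_band n (basis j)) \<longlonglongrightarrow> 0" for j
  proof (rule tendsto_eventually)
    show "\<forall>\<^sub>F n in sequentially. top_band n (basis j) = 0"
      using eventually_ge_at_top[of "Suc j"]
    proof eventually_elim
      case (elim n)
      have "N ^ j \<le> N ^ (n - Suc 0)" using elim by simp
      then have "j < N ^ (n - Suc 0)" using less_pow[of j] by linarith
      then show ?case by (simp add: band_0[symmetric] band_basis)
    qed
  qed
  then show ?thesis using band_S[of 0] by (simp add: strong_null_def band_0)
qed

lemma one_not_strong_null: "(\<lambda>n. proj (N ^ n)) \<notin> strong_null"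
proof
  assume "(\<lambda>n. proj (N ^ n)) \<in> strong_null"
  then have "(\<lambda>n. proj (N ^ n) (basis 0)) \<longlonglongrightarrow> 0" by (simp only: strong_null_def mem_Collect_eq)
  then have "(\<lambda>n. basis 0) \<longlonglongrightarrow> 0" by simp
  then have "basis 0 = 0" by (rule LIMSEQ_unique[OF tendsto_const])
  then show False by (metis norm_basis norm_zero zero_neq_one)
qed

lemma top_band_not_G: "top_band \<notin> G"
proof
  assume "top_band \<in> G"
  then have "(\<lambda>n. norm (top_band n)) \<longlonglongrightarrow> 0" by (simp add: G_iff)
  then have "\<forall>\<^sub>F n in sequentially. norm (top_band n) < 1" by (rule order_tendstoD) simp
  then obtain n where n: "norm (top_band (Suc n)) < 1"
    unfolding eventually_sequentially by (meson le_Suc_eq order_refl)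
  have "top_band (Suc n) (basis (N ^ n)) = basis (N ^ n)"
    using N2 by (simp add: band_0[symmetric] band_basis)
  then have "norm (basis (N ^ n)) \<le> norm (top_band (Suc n)) * norm (basis (N ^ n))"
    by (metis norm_blinfun)
  then show False using n by simp
qed

subsection \<open>Passing to the quotient\<close>

lemma S_eta_simps [simp]:
  "mult (S_eta N) = (\<lambda>A B n. A n o\<^sub>L B n)" "one (S_eta N) = (\<lambda>n. proj (N ^ n))"
  "zero (S_eta N) = (\<lambda>n. 0)" "add (S_eta N) = (\<lambda>A B n. A n + B n)"
  "star (S_eta N) = (\<lambda>A n. adj (A n))" "nrm (S_eta N) = (\<lambda>A. SUP n. norm (A n))"
  by (simp_all add: S_eta_def section_algebra_def)

lemma ring_S_eta: "ring (S_eta N)"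
proof (rule ringI)
  show "abelian_group (S_eta N)"
  proof (rule abelian_groupI)
    fix A assume "A \<in> S"
    then show "\<exists>B\<in>S. B \<oplus>\<^bsub>S_eta N\<^esub> A = \<zero>\<^bsub>S_eta N\<^esub>"
      by (intro bexI[of _ "\<lambda>n. - A n"]) (auto intro: S_uminus)
  qed (auto intro: S_closed simp: add.assoc add.commute)
  show "monoid (S_eta N)"
    by (rule monoidI) (auto intro: S_closed one_S simp: compose_assoc F_memD[OF S_F])
qed (auto simp: compose_simps)

lemma G_section_ideal: "section_ideal G"
  unfolding section_ideal_def
proof (intro conjI ballI allI impI)
  fix A B assume "A \<in> G" "B \<in> G"
  then have A: "A \<in> carrier (F_alg \<eta>)" "(\<lambda>n. norm (A n)) \<longlonglongrightarrow> 0"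
    and B: "B \<in> carrier (F_alg \<eta>)" "(\<lambda>n. norm (B n)) \<longlonglongrightarrow> 0" by (auto simp: G_iff)
  have "(\<lambda>n. norm (A n + B n)) \<longlonglongrightarrow> 0"
    using tendsto_add_zero[OF A(2) B(2)]
    by (rule Lim_null_comparison[rotated]) (simp add: norm_triangle_ineq)
  then show "(\<lambda>n. A n + B n) \<in> G" using A B by (simp add: G_iff F_closed2)
next
  fix A B assume "A \<in> G" and B: "B \<in> S"
  then have A: "A \<in> carrier (F_alg \<eta>)" "(\<lambda>n. norm (A n)) \<longlonglongrightarrow> 0" by (auto simp: G_iff)
  obtain b where b: "b > 0" "\<And>n. norm (B n) \<le> b" using F_bound[OF S_F[OF B]] by blast
  have "(\<lambda>n. norm (A n o\<^sub>L B n)) \<longlonglongrightarrow> 0"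
    using tendsto_mult_left_zero[OF A(2), of b]
    by (rule Lim_null_comparison[rotated]) (auto intro!: always_eventually norm_compose_le b(2))
  then show "(\<lambda>n. A n o\<^sub>L B n) \<in> G" using A B by (simp add: G_iff F_closed2 S_F)
  have "(\<lambda>n. norm (B n o\<^sub>L A n)) \<longlonglongrightarrow> 0"
    using tendsto_mult_right_zero[OF A(2), of b]
    by (rule Lim_null_comparison[rotated]) (auto intro!: always_eventually norm_compose_le b(2))
  then show "(\<lambda>n. B n o\<^sub>L A n) \<in> G" using A B by (simp add: G_iff F_closed2 S_F)
next
  fix A assume A: "A \<in> S" and lim: "\<forall>\<epsilon>>0. \<exists>B\<in>G. \<forall>n. norm (B n - A n) \<le> \<epsilon>"
  have "A \<longlonglongrightarrow> 0"
  proof (rule tendsto_zero_epsilon)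
    fix \<epsilon> :: real assume "\<epsilon> > 0"
    then obtain B where B: "B \<in> G" "\<And>n. norm (B n - A n) \<le> \<epsilon>" using lim by blast
    have "norm (A n) \<le> \<epsilon> + norm (B n)" for n
      using norm_triangle_sub[of "A n" "B n"] B(2)[of n] by (simp add: norm_minus_commute)
    moreover have "B \<longlonglongrightarrow> 0" using B(1) by (simp add: G_iff tendsto_norm_zero_iff)
    ultimately show "\<exists>g. g \<longlonglongrightarrow> 0 \<and> (\<forall>\<^sub>F n in sequentially. norm (A n) \<le> \<epsilon> + norm (g n :: ell2 \<Rightarrow>\<^sub>L ell2))"
      by (intro exI[of _ B]) (simp add: always_eventually)
  qed
  then show "A \<in> G" using S_F[OF A] by (simp add: G_iff tendsto_norm_zero_iff)
qed (auto simp: G_S)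

lemma ideal_G_S_eta: "ideal G (S_eta N)"
proof (rule idealI[OF ring_S_eta])
  interpret ring "S_eta N" by (rule ring_S_eta)
  show "subgroup G (add_monoid (S_eta N))"
  proof (rule add.subgroupI)
    fix A assume A: "A \<in> G"
    then have "\<ominus>\<^bsub>S_eta N\<^esub> A = (\<lambda>n. - A n)"
      using G_S by (intro minus_equality) (auto intro: S_uminus)
    then show "\<ominus>\<^bsub>S_eta N\<^esub> A \<in> G" using ideal_uminus[OF G_section_ideal A] by simp
  qed (use G_S ideal_zero[OF G_section_ideal] ideal_add[OF G_section_ideal] in auto)
qed (use ideal_left[OF G_section_ideal] ideal_right[OF G_section_ideal] in auto)

abbreviation cls :: "op_seq \<Rightarrow> op_seq set" where
  "cls A \<equiv> G +>\<^bsub>S_eta N\<^esub> A"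

lemma cls_eq: "cls A = (\<lambda>g n. g n + A n) ` G"
  by (auto simp: a_r_coset_def r_coset_def)

lemma cls_self: "A \<in> cls A"
  unfolding cls_eq using ideal_zero[OF G_section_ideal] by (intro image_eqI[of _ _ "\<lambda>n. 0"]) auto

lemma cls_eq_iff: "cls A = cls B \<longleftrightarrow> (\<lambda>n. A n - B n) \<in> G"
proof
  assume "cls A = cls B"
  then have "A \<in> cls B" using cls_self by blast
  then show "(\<lambda>n. A n - B n) \<in> G" by (auto simp: cls_eq)
next
  assume D: "(\<lambda>n. A n - B n) \<in> G"
  have "cls X \<subseteq> cls Y" if d: "(\<lambda>n. X n - Y n) \<in> G" for X Y
  proof
    fix Z assume "Z \<in> cls X"
    then obtain g where g: "g \<in> G" "Z = (\<lambda>n. g n + X n)" by (auto simp: cls_eq)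
    have "(\<lambda>n. g n + (X n - Y n)) \<in> G" by (rule ideal_add[OF G_section_ideal g(1) d])
    then show "Z \<in> cls Y" unfolding cls_eq g(2) by (rule image_eqI[rotated]) auto
  qed
  moreover have "(\<lambda>n. B n - A n) \<in> G" using ideal_uminus[OF G_section_ideal D] by simp
  ultimately show "cls A = cls B" using D by blast
qed

abbreviation Q :: "op_seq set star_algebra" where "Q \<equiv> S_quot N"

lemma ring_Q: "ring Q"
  unfolding S_quot_def by (rule ring_quotient_algebra[OF ideal_G_S_eta])

lemma carrier_Q: "carrier Q = cls ` S"
  unfolding S_quot_def quotient_algebra_simps FactRing_simps by auto

lemma cls_hom:
  assumes "A \<in> S" "B \<in> S"
  shows "cls A \<oplus>\<^bsub>Q\<^esub> cls B = cls (\<lambda>n. A n + B n)" "cls A \<otimes>\<^bsub>Q\<^esub> cls B = cls (\<lambda>n. A n o\<^sub>L B n)"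
  using ring_hom_add[OF ideal.rcos_ring_hom[OF ideal_G_S_eta] assms]
    ring_hom_mult[OF ideal.rcos_ring_hom[OF ideal_G_S_eta] assms]
  by (simp_all add: S_quot_def)

lemma cls_zero: "\<zero>\<^bsub>Q\<^esub> = cls (\<lambda>n. 0)"
  by (simp add: S_quot_def FactRing_def cls_eq)

lemma cls_one: "\<one>\<^bsub>Q\<^esub> = cls (\<lambda>n. proj (N ^ n))"
  by (simp add: S_quot_def FactRing_def)

lemma cls_uminus: "A \<in> S \<Longrightarrow> \<ominus>\<^bsub>Q\<^esub> cls A = cls (\<lambda>n. - A n)"
proof -
  interpret Q: ring Q by (rule ring_Q)
  assume A: "A \<in> S"
  then show ?thesis
    by (intro Q.minus_equality) (auto simp: carrier_Q cls_hom S_uminus cls_zero)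
qed

lemma cls_diff: "A \<in> S \<Longrightarrow> B \<in> S \<Longrightarrow> cls A \<ominus>\<^bsub>Q\<^esub> cls B = cls (\<lambda>n. A n - B n)"
  by (simp add: a_minus_def cls_uminus cls_hom S_uminus)

lemma nrm_Q: "nrm Q X = (INF x\<in>X. SUP n. norm (x n))"
  by (simp add: S_quot_def)

lemma sup_norm:
  assumes "A \<in> S"
  shows "norm (A n) \<le> (SUP n. norm (A n))" "0 \<le> (SUP n. norm (A n))"
proof -
  show 1: "norm (A n) \<le> (SUP n. norm (A n))" for n
    using norm_le_nrm_F[OF S_F[OF assms]] by simp
  show "0 \<le> (SUP n. norm (A n))" using order_trans[OF norm_ge_zero 1] .
qed

lemma cls_S: "A \<in> S \<Longrightarrow> B \<in> cls A \<Longrightarrow> B \<in> S"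
  using G_S by (auto simp: cls_eq intro: S_closed)

lemma nrm_cls:
  assumes "A \<in> S"
  shows "0 \<le> nrm Q (cls A)" "nrm Q (cls A) \<le> (SUP n. norm (A n))"
    and "nrm Q (cls A) < \<epsilon> \<Longrightarrow> \<exists>B\<in>cls A. \<forall>n. norm (B n) \<le> \<epsilon>"
proof -
  have ne: "cls A \<noteq> {}" using cls_self by blast
  have nn: "0 \<le> (SUP n. norm (B n))" if "B \<in> cls A" for B
    using cls_S[OF assms that] sup_norm(2) by blast
  then have bd: "bdd_below ((\<lambda>x. SUP n. norm (x n)) ` cls A)" by (rule bdd_belowI2)
  show "0 \<le> nrm Q (cls A)" unfolding nrm_Q by (rule cINF_greatest[OF ne nn])
  show "nrm Q (cls A) \<le> (SUP n. norm (A n))" unfolding nrm_Q by (rule cINF_lower[OF bd cls_self])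
  assume "nrm Q (cls A) < \<epsilon>"
  then obtain B where B: "B \<in> cls A" "(SUP n. norm (B n)) < \<epsilon>"
    using cINF_less_iff[OF ne bd] unfolding nrm_Q by blast
  then have "norm (B n) \<le> \<epsilon>" for n
    using sup_norm(1)[OF cls_S[OF assms B(1)], of n] by linarith
  then show "\<exists>B\<in>cls A. \<forall>n. norm (B n) \<le> \<epsilon>" using B(1) by blast
qed

text \<open>The involution of the quotient is a union over all representatives. Adjoints of null
  sequences are null, so every representative contributes the same coset.\<close>

lemma star_cls:
  assumes A: "A \<in> S"
  shows "star Q (cls A) = cls (\<lambda>n. adj (A n))"
proof -
  have "cls (\<lambda>n. adj (B n)) = cls (\<lambda>n. adj (A n))" if B: "B \<in> cls A" for B
  proof -
    obtain g where g: "g \<in> G" "B = (\<lambda>n. g n + A n)" using B by (auto simp: cls_eq)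
    have gS: "clin (g n)" for n using g(1) G_S S_clin by blast
    have "(\<lambda>n. norm (adj (g n))) \<longlonglongrightarrow> 0"
      by (rule Lim_null_comparison[of _ "\<lambda>n. norm (g n)"]) (use g(1) gS in \<open>auto simp: G_iff norm_adj_le\<close>)
    then have "(\<lambda>n. adj (g n)) \<in> G" using g(1) by (auto simp: G_iff F_closed)
    then show ?thesis
      using gS S_clin[OF A] by (simp add: cls_eq_iff g(2) adj_add)
  qed
  moreover have "star Q (cls A) = (\<Union>B\<in>cls A. cls (\<lambda>n. adj (B n)))" by (simp add: S_quot_def)
  ultimately show ?thesis using cls_self[of A] by blast
qed

lemma one_minus_p1: "\<one>\<^bsub>Q\<^esub> \<ominus>\<^bsub>Q\<^esub> p1 N = cls top_band"
proof -
  let ?s = "sections \<eta> (T 1 0)"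
  have s: "?s \<in> S" by (rule sections_S[OF T_cuntz]) simp
  have "s_gen N 0 = cls ?s" by (simp add: s_gen_def T_def)
  then have "p1 N = cls (\<lambda>n. adj (?s n)) \<otimes>\<^bsub>Q\<^esub> cls ?s" using s by (simp add: p1_def star_cls)
  also have "\<dots> = cls (\<lambda>n. proj (N ^ (n - 1)))"
    using s by (simp add: cls_hom S_closed proj_eq_sections)
  finally have "p1 N = cls (\<lambda>n. proj (N ^ (n - 1)))" .
  then show ?thesis
    using one_S proj_S[of 1] by (simp add: cls_one cls_diff top_band_def[abs_def])
qed

lemma closed_ideal_preimage:
  assumes "closed_ideal I Q"
  defines "K \<equiv> {A \<in> S. cls A \<in> I}"
  shows "section_ideal K" "I = cls ` K"
proof -
  have id: "ideal I Q" and cl: "norm_closed_in I Q" using assms(1) by (auto simp: closed_ideal_def)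
  interpret I: ideal I Q by (rule id)
  have IQ: "I \<subseteq> cls ` S" using cl by (simp add: norm_closed_in_def carrier_Q)
  then show "I = cls ` K" by (auto simp: K_def)
  have clsQ: "cls A \<in> carrier Q" if "A \<in> S" for A using that by (auto simp: carrier_Q)
  show "section_ideal K"
    unfolding section_ideal_def
  proof (intro conjI ballI allI impI)
    show "G \<subseteq> K"
    proof
      fix A assume A: "A \<in> G"
      then have "cls A = \<zero>\<^bsub>Q\<^esub>" by (simp add: cls_zero cls_eq_iff)
      then show "A \<in> K" using A G_S I.zero_closed by (auto simp: K_def)
    qed
  next
    fix A B assume "A \<in> K" "B \<in> K"
    then show "(\<lambda>n. A n + B n) \<in> K"
      using additive_subgroup.a_closed[OF I.additive_subgroup_axioms, of "cls A" "cls B"] by (simp add: K_def cls_hom S_closed)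
  next
    fix A B assume "A \<in> K" "B \<in> S"
    then show "(\<lambda>n. A n o\<^sub>L B n) \<in> K" "(\<lambda>n. B n o\<^sub>L A n) \<in> K"
      using I.I_r_closed[of "cls A" "cls B"] I.I_l_closed[of "cls A" "cls B"] clsQ
      by (simp_all add: K_def cls_hom S_closed)
  next
    fix A assume A: "A \<in> S" and lim: "\<forall>\<epsilon>>0. \<exists>B\<in>K. \<forall>n. norm (B n - A n) \<le> \<epsilon>"
    have "\<exists>B. B \<in> K \<and> (\<forall>n. norm (B n - A n) \<le> inverse (real (Suc i)))" for i
      using lim[rule_format, of "inverse (real (Suc i))"] by auto
    then obtain f where f: "\<And>i. f i \<in> K" "\<And>i n. norm (f i n - A n) \<le> inverse (real (Suc i))"
      by metis
    have null: "(\<lambda>i. nrm Q (cls (f i) \<ominus>\<^bsub>Q\<^esub> cls A)) \<longlonglongrightarrow> 0"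
    proof (rule Lim_null_comparison[OF _ LIMSEQ_inverse_real_of_nat], rule always_eventually, rule allI)
      fix i
      have fS: "f i \<in> S" using f(1) by (simp add: K_def)
      let ?D = "\<lambda>n. f i n - A n"
      have DS: "?D \<in> S" by (rule S_diff[OF fS A])
      have "(SUP n. norm (?D n)) \<le> inverse (real (Suc i))" by (rule cSUP_least) (use f in auto)
      then have "0 \<le> nrm Q (cls ?D)" "nrm Q (cls ?D) \<le> inverse (real (Suc i))"
        using nrm_cls(1,2)[OF DS] by simp_all
      then show "norm (nrm Q (cls (f i) \<ominus>\<^bsub>Q\<^esub> cls A)) \<le> inverse (real (Suc i))"
        by (simp only: cls_diff[OF fS A] real_norm_def abs_of_nonneg)
    qed
    have fI: "\<forall>i. cls (f i) \<in> I" using f(1) by (simp add: K_def)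
    have closed: "a \<in> I" if "a \<in> carrier Q" "\<forall>n. g n \<in> I" "(\<lambda>n. nrm Q (g n \<ominus>\<^bsub>Q\<^esub> a)) \<longlonglongrightarrow> 0"
      for g :: "nat \<Rightarrow> op_seq set" and a
      using that cl unfolding norm_closed_in_def by blast
    have "cls A \<in> I" by (rule closed[OF clsQ[OF A] fI null])
    then show "A \<in> K" using A by (simp add: K_def)
  qed (auto simp: K_def)
qed

lemma cls_image_iff:
  assumes "section_ideal K" "A \<in> S"
  shows "cls A \<in> cls ` K \<longleftrightarrow> A \<in> K"
proof
  assume "cls A \<in> cls ` K"
  then obtain B where B: "B \<in> K" "(\<lambda>n. A n - B n) \<in> G" by (auto simp: cls_eq_iff)
  then have "(\<lambda>n. (A n - B n) + B n) \<in> K"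
    by (intro ideal_add[OF assms(1) ideal_G[OF assms(1)]])
  then show "A \<in> K" by simp
qed auto

lemma closed_ideal_image:
  assumes K: "section_ideal K"
  shows "closed_ideal (cls ` K) Q"
  unfolding closed_ideal_def
proof
  interpret Q: ring Q by (rule ring_Q)
  have KS: "A \<in> S" if "A \<in> K" for A using ideal_S[OF K that] .
  show "ideal (cls ` K) Q"
  proof (rule idealI[OF ring_Q])
    show "subgroup (cls ` K) (add_monoid Q)"
    proof (rule Q.add.subgroupI)
      show "cls ` K \<subseteq> carrier Q" using KS by (auto simp: carrier_Q)
      show "cls ` K \<noteq> {}" using ideal_zero[OF K] by auto
      show "\<ominus>\<^bsub>Q\<^esub> X \<in> cls ` K" if "X \<in> cls ` K" for X
        using that by (auto simp: cls_uminus KS intro: ideal_uminus[OF K])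
      show "X \<oplus>\<^bsub>Q\<^esub> Y \<in> cls ` K" if "X \<in> cls ` K" "Y \<in> cls ` K" for X Y
        using that by (auto simp: cls_hom KS intro: ideal_add[OF K])
    qed
  qed (auto simp: carrier_Q cls_hom KS intro: ideal_left[OF K] ideal_right[OF K])
  show "norm_closed_in (cls ` K) Q"
    unfolding norm_closed_in_def
  proof (intro conjI allI ballI impI)
    show "cls ` K \<subseteq> carrier Q" using KS by (auto simp: carrier_Q)
    fix f :: "nat \<Rightarrow> op_seq set" and X assume "X \<in> carrier Q"
      and f: "(\<forall>n. f n \<in> cls ` K) \<and> (\<lambda>n. nrm Q (f n \<ominus>\<^bsub>Q\<^esub> X)) \<longlonglongrightarrow> 0"
    then obtain A where A: "A \<in> S" "X = cls A" by (auto simp: carrier_Q)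
    have "A \<in> K"
    proof (rule ideal_limit[OF K A(1)])
      fix \<epsilon> :: real assume "\<epsilon> > 0"
      then have "\<forall>\<^sub>F n in sequentially. nrm Q (f n \<ominus>\<^bsub>Q\<^esub> X) < \<epsilon>"
        using f by (intro order_tendstoD[where y = 0]) auto
      then obtain i where i: "nrm Q (f i \<ominus>\<^bsub>Q\<^esub> X) < \<epsilon>" by (auto simp: eventually_sequentially)
      obtain B where B: "B \<in> K" "f i = cls B" using f by blast
      let ?D = "\<lambda>n. B n - A n"
      have DS: "?D \<in> S" by (rule S_diff[OF KS[OF B(1)] A(1)])
      have "nrm Q (cls ?D) < \<epsilon>" using i by (simp add: A(2) B(2) cls_diff KS[OF B(1)] A(1))
      then obtain Z where Z: "Z \<in> cls ?D" "\<forall>n. norm (Z n) \<le> \<epsilon>" using nrm_cls(3)[OF DS] by blast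
      \<comment> \<open>A small quotient norm makes only some representative of the difference
        small; the discrepancy \<open>g\<close> is a null sequence and is absorbed into
        \<open>K\<close>.\<close>
      obtain g where g: "g \<in> G" "Z = (\<lambda>n. g n + (B n - A n))" using Z(1) by (auto simp: cls_eq)
      have "norm (Z n) \<le> \<epsilon>" for n using Z(2) by blast
      then have "\<forall>\<^sub>F n in sequentially. norm ((g n + B n) - A n) \<le> \<epsilon>"
        by (simp add: g(2) algebra_simps)
      moreover have "(\<lambda>n. g n + B n) \<in> K" by (rule ideal_add[OF K ideal_G[OF K g(1)] B(1)])
      ultimately show "\<exists>B\<in>K. \<forall>\<^sub>F n in sequentially. norm (B n - A n) \<le> \<epsilon>"
        by (intro bexI[of _ "\<lambda>n. g n + B n"])
    qed
    then show "X \<in> cls ` K" using A(2) by blast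
  qed
qed

text \<open>The image under \<open>cls\<close> is \<open>J_ideal N\<close>, by
  \<open>J_ideal_eq\<close>. The intersected family is nonempty because \<open>strong_null\<close>
  belongs to it.\<close>

definition band_ideal :: "op_seq set" where
  "band_ideal = \<Inter>{K. section_ideal K \<and> top_band \<in> K}"

lemma section_ideal_band_ideal: "section_ideal band_ideal"
  unfolding section_ideal_def
proof (intro conjI ballI allI impI)
  show "band_ideal \<subseteq> S"
    using section_ideal_strong_null top_band_strong_null ideal_S unfolding band_ideal_def by blast
  show "G \<subseteq> band_ideal" using ideal_G unfolding band_ideal_def by blast
  fix A assume A: "A \<in> S" and lim: "\<forall>\<epsilon>>0. \<exists>B\<in>band_ideal. \<forall>n. norm (B n - A n) \<le> \<epsilon>"
  show "A \<in> band_ideal"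
    unfolding band_ideal_def
  proof
    fix K assume "K \<in> {K. section_ideal K \<and> top_band \<in> K}"
    then have K: "section_ideal K" "band_ideal \<subseteq> K" by (auto simp: band_ideal_def)
    show "A \<in> K"
      by (rule ideal_limit[OF K(1) A]) (use lim K(2) in \<open>fastforce intro: always_eventually\<close>)
  qed
qed (auto simp: band_ideal_def intro: ideal_add ideal_left ideal_right)

lemma J_ideal_eq: "J_ideal N = cls ` band_ideal"
  unfolding J_ideal_def closed_ideal_generated_def one_minus_p1
proof
  have "top_band \<in> band_ideal" by (auto simp: band_ideal_def)
  then show "\<Inter>{I. closed_ideal I Q \<and> {cls top_band} \<subseteq> I} \<subseteq> cls ` band_ideal"
    using closed_ideal_image[OF section_ideal_band_ideal] by blast
  show "cls ` band_ideal \<subseteq> \<Inter>{I. closed_ideal I Q \<and> {cls top_band} \<subseteq> I}"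
  proof
    fix X assume "X \<in> cls ` band_ideal"
    then obtain A where A: "A \<in> band_ideal" "X = cls A" by blast
    have "X \<in> I" if I: "closed_ideal I Q" "cls top_band \<in> I" for I
    proof -
      have "top_band \<in> {A \<in> S. cls A \<in> I}" using I(2) band_S[of 0] by (simp add: band_0)
      then have "A \<in> {A \<in> S. cls A \<in> I}"
        using A(1) closed_ideal_preimage(1)[OF I(1)] unfolding band_ideal_def by blast
      then show ?thesis using A(2) by blast
    qed
    then show "X \<in> \<Inter>{I. closed_ideal I Q \<and> {cls top_band} \<subseteq> I}" by blast
  qed
qed

lemma unique_closed_ideal:
  "{I. closed_ideal I Q \<and> I \<noteq> {\<zero>\<^bsub>Q\<^esub>} \<and> I \<noteq> carrier Q} = {J_ideal N}"
proof (intro equalityI subsetI)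
  fix I assume "I \<in> {I. closed_ideal I Q \<and> I \<noteq> {\<zero>\<^bsub>Q\<^esub>} \<and> I \<noteq> carrier Q}"
  then have I: "closed_ideal I Q" "I \<noteq> {\<zero>\<^bsub>Q\<^esub>}" "I \<noteq> carrier Q" by auto
  obtain K where K: "section_ideal K" "I = cls ` K" using closed_ideal_preimage[OF I(1)] by blast
  have "\<not> K \<subseteq> G"
  proof
    assume "K \<subseteq> G"
    then have "cls A = \<zero>\<^bsub>Q\<^esub>" if "A \<in> K" for A using that by (auto simp: cls_zero cls_eq_iff)
    then have "I = {\<zero>\<^bsub>Q\<^esub>}" unfolding K(2) using ideal_zero[OF K(1)] by auto
    then show False using I(2) by simp
  qed
  then obtain A where "A \<in> K" "A \<notin> G" by blast
  then have band: "top_band \<in> K" using ideal_contains_top_band[OF K(1)] by blast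
  then have sub: "band_ideal \<subseteq> K" using K(1) by (auto simp: band_ideal_def)
  have "K \<subseteq> band_ideal"
  proof (rule ccontr)
    assume "\<not> K \<subseteq> band_ideal"
    then obtain B where "B \<in> K" "B \<notin> band_ideal" by blast
    moreover have "top_band \<in> band_ideal" by (auto simp: band_ideal_def)
    ultimately have "K = S"
      using ideal_above_top_band[OF section_ideal_band_ideal _ K(1) sub] by blast
    then show False using I(3) by (simp add: K(2) carrier_Q)
  qed
  then show "I \<in> {J_ideal N}" using sub by (simp add: K(2) J_ideal_eq)
next
  fix I assume "I \<in> {J_ideal N}"
  then have I: "I = cls ` band_ideal" by (simp add: J_ideal_eq)
  have "top_band \<in> band_ideal" by (auto simp: band_ideal_def)
  then have "cls top_band \<in> I" by (simp add: I)
  moreover have "cls top_band \<noteq> \<zero>\<^bsub>Q\<^esub>"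
    using top_band_not_G by (simp add: cls_zero cls_eq_iff)
  moreover have "band_ideal \<subseteq> strong_null"
    using section_ideal_strong_null top_band_strong_null unfolding band_ideal_def by blast
  then have "cls (\<lambda>n. proj (N ^ n)) \<notin> I"
    unfolding I cls_image_iff[OF section_ideal_band_ideal one_S] using one_not_strong_null by blast
  moreover have "cls (\<lambda>n. proj (N ^ n)) \<in> carrier Q" using one_S by (auto simp: carrier_Q)
  ultimately show "I \<in> {I. closed_ideal I Q \<and> I \<noteq> {\<zero>\<^bsub>Q\<^esub>} \<and> I \<noteq> carrier Q}"
    using closed_ideal_image[OF section_ideal_band_ideal] I by auto
qed

end

theorem corollary6p9:
  fixes N :: nat
  assumes "N \<ge> 2"
  shows "{I. closed_ideal I (S_quot N) \<and> I \<noteq> {\<zero>\<^bsub>S_quot N\<^esub>} \<and> I \<noteq> carrier (S_quot N)} = {J_ideal N}"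
  using cuntz_sections.unique_closed_ideal[OF cuntz_sections.intro[OF assms]] .

end
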